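(* Let $T\in(0,\infty)$, let $D\subset\mathbb{R}^{d+1}$ be an $A$-type bounded domain with $\bar D\subset \mathcal{O}_T=(0,T)\times\mathbb{R}^d$, and let $0<\beta<1$. Let $g\in C^\beta(\mathbb{R}_+\times\mathbb{R}^d)$ be a non-random function with $g(0,0)=0$, and let $K:\mathbb{R}\times\mathbb{R}^d\to\mathbb{R}$ be a non-random measurable kernel. Assume that there are constants $\gamma_1,\gamma_2>0$, $N_0>0$ and $N_1=N_1(T,\beta)>0$ such that for all $0\le s<t\le T$ $$\int_0^s\Big(\int_{\mathbb{R}^d}|K(t-r,z)-K(s-r,z)|(1+|z|^\beta)\,dz\Big)^2dr\le N_1(t-s)^{\gamma_1},$$ $$\int_0^s\Big(\int_{\mathbb{R}^d}|K(s-r,z)|\,dz\Big)^2dr\le N_0,$$ $$\int_s^t\Big(\int_{\mathbb{R}^d}|K(t-r,z)|(1+|z|^\beta)\,dz\Big)^2dr\le N_1(t-s)^{\gamma_2}.$$ Let $\mathcal{K}g(t,x)=\int_0^t\int_{\mathbb{R}^d}K(t-r,y)\,g(r,x-y)\,dy\,dW(r)$ and $\gamma=\min\{\gamma_1,\gamma_2,\beta\}$. Then for every $p\ge1$, $$\mathcal{K}g\in C^{\gamma}((\bar D;\delta);L^p(\Omega)).$$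
   Context: $(\Omega,\mathcal{F},\mathbb{P})$ is a complete probability space with a filtration $\{\mathcal{F}_t\}_{t\in[0,T]}$ containing all null sets, and $W$ is a one-dimensional $\{\mathcal{F}_t\}$-Wiener process. The parabolic distance on $\mathbb{R}\times\mathbb{R}^d$ is $\delta((t,x),(s,y))=\max\{|x-y|,|t-s|^{1/2}\}$, and $Q_c(t,x)=(t-c^2,t+c^2)\times B_c(x)$ is its ball of radius $c$. For $D\subset\mathbb{R}^{d+1}$ and $X\in D$ put $D(X,\rho)=D\cap Q_\rho(X)$; $\operatorname{diam}D$ is the diameter with respect to $\delta$. $D$ is called $A$-type if there is a constant $A>0$ such that $|D(X,\rho)|\ge A|Q_\rho(X)|$ (Lebesgue measure) for all $X\in D$ and $0<\rho\le\operatorname{diam}D$. $g\in C^\beta(\mathbb{R}_+\times\mathbb{R}^d)$ means that there is a constant $C_g$ with $|g(X)-g(Y)|\le C_g\,\delta(X,Y)^\beta$ for all $X,Y$ (with $g$ extended continuously to $t=0$). $u\in C^\gamma((\bar D;\delta);L^p(\Omega))$ means that $u$ is $\gamma$-Hölder continuous with respect to $\delta$ as an $L^p(\Omega)$-valued map on $\bar D$: $\sup_{X\in\bar D}\|u(X)\|_{L^p(\Omega)}+\sup_{X\ne Y\in\bar D}\frac{\|u(X)-u(Y)\|_{L^p(\Omega)}}{\delta(X,Y)^\gamma}<\infty$. *)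

theory Defs
  imports "HOL-Probability.Probability"
begin

section \<open>Parabolic geometry\<close>

definition pdist :: "real \<times> (real ^ 'd) \<Rightarrow> real \<times> (real ^ 'd) \<Rightarrow> real" where
  "pdist X Y = max (norm (snd X - snd Y)) (sqrt \<bar>fst X - fst Y\<bar>)"

definition pball :: "real \<times> (real ^ 'd) \<Rightarrow> real \<Rightarrow> (real \<times> (real ^ 'd)) set" where
  "pball X c = {fst X - c\<^sup>2 <..< fst X + c\<^sup>2} \<times> ball (snd X) c"

text \<open>The supremum is taken in the reals, so this is the diameter only for nonempty bounded sets.\<close>
definition pdiameter :: "(real \<times> (real ^ 'd)) set \<Rightarrow> real" where
  "pdiameter D = (SUP (X, Y)\<in>D \<times> D. pdist X Y)"

definition A_type :: "(real \<times> (real ^ 'd)) set \<Rightarrow> bool" where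
  "A_type D \<longleftrightarrow> (\<exists>A>0. \<forall>X\<in>D. \<forall>\<rho>. 0 < \<rho> \<and> \<rho> \<le> pdiameter D \<longrightarrow>
     measure lebesgue (D \<inter> pball X \<rho>) \<ge> A * measure lebesgue (pball X \<rho>))"

definition pholder_on :: "(real \<times> (real ^ 'd)) set \<Rightarrow> real \<Rightarrow> (real \<times> (real ^ 'd) \<Rightarrow> real) \<Rightarrow> bool" where
  "pholder_on S \<beta> g \<longleftrightarrow> (\<exists>C. \<forall>X\<in>S. \<forall>Y\<in>S. \<bar>g X - g Y\<bar> \<le> C * pdist X Y powr \<beta>)"


section \<open>Hoelder spaces of random fields\<close>

definition in_Lp :: "'a measure \<Rightarrow> real \<Rightarrow> ('a \<Rightarrow> real) \<Rightarrow> bool" where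
  "in_Lp M p f \<longleftrightarrow> f \<in> borel_measurable M \<and> integrable M (\<lambda>\<omega>. \<bar>f \<omega>\<bar> powr p)"

definition Lp_norm :: "'a measure \<Rightarrow> real \<Rightarrow> ('a \<Rightarrow> real) \<Rightarrow> real" where
  "Lp_norm M p f = (\<integral>\<omega>. \<bar>f \<omega>\<bar> powr p \<partial>M) powr (1 / p)"

definition pholder_Lp ::
  "'a measure \<Rightarrow> real \<Rightarrow> real \<Rightarrow> (real \<times> (real ^ 'd)) set \<Rightarrow> (real \<times> (real ^ 'd) \<Rightarrow> 'a \<Rightarrow> real) \<Rightarrow> bool" where
  "pholder_Lp M p \<gamma> S u \<longleftrightarrow>
     (\<forall>X\<in>S. in_Lp M p (u X)) \<and>
     bdd_above {Lp_norm M p (u X) | X. X \<in> S} \<and>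
     bdd_above {Lp_norm M p (\<lambda>\<omega>. u X \<omega> - u Y \<omega>) / pdist X Y powr \<gamma> | X Y. X \<in> S \<and> Y \<in> S \<and> X \<noteq> Y}"


section \<open>Wiener processes\<close>

definition complete_filtration :: "'a measure \<Rightarrow> real \<Rightarrow> (real \<Rightarrow> 'a measure) \<Rightarrow> bool" where
  "complete_filtration M T F \<longleftrightarrow>
     (\<forall>t\<in>{0..T}. subalgebra M (F t) \<and> null_sets M \<subseteq> sets (F t)) \<and>
     (\<forall>s t. 0 \<le> s \<and> s \<le> t \<and> t \<le> T \<longrightarrow> sets (F s) \<subseteq> sets (F t))"

definition wiener_process ::
  "'a measure \<Rightarrow> real \<Rightarrow> (real \<Rightarrow> 'a measure) \<Rightarrow> (real \<Rightarrow> 'a \<Rightarrow> real) \<Rightarrow> bool" where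
  "wiener_process M T F W \<longleftrightarrow>
     (\<forall>t\<in>{0..T}. W t \<in> borel_measurable (F t)) \<and>
     (AE \<omega> in M. W 0 \<omega> = 0) \<and>
     (AE \<omega> in M. continuous_on {0..T} (\<lambda>t. W t \<omega>)) \<and>
     (\<forall>s t. 0 \<le> s \<and> s < t \<and> t \<le> T \<longrightarrow>
        distributed M lborel (\<lambda>\<omega>. W t \<omega> - W s \<omega>) (normal_density 0 (sqrt (t - s))) \<and>
        prob_space.indep_set M (sets (F s))
          {(\<lambda>\<omega>. W t \<omega> - W s \<omega>) -` B \<inter> space M | B. B \<in> sets borel})"


section \<open>The Ito integral\<close>

text \<open>
  A simple process on \<open>[0, t]\<close> is given by a partition \<open>\<tau> 0 \<le> \<dots> \<le> \<tau> n\<close> and bounded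
  random variables \<open>\<xi> i\<close>, measurable with respect to \<open>F (\<tau> i)\<close>.
\<close>
definition simple_process_data ::
  "'a measure \<Rightarrow> (real \<Rightarrow> 'a measure) \<Rightarrow> real \<Rightarrow> nat \<Rightarrow> (nat \<Rightarrow> real) \<Rightarrow> (nat \<Rightarrow> 'a \<Rightarrow> real) \<Rightarrow> bool" where
  "simple_process_data M F t n \<tau> \<xi> \<longleftrightarrow>
     0 \<le> \<tau> 0 \<and> \<tau> n \<le> t \<and> (\<forall>i<n. \<tau> i \<le> \<tau> (Suc i)) \<and>
     (\<forall>i<n. \<xi> i \<in> borel_measurable (F (\<tau> i)) \<and> (\<exists>C. \<forall>\<omega>\<in>space M. \<bar>\<xi> i \<omega>\<bar> \<le> C))"

definition simple_process :: "nat \<Rightarrow> (nat \<Rightarrow> real) \<Rightarrow> (nat \<Rightarrow> 'a \<Rightarrow> real) \<Rightarrow> real \<Rightarrow> 'a \<Rightarrow> real" where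
  "simple_process n \<tau> \<xi> r \<omega> = (\<Sum>i<n. \<xi> i \<omega> * indicator {\<tau> i <.. \<tau> (Suc i)} r)"

definition simple_integral ::
  "(real \<Rightarrow> 'a \<Rightarrow> real) \<Rightarrow> nat \<Rightarrow> (nat \<Rightarrow> real) \<Rightarrow> (nat \<Rightarrow> 'a \<Rightarrow> real) \<Rightarrow> 'a \<Rightarrow> real" where
  "simple_integral W n \<tau> \<xi> \<omega> = (\<Sum>i<n. \<xi> i \<omega> * (W (\<tau> (Suc i)) \<omega> - W (\<tau> i) \<omega>))"

text \<open>
  \<open>I\<close> is a version of the Ito integral of \<open>f\<close> over \<open>[0, t]\<close>: simple processes converge to \<open>f\<close>
  in \<open>L\<^sup>2\<close> of the product of Lebesgue measure on \<open>[0, t]\<close> and \<open>M\<close>, and their elementary integrals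
  converge to \<open>I\<close> in \<open>L\<^sup>2\<close> of \<open>M\<close>. Adaptedness of \<open>f\<close> (up to null sets) is a consequence of the
  first convergence.
\<close>
definition has_ito_integral ::
  "'a measure \<Rightarrow> (real \<Rightarrow> 'a measure) \<Rightarrow> (real \<Rightarrow> 'a \<Rightarrow> real) \<Rightarrow> real \<Rightarrow>
   (real \<Rightarrow> 'a \<Rightarrow> real) \<Rightarrow> ('a \<Rightarrow> real) \<Rightarrow> bool" where
  "has_ito_integral M F W t f I \<longleftrightarrow>
     I \<in> borel_measurable M \<and>
     (\<lambda>(r, \<omega>). indicator {0..t} r * f r \<omega>) \<in> borel_measurable (completion (lborel \<Otimes>\<^sub>M M)) \<and>
     (\<exists>n \<tau> \<xi>. (\<forall>k. simple_process_data M F t (n k) (\<tau> k) (\<xi> k)) \<and>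
        (\<lambda>k. \<integral>\<^sup>+ (r, \<omega>). ennreal (indicator {0..t} r * (simple_process (n k) (\<tau> k) (\<xi> k) r \<omega> - f r \<omega>)\<^sup>2)
               \<partial>completion (lborel \<Otimes>\<^sub>M M)) \<longlonglongrightarrow> 0 \<and>
        (\<lambda>k. \<integral>\<^sup>+ \<omega>. ennreal ((simple_integral W (n k) (\<tau> k) (\<xi> k) \<omega> - I \<omega>)\<^sup>2) \<partial>M) \<longlonglongrightarrow> 0)"

text \<open>The Ito integral is determined only up to almost sure equality; some version is chosen.\<close>
definition ito_integral ::
  "'a measure \<Rightarrow> (real \<Rightarrow> 'a measure) \<Rightarrow> (real \<Rightarrow> 'a \<Rightarrow> real) \<Rightarrow> real \<Rightarrow>
   (real \<Rightarrow> 'a \<Rightarrow> real) \<Rightarrow> 'a \<Rightarrow> real" where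
  "ito_integral M F W t f = (SOME I. has_ito_integral M F W t f I)"

definition stochastic_convolution ::
  "'a measure \<Rightarrow> (real \<Rightarrow> 'a measure) \<Rightarrow> (real \<Rightarrow> 'a \<Rightarrow> real) \<Rightarrow> (real \<times> (real ^ 'd) \<Rightarrow> real) \<Rightarrow>
   (real \<times> (real ^ 'd) \<Rightarrow> real) \<Rightarrow> real \<times> (real ^ 'd) \<Rightarrow> 'a \<Rightarrow> real" where
  "stochastic_convolution M F W K g X =
     ito_integral M F W (fst X) (\<lambda>r \<omega>. \<integral>y. K (fst X - r, y) * g (r, snd X - y) \<partial>lebesgue)"

end

theory Submission
  imports Defs
begin

text \<open>
  The integrand of the stochastic convolution is non-random, so increments of the field are Wiener
  integrals of deterministic functions \<open>h\<close>: a version of them is the limit of Gaussian variables, whose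
  exponential moments bound every \<open>L\<^sup>p\<close> norm by a constant multiple of the \<open>L\<^sup>2[0, T]\<close> norm of \<open>h\<close>.
  For \<open>X = (t, x)\<close> and \<open>Y = (s, y)\<close> with \<open>s \<le> t\<close>, the function \<open>h\<close> splits over \<open>[0, s]\<close> into a term
  with \<open>K(t - r, z) - K(s - r, z)\<close>, where \<open>g\<close> is controlled by its growth, and a term with
  \<open>g(r, x - z) - g(r, y - z)\<close>, where \<open>g\<close> is controlled by its Hoelder seminorm; over \<open>[s, t]\<close> only the
  growth of \<open>g\<close> enters. The three hypotheses on \<open>K\<close> bound the squares of the three \<open>L\<^sup>2\<close> norms by
  multiples of \<open>(t - s) powr \<gamma>\<^sub>1\<close>, \<open>norm (x - y) powr (2 * \<beta>)\<close> and \<open>(t - s) powr \<gamma>\<^sub>2\<close>, and \<open>t - s \<le> \<delta>(X, Y)\<^sup>2\<close>.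
\<close>


section \<open>Density of step functions in \<open>L\<^sup>2[0, t]\<close>\<close>

text \<open>The obstacle is that \<open>ito_integral\<close> picks an arbitrary version: the simple
  processes behind it may be random, and no moment can be read off them. Two facts get around this.
  Some version exists for every integrand that occurs, so the choice is meaningful; and versions
  agree almost surely, so a chosen increment may be replaced by a version built from deterministic
  step functions, for which Gaussian exponential moments are available. For the sake of the second
  fact the isometry must cover random coefficients, although only deterministic ones are ever
  estimated. Boundedness of \<open>D\<close> enters when the three powers of the distance are
  reduced to the smallest one: surplus exponents turn into constants. A further difficulty is that
  \<open>K\<close> is Lebesgue measurable on the product, so a section at a given time need not be
  measurable. A Borel version of \<open>K\<close> agrees with it for almost every time, and all
  estimates are made for that version.\<close>

lemma square_sum3_le: "(a + b + c)\<^sup>2 \<le> 3 * a\<^sup>2 + 3 * b\<^sup>2 + 3 * (c::real)\<^sup>2"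
proof -
  have "3 * a\<^sup>2 + 3 * b\<^sup>2 + 3 * c\<^sup>2 - (a + b + c)\<^sup>2 = (a - b)\<^sup>2 + (a - c)\<^sup>2 + (b - c)\<^sup>2"
    by (simp add: power2_eq_square algebra_simps)
  then show ?thesis
    by (smt (verit) zero_le_power2)
qed

text \<open>Stands in for the triangle inequality of a weighted L2 norm; integrals of squares cost
  the factor 3 but avoid roots and finiteness conditions. The weight \<open>q\<close> is a time
  cutoff or the constant 1, and shorter sums are padded with 0, which explains shapes such as
  \<open>1 * (...)\<close> and \<open>+ 0\<close> in later goals.\<close>

lemma nn_integral_square_sum3:
  fixes q u v w :: "'b \<Rightarrow> real"
  assumes [measurable]: "(\<lambda>x. q x * (u x)\<^sup>2) \<in> borel_measurable N" "(\<lambda>x. q x * (v x)\<^sup>2) \<in> borel_measurable N"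
    "(\<lambda>x. q x * (w x)\<^sup>2) \<in> borel_measurable N" and q: "\<And>x. 0 \<le> q x"
  shows "(\<integral>\<^sup>+x. ennreal (q x * (u x + v x + w x)\<^sup>2) \<partial>N) \<le>
     3 * (\<integral>\<^sup>+x. ennreal (q x * (u x)\<^sup>2) \<partial>N) + 3 * (\<integral>\<^sup>+x. ennreal (q x * (v x)\<^sup>2) \<partial>N)
     + 3 * (\<integral>\<^sup>+x. ennreal (q x * (w x)\<^sup>2) \<partial>N)"
proof -
  have *: "ennreal (q x * (u x + v x + w x)\<^sup>2) \<le>
      3 * ennreal (q x * (u x)\<^sup>2) + 3 * ennreal (q x * (v x)\<^sup>2) + 3 * ennreal (q x * (w x)\<^sup>2)" for x
  proof -
    have "q x * (u x + v x + w x)\<^sup>2 \<le> q x * (3 * (u x)\<^sup>2 + 3 * (v x)\<^sup>2 + 3 * (w x)\<^sup>2)"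
      using q square_sum3_le by (intro mult_left_mono)
    then have "ennreal (q x * (u x + v x + w x)\<^sup>2) \<le>
        ennreal (3 * (q x * (u x)\<^sup>2) + 3 * (q x * (v x)\<^sup>2) + 3 * (q x * (w x)\<^sup>2))"
      by (intro ennreal_leI) (simp add: algebra_simps)
    also have "\<dots> = 3 * ennreal (q x * (u x)\<^sup>2) + 3 * ennreal (q x * (v x)\<^sup>2) + 3 * ennreal (q x * (w x)\<^sup>2)"
      using q by (simp add: ennreal_plus ennreal_mult)
    finally show ?thesis .
  qed
  show ?thesis
    by (rule order_trans[OF nn_integral_mono[OF *]]) (simp add: nn_integral_add nn_integral_cmult)
qed

lemma nn_integral_square_tendsto_0:
  fixes u :: "nat \<Rightarrow> real \<Rightarrow> real"
  assumes [measurable]: "\<And>n. u n \<in> borel_measurable borel" "v \<in> borel_measurable borel" "w \<in> borel_measurable borel"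
    and conv: "AE r in lborel. r \<in> {0..t} \<longrightarrow> (\<lambda>n. u n r) \<longlonglongrightarrow> v r"
    and bound: "\<And>n. AE r in lborel. r \<in> {0..t} \<longrightarrow> (u n r - v r)\<^sup>2 \<le> w r"
    and fin: "(\<integral>\<^sup>+r. ennreal (indicator {0..t} r * w r) \<partial>lborel) < \<infinity>"
  shows "(\<lambda>n. \<integral>\<^sup>+r. ennreal (indicator {0..t} r * (u n r - v r)\<^sup>2) \<partial>lborel) \<longlonglongrightarrow> 0"
proof -
  have "(\<lambda>n. \<integral>\<^sup>+r. ennreal (indicator {0..t} r * (u n r - v r)\<^sup>2) \<partial>lborel) \<longlonglongrightarrow> (\<integral>\<^sup>+r. 0 \<partial>(lborel::real measure))"
  proof (rule nn_integral_dominated_convergence[where w = "\<lambda>r. ennreal (indicator {0..t} r * w r)"])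
    show "AE r in lborel. ennreal (indicator {0..t} r * (u n r - v r)\<^sup>2) \<le> ennreal (indicator {0..t} r * w r)" for n
      using bound[of n] by eventually_elim (auto simp: indicator_def intro!: ennreal_leI)
    show "AE r in lborel. (\<lambda>n. ennreal (indicator {0..t} r * (u n r - v r)\<^sup>2)) \<longlonglongrightarrow> 0"
      using conv
    proof eventually_elim
      case (elim r)
      show ?case
      proof (cases "r \<in> {0..t}")
        case True
        then have "(\<lambda>n. ennreal ((u n r - v r)\<^sup>2)) \<longlonglongrightarrow> ennreal ((v r - v r)\<^sup>2)"
          using elim by (intro tendsto_intros) auto
        with True show ?thesis by simp
      qed auto
    qed
  qed (use fin in \<open>auto simp: less_top\<close>)
  then show ?thesis by simp
qed

text \<open>The cells partition \<open>(0, t]\<close>, so exactly one summand survives. The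
  surviving index depends on \<open>r\<close> alone and not on the coefficients, and its grid point
  is within one mesh width of \<open>r\<close>.\<close>

lemma sum_grid_indicator:
  fixes r t :: real
  assumes "0 < r" "r \<le> t" "0 < n"
  shows "\<exists>i<n. \<bar>t * real i / real n - r\<bar> \<le> t / real n \<and>
    (\<forall>c. (\<Sum>j<n. c j * indicator {t * real j / real n <.. t * real (Suc j) / real n} r) = (c i :: real))"
proof -
  \<comment> \<open>The cells are closed on the right, so the index is a ceiling minus one; a floor
    would be wrong at grid points.\<close>
  define i where "i = nat (\<lceil>r * n / t\<rceil> - 1)"
  have pos: "0 < r * n / t" using assms by auto
  then have c1: "1 \<le> \<lceil>r * n / t\<rceil>" by linarith
  have le: "r * n / t \<le> n" using assms by (simp add: field_simps)
  have i_real: "real i = of_int \<lceil>r * n / t\<rceil> - 1"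
    using c1 by (simp add: i_def)
  have lo: "real i < r * n / t" and hi: "r * n / t \<le> real i + 1"
    unfolding i_real by linarith+
  have "i < n" using lo le by linarith
  have lo': "t * real i / n < r" and hi': "r \<le> t * (real i + 1) / n"
    using lo hi assms by (simp_all add: field_simps)
  have uniq: "j = i" if "t * real j / n < r" "r \<le> t * (real j + 1) / n" for j
  proof -
    have "real j < r * n / t" "r * n / t \<le> real j + 1"
      using that assms by (simp_all add: field_simps)
    then show "j = i" using lo hi by linarith
  qed
  have ind: "indicator {t * real j / n <.. t * real (Suc j) / n} r = (if j = i then 1 else 0 :: real)" for j
  proof -
    have "real (Suc j) = real j + 1" by simp
    then have "r \<in> {t * real j / n <.. t * real (Suc j) / n} \<longleftrightarrow> j = i"
      using lo' hi' uniq[of j] by (simp only: greaterThanAtMost_iff) blast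
    then show ?thesis by (simp only: indicator_def of_bool_def)
  qed
  show ?thesis
  proof (intro exI[of _ i] conjI allI)
    show "\<bar>t * real i / real n - r\<bar> \<le> t / real n"
    proof -
      have "t * (real i + 1) / n = t * real i / n + t / n"
        by (simp add: distrib_left add_divide_distrib)
      with lo' hi' show ?thesis by linarith
    qed
    show "(\<Sum>j<n. c j * indicator {t * real j / real n <.. t * real (Suc j) / real n} r) = c i" for c :: "nat \<Rightarrow> real"
      unfolding ind using \<open>i < n\<close> by (simp add: if_distrib cong: if_cong)
  qed fact
qed

lemma clamp_diff_square_le:
  fixes a b :: real
  assumes "\<bar>a\<bar> \<le> B" "\<bar>b\<bar> \<le> B"
  shows "(a - b)\<^sup>2 \<le> (2 * B)\<^sup>2"
  using assms by (intro abs_le_square_iff[THEN iffD1]) auto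

text \<open>Three approximations are chained: truncation of \<open>f\<close> to \<open>h\<close>, a
  clipped continuous function \<open>k\<close> near \<open>h\<close>, and sampling of
  \<open>k\<close> on a fine uniform grid. The bound gained by truncation supplies the constant
  dominating function for the other two limits.\<close>

lemma step_functions_dense_L2:
  fixes f :: "real \<Rightarrow> real"
  assumes f[measurable]: "f \<in> borel_measurable borel" and t: "0 < t" and e: "0 < (e :: real)"
    and fin: "(\<integral>\<^sup>+r. ennreal (indicator {0..t} r * (f r)\<^sup>2) \<partial>lborel) < \<infinity>"
  shows "\<exists>n c. 0 < n \<and> (\<integral>\<^sup>+r. ennreal (indicator {0..t} r *
     ((\<Sum>i<n. c i * indicator {t * real i / real n <.. t * real (Suc i) / real n} r) - f r)\<^sup>2) \<partial>lborel) < e"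
proof -
  \<comment> \<open>Three errors, each charged with the factor 3 of
    \<open>nn_integral_square_sum3\<close>, add up to \<open>9 * (e / 9) = e\<close>.\<close>
  define e' where "e' = ennreal (e / 9)"
  have e': "0 < e'" using e by (simp add: e'_def)
  define cut where "cut B x = max (- real B) (min (real B) x)" for B :: nat and x :: real
  have cut_meas[measurable]: "cut B \<in> borel_measurable borel" for B
    unfolding cut_def by measurable
  have cut_le: "\<bar>cut B x\<bar> \<le> real B" for B x unfolding cut_def by auto
  have "(\<lambda>B. \<integral>\<^sup>+r. ennreal (indicator {0..t} r * (cut B (f r) - f r)\<^sup>2) \<partial>lborel) \<longlonglongrightarrow> 0"
  proof (rule nn_integral_square_tendsto_0[where w = "\<lambda>r. (f r)\<^sup>2"])
    show "AE r in lborel. r \<in> {0..t} \<longrightarrow> (\<lambda>B. cut B (f r)) \<longlonglongrightarrow> f r"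
    proof (intro always_eventually allI impI)
      fix r
      have "\<forall>\<^sub>F B in sequentially. cut B (f r) = f r"
        using eventually_ge_at_top[of "nat \<lceil>\<bar>f r\<bar>\<rceil>"]
      proof eventually_elim
        case (elim B)
        then have "\<bar>f r\<bar> \<le> real B" by linarith
        then show ?case by (auto simp: cut_def)
      qed
      then show "(\<lambda>B. cut B (f r)) \<longlonglongrightarrow> f r" by (simp add: tendsto_eventually)
    qed
    show "AE r in lborel. r \<in> {0..t} \<longrightarrow> (cut n (f r) - f r)\<^sup>2 \<le> (f r)\<^sup>2" for n
      by (intro always_eventually allI impI abs_le_square_iff[THEN iffD1]) (auto simp: cut_def)
  qed (use fin in auto)
  then have "\<forall>\<^sub>F B in sequentially. (\<integral>\<^sup>+r. ennreal (indicator {0..t} r * (cut B (f r) - f r)\<^sup>2) \<partial>lborel) < e'"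
    using e' by (simp add: order_tendsto_iff)
  then obtain B where B: "(\<integral>\<^sup>+r. ennreal (indicator {0..t} r * (cut B (f r) - f r)\<^sup>2) \<partial>lborel) < e'"
    using eventually_happens'[OF sequentially_bot] by blast
  define h where "h = (\<lambda>r. cut B (f r))"
  have [measurable]: "h \<in> borel_measurable borel" unfolding h_def by measurable
  have h_le: "\<bar>h r\<bar> \<le> real B" for r by (simp add: h_def cut_le)
  have fin_const: "(\<integral>\<^sup>+r. ennreal (indicator {0..t} r * (2 * real B)\<^sup>2) \<partial>lborel) < \<infinity>"
  proof -
    have "(\<integral>\<^sup>+r. ennreal (indicator {0..t} r * (2 * real B)\<^sup>2) \<partial>lborel) = (\<integral>\<^sup>+r. ennreal ((2 * real B)\<^sup>2) * indicator {0..t} r \<partial>lborel)"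
      by (intro nn_integral_cong) (auto simp: indicator_def)
    also have "\<dots> < \<infinity>" using t by (simp add: nn_integral_cmult_indicator ennreal_mult_less_top)
    finally show ?thesis .
  qed
  \<comment> \<open>\<open>measurable_on\<close> unfolds to a sequence of continuous functions
    converging off a negligible set, so the continuous approximants come for free.\<close>
  have "h measurable_on UNIV"
    by (intro lebesgue_measurable_imp_measurable_on measurable_completion) auto
  then obtain Z G where Z: "negligible Z" and G: "\<And>n. continuous_on UNIV (G n)"
    and lim: "\<And>x. x \<notin> Z \<Longrightarrow> (\<lambda>n. G n x) \<longlonglongrightarrow> h x"
    unfolding measurable_on_def by auto
  have AE_Z: "AE r in lborel. r \<notin> Z"
  proof -
    have "AE r in lebesgue. r \<notin> Z"
      using Z by (simp add: negligible_iff_null_sets AE_not_in)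
    then show ?thesis by (rule AE_completion_iff[THEN iffD1])
  qed
  have cont_cut: "continuous_on UNIV (cut B)"
    unfolding cut_def by (intro continuous_intros)
  \<comment> \<open>The functions \<open>G n\<close> may be unbounded. Clipping at \<open>B\<close>
    keeps them continuous and does not change the limit, because \<open>h\<close> already takes
    values between \<open>- B\<close> and \<open>B\<close>.\<close>
  have Gcut: "continuous_on UNIV (\<lambda>r. cut B (G n r))" for n
    using continuous_on_compose2[OF cont_cut G] by simp
  have [measurable]: "(\<lambda>r. cut B (G n r)) \<in> borel_measurable borel" for n
    using Gcut by (rule borel_measurable_continuous_onI)
  have "(\<lambda>n. \<integral>\<^sup>+r. ennreal (indicator {0..t} r * (cut B (G n r) - h r)\<^sup>2) \<partial>lborel) \<longlonglongrightarrow> 0"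
  proof (rule nn_integral_square_tendsto_0[where w = "\<lambda>r. (2 * real B)\<^sup>2"])
    show "AE r in lborel. r \<in> {0..t} \<longrightarrow> (\<lambda>n. cut B (G n r)) \<longlonglongrightarrow> h r"
      using AE_Z
    proof eventually_elim
      case (elim r)
      have "(\<lambda>n. cut B (G n r)) \<longlonglongrightarrow> cut B (h r)"
        using continuous_on_tendsto_compose[OF cont_cut lim[OF elim]] by simp
      moreover have "cut B (h r) = h r" by (auto simp: h_def cut_def)
      ultimately show ?case by simp
    qed
    show "AE r in lborel. r \<in> {0..t} \<longrightarrow> (cut B (G n r) - h r)\<^sup>2 \<le> (2 * real B)\<^sup>2" for n
      using clamp_diff_square_le cut_le h_le by (intro always_eventually allI impI) blast
  qed (use fin_const in auto)
  then have "\<forall>\<^sub>F n in sequentially. (\<integral>\<^sup>+r. ennreal (indicator {0..t} r * (cut B (G n r) - h r)\<^sup>2) \<partial>lborel) < e'"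
    using e' by (simp add: order_tendsto_iff)
  then obtain m where m: "(\<integral>\<^sup>+r. ennreal (indicator {0..t} r * (cut B (G m r) - h r)\<^sup>2) \<partial>lborel) < e'"
    using eventually_happens'[OF sequentially_bot] by blast
  define k where "k = (\<lambda>r. cut B (G m r))"
  have [measurable]: "k \<in> borel_measurable borel" unfolding k_def by measurable
  have k_le: "\<bar>k r\<bar> \<le> real B" for r by (simp add: k_def cut_le)
  define \<phi> where "\<phi> n r = (\<Sum>i<n. k (t * real i / real n) * indicator {t * real i / real n <.. t * real (Suc i) / real n} r)"
    for n r
  have [measurable]: "\<phi> n \<in> borel_measurable borel" for n unfolding \<phi>_def by measurable
  have \<phi>_grid: "\<exists>i. \<bar>t * real i / real (Suc n) - r\<bar> \<le> t / real (Suc n) \<and> \<phi> (Suc n) r = k (t * real i / real (Suc n))"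
    if r: "0 < r" "r \<le> t" for n r
  proof -
    obtain i where "\<bar>t * real i / real (Suc n) - r\<bar> \<le> t / real (Suc n)"
      "\<forall>c. (\<Sum>j<Suc n. c j * indicator {t * real j / real (Suc n) <.. t * real (Suc j) / real (Suc n)} r) = (c i :: real)"
      using sum_grid_indicator[OF r zero_less_Suc, of n] by auto
    then show ?thesis
      unfolding \<phi>_def by (intro exI[of _ i] conjI) (assumption, erule spec)
  qed
  \<comment> \<open>The first cell is open on the left, so step functions vanish at 0; this point is
    discarded as a null set.\<close>
  have AE_pos: "AE r in lborel. r \<noteq> (0::real)" by (rule AE_lborel_singleton)
  have "(\<lambda>n. \<integral>\<^sup>+r. ennreal (indicator {0..t} r * (\<phi> (Suc n) r - k r)\<^sup>2) \<partial>lborel) \<longlonglongrightarrow> 0"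
  proof (rule nn_integral_square_tendsto_0[where w = "\<lambda>r. (2 * real B)\<^sup>2"])
    show "AE r in lborel. r \<in> {0..t} \<longrightarrow> (\<lambda>n. \<phi> (Suc n) r) \<longlonglongrightarrow> k r"
      using AE_pos
    proof eventually_elim
      case (elim r)
      show ?case
      proof
        assume r: "r \<in> {0..t}"
        have "\<exists>i. \<bar>t * real i / real (Suc n) - r\<bar> \<le> t / real (Suc n) \<and> \<phi> (Suc n) r = k (t * real i / real (Suc n))" for n
          using \<phi>_grid[of r n] r elim by auto
        then obtain i where i: "\<And>n. \<bar>t * real (i n) / real (Suc n) - r\<bar> \<le> t / real (Suc n)"
          "\<And>n. \<phi> (Suc n) r = k (t * real (i n) / real (Suc n))" by metis
        have "(\<lambda>n. t * real (i n) / real (Suc n) - r) \<longlonglongrightarrow> 0"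
        proof (rule Lim_null_comparison)
          show "\<forall>\<^sub>F n in sequentially. norm (t * real (i n) / real (Suc n) - r) \<le> t / real (Suc n)"
            using i(1) by (intro always_eventually) auto
          show "(\<lambda>n. t / real (Suc n)) \<longlonglongrightarrow> 0"
            using LIMSEQ_Suc[OF lim_const_over_n[of t]] by simp
        qed
        then have "(\<lambda>n. t * real (i n) / real (Suc n)) \<longlonglongrightarrow> r" by (rule LIM_zero_cancel)
        from continuous_on_tendsto_compose[OF Gcut[of m] this]
        have "(\<lambda>n. k (t * real (i n) / real (Suc n))) \<longlonglongrightarrow> k r" unfolding k_def by simp
        then show "(\<lambda>n. \<phi> (Suc n) r) \<longlonglongrightarrow> k r" by (simp only: i(2))
      qed
    qed
    show "AE r in lborel. r \<in> {0..t} \<longrightarrow> (\<phi> (Suc n) r - k r)\<^sup>2 \<le> (2 * real B)\<^sup>2" for n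
      using AE_pos
    proof eventually_elim
      case (elim r)
      show ?case
      proof
        assume r: "r \<in> {0..t}"
        have "\<exists>i. \<phi> (Suc n) r = k (t * real i / real (Suc n))"
          using \<phi>_grid[of r n] r elim by auto
        then have "\<bar>\<phi> (Suc n) r\<bar> \<le> real B" using k_le by metis
        then show "(\<phi> (Suc n) r - k r)\<^sup>2 \<le> (2 * real B)\<^sup>2" using k_le clamp_diff_square_le by blast
      qed
    qed
  qed (use fin_const in auto)
  then have "\<forall>\<^sub>F n in sequentially. (\<integral>\<^sup>+r. ennreal (indicator {0..t} r * (\<phi> (Suc n) r - k r)\<^sup>2) \<partial>lborel) < e'"
    using e' by (simp add: order_tendsto_iff)
  then obtain n where n: "(\<integral>\<^sup>+r. ennreal (indicator {0..t} r * (\<phi> (Suc n) r - k r)\<^sup>2) \<partial>lborel) < e'"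
    using eventually_happens'[OF sequentially_bot] by blast
  have "(\<integral>\<^sup>+r. ennreal (indicator {0..t} r * (\<phi> (Suc n) r - f r)\<^sup>2) \<partial>lborel)
     = (\<integral>\<^sup>+r. ennreal (indicator {0..t} r * ((\<phi> (Suc n) r - k r) + (k r - h r) + (h r - f r))\<^sup>2) \<partial>lborel)"
    by simp
  also have "\<dots> \<le> 3 * (\<integral>\<^sup>+r. ennreal (indicator {0..t} r * (\<phi> (Suc n) r - k r)\<^sup>2) \<partial>lborel)
     + 3 * (\<integral>\<^sup>+r. ennreal (indicator {0..t} r * (k r - h r)\<^sup>2) \<partial>lborel)
     + 3 * (\<integral>\<^sup>+r. ennreal (indicator {0..t} r * (h r - f r)\<^sup>2) \<partial>lborel)"
    by (rule nn_integral_square_sum3) auto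
  also have "\<dots> < 3 * e' + 3 * e' + 3 * e'"
    using n m B unfolding k_def h_def
    by (intro add_strict_mono ennreal_mult_strict_left_mono) auto
  also have "\<dots> = ennreal e"
  proof -
    have *: "3 * e' = ennreal (e / 3)"
      using e ennreal_mult[of 3 "e / 9"] by (simp add: e'_def)
    show ?thesis
      unfolding * using e by (simp flip: ennreal_plus)
  qed
  finally show ?thesis unfolding \<phi>_def
    by (intro exI[of _ "Suc n"] exI[of _ "\<lambda>i. k (t * real i / real (Suc n))"]) auto
qed


section \<open>Wiener increments and the isometry\<close>

lemma nn_integral_eq_has_bochner:
  assumes "has_bochner_integral N f v" "\<And>x. 0 \<le> f x"
  shows "(\<integral>\<^sup>+x. ennreal (f x) \<partial>N) = ennreal v"
  using assms by (auto simp: has_bochner_integral_iff nn_integral_eq_integral)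

text \<open>Completing the square: the exponential factor shifts the mean of the density to
  \<open>c * \<sigma>\<^sup>2\<close> and leaves a constant, which is the value of the
  integral.\<close>

lemma normal_exp_moment:
  assumes "0 < \<sigma>"
  shows "has_bochner_integral lborel (\<lambda>x. normal_density 0 \<sigma> x * exp (c * x)) (exp (c\<^sup>2 * \<sigma>\<^sup>2 / 2))"
proof -
  have "normal_density 0 \<sigma> x * exp (c * x) = exp (c\<^sup>2 * \<sigma>\<^sup>2 / 2) * normal_density (c * \<sigma>\<^sup>2) \<sigma> x" for x
  proof -
    have "- (x\<^sup>2 / (2 * \<sigma>\<^sup>2)) + c * x = c\<^sup>2 * \<sigma>\<^sup>2 / 2 - (x - c * \<sigma>\<^sup>2)\<^sup>2 / (2 * \<sigma>\<^sup>2)"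
      using assms by (simp add: field_simps power2_eq_square)
    then have "exp (- (x\<^sup>2 / (2 * \<sigma>\<^sup>2))) * exp (c * x) = exp (c\<^sup>2 * \<sigma>\<^sup>2 / 2) * exp (- ((x - c * \<sigma>\<^sup>2)\<^sup>2 / (2 * \<sigma>\<^sup>2)))"
      by (simp flip: exp_add)
    then show ?thesis by (simp add: normal_density_def)
  qed
  moreover have "has_bochner_integral lborel (\<lambda>x. exp (c\<^sup>2 * \<sigma>\<^sup>2 / 2) * normal_density (c * \<sigma>\<^sup>2) \<sigma> x) (exp (c\<^sup>2 * \<sigma>\<^sup>2 / 2) * 1)"
    using assms by (intro has_bochner_integral_mult_right) (simp add: has_bochner_integral_iff)
  ultimately show ?thesis by simp
qed

locale wiener_setting = prob_space M
  for M :: "'a measure" +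
  fixes T :: real and F :: "real \<Rightarrow> 'a measure" and W :: "real \<Rightarrow> 'a \<Rightarrow> real"
  assumes filtration: "complete_filtration M T F"
    and wiener: "wiener_process M T F W"
begin

lemma measurable_filtration_mono:
  assumes "0 \<le> s" "s \<le> t" "t \<le> T" "f \<in> borel_measurable (F s)"
  shows "f \<in> borel_measurable (F t)"
proof -
  have "space (F s) = space M" "space (F t) = space M" "sets (F s) \<subseteq> sets (F t)"
    using assms filtration by (auto simp: complete_filtration_def subalgebra_def)
  then have "subalgebra (F t) (F s)" by (simp add: subalgebra_def)
  then show ?thesis using assms(4) by (rule measurable_from_subalg)
qed

lemma measurable_filtration_M:
  assumes "0 \<le> s" "s \<le> T" "f \<in> borel_measurable (F s)"
  shows "f \<in> borel_measurable M"
  using assms filtration by (auto simp: complete_filtration_def intro: measurable_from_subalg)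

lemma space_filtration: "0 \<le> s \<Longrightarrow> s \<le> T \<Longrightarrow> space (F s) = space M"
  using filtration by (auto simp: complete_filtration_def subalgebra_def)

lemma wiener_adapted: "0 \<le> t \<Longrightarrow> t \<le> T \<Longrightarrow> W t \<in> borel_measurable (F t)"
  using wiener by (auto simp: wiener_process_def)

lemma wiener_measurable: "0 \<le> t \<Longrightarrow> t \<le> T \<Longrightarrow> W t \<in> borel_measurable M"
  by (rule measurable_filtration_M[OF _ _ wiener_adapted])

lemma increment_measurable:
  assumes "0 \<le> s" "s \<le> t" "t \<le> T"
  shows "(\<lambda>\<omega>. W t \<omega> - W s \<omega>) \<in> borel_measurable (F t)"
  using assms wiener_adapted[of t] measurable_filtration_mono[OF _ _ _ wiener_adapted[of s]] by auto

lemma increment_distributed: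
  assumes "0 \<le> s" "s < t" "t \<le> T"
  shows "distributed M lborel (\<lambda>\<omega>. W t \<omega> - W s \<omega>) (normal_density 0 (sqrt (t - s)))"
  using assms wiener by (auto simp: wiener_process_def)

lemma increment_indep:
  assumes "0 \<le> s" "s < t" "t \<le> T" "Z \<in> borel_measurable (F s)"
  shows "indep_var borel Z borel (\<lambda>\<omega>. W t \<omega> - W s \<omega>)"
proof -
  let ?X = "\<lambda>\<omega>. W t \<omega> - W s \<omega>"
  have ind: "indep_set (sets (F s)) {?X -` B \<inter> space M | B. B \<in> sets borel}"
    using assms wiener by (auto simp: wiener_process_def)
  have Z: "Z \<in> borel_measurable M"
    by (rule measurable_filtration_M[OF _ _ assms(4)]) (use assms in linarith)+
  have X: "?X \<in> borel_measurable M"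
    using assms by (auto intro!: borel_measurable_diff wiener_measurable)
  have sp: "space (F s) = space M" using assms by (intro space_filtration) auto
  have 1: "sigma_sets (space M) {Z -` A \<inter> space M |A. A \<in> sets borel} \<subseteq> sets (F s)"
  proof -
    have "{Z -` A \<inter> space M |A. A \<in> sets borel} \<subseteq> sets (F s)"
      using measurable_sets[OF assms(4)] sp by auto
    then show ?thesis using sets.sigma_sets_subset[of _ "F s"] sp by auto
  qed
  \<comment> \<open>Preimages of all Borel sets under one function already form a sigma-algebra, so
    the generated one is the family that occurs in \<open>wiener_process\<close>.\<close>
  have 2: "sigma_sets (space M) {?X -` A \<inter> space M |A. A \<in> sets borel} = {?X -` B \<inter> space M | B. B \<in> sets borel}"
    using sets_vimage_algebra[of "space M" ?X borel] sets_vimage_algebra2[of ?X "space M" borel] by simp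
  have "indep_set (sigma_sets (space M) {Z -` A \<inter> space M |A. A \<in> sets borel})
      (sigma_sets (space M) {?X -` A \<inter> space M |A. A \<in> sets borel})"
    using ind 1 unfolding 2 indep_set_def
    by (elim indep_sets_mono_sets) (auto split: bool.split)
  then show ?thesis using Z X by (simp add: indep_var_eq)
qed

text \<open>Independence factorises the expectation, and the law of the increment turns the second
  factor into a Gaussian integral. The choices \<open>h x = x\<close>, \<open>x\<^sup>2\<close> and
  \<open>exp (c * x)\<close> give the three lemmas below, which add the degenerate case
  \<open>s = t\<close> where there is no density.\<close>

lemma increment_mult:
  fixes h :: "real \<Rightarrow> real"
  assumes "0 \<le> s" "s < t" "t \<le> T" "Z \<in> borel_measurable (F s)" "integrable M Z"
    and [measurable]: "h \<in> borel_measurable borel"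
    and h: "has_bochner_integral lborel (\<lambda>x. normal_density 0 (sqrt (t - s)) x * h x) v"
  shows "has_bochner_integral M (\<lambda>\<omega>. Z \<omega> * h (W t \<omega> - W s \<omega>)) (expectation Z * v)"
proof -
  let ?X = "\<lambda>\<omega>. W t \<omega> - W s \<omega>"
  note D = increment_distributed[OF assms(1-3)]
  have "indep_var borel (id \<circ> Z) borel (h \<circ> ?X)"
    by (rule indep_var_compose[OF increment_indep[OF assms(1-4)]]) auto
  then have ind: "indep_var borel Z borel (\<lambda>\<omega>. h (?X \<omega>))" by (simp add: comp_def)
  have int: "integrable M (\<lambda>\<omega>. h (?X \<omega>))"
    using h distributed_integrable[OF D, of h] by (auto dest: has_bochner_integral_iff[THEN iffD1])
  have "expectation (\<lambda>\<omega>. h (?X \<omega>)) = v"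
    using h distributed_integral[OF D, of h] by (auto dest: has_bochner_integral_iff[THEN iffD1])
  with indep_var_lebesgue_integral[OF ind assms(5) int] indep_var_integrable[OF ind assms(5) int]
  show ?thesis by (simp add: has_bochner_integral_iff)
qed

lemma increment_mult_mean:
  assumes "0 \<le> s" "s \<le> t" "t \<le> T" "Z \<in> borel_measurable (F s)" "integrable M Z"
  shows "has_bochner_integral M (\<lambda>\<omega>. Z \<omega> * (W t \<omega> - W s \<omega>)) 0"
proof (cases "s = t")
  case False
  then have st: "s < t" using assms by simp
  have "has_bochner_integral lborel (\<lambda>x. normal_density 0 (sqrt (t - s)) x * x) 0"
    using normal_moment_nz_1[of "sqrt (t - s)" 0] st by simp
  from increment_mult[OF assms(1) st assms(3-5) _ this] show ?thesis by simp
qed (simp add: has_bochner_integral_zero)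

lemma increment_mult_square:
  assumes "0 \<le> s" "s \<le> t" "t \<le> T" "Z \<in> borel_measurable (F s)" "integrable M Z"
  shows "has_bochner_integral M (\<lambda>\<omega>. Z \<omega> * (W t \<omega> - W s \<omega>)\<^sup>2) (expectation Z * (t - s))"
proof (cases "s = t")
  case False
  then have st: "s < t" using assms by simp
  have "has_bochner_integral lborel (\<lambda>x. normal_density 0 (sqrt (t - s)) x * x\<^sup>2) (t - s)"
  proof -
    have "2 * (t - s) / 2 = t - s" by simp
    then show ?thesis
      using normal_moment_even[of "sqrt (t - s)" 0 1] st by (simp add: numeral_2_eq_2 diff_divide_distrib)
  qed
  from increment_mult[OF assms(1) st assms(3-5) _ this] show ?thesis by simp
qed (simp add: has_bochner_integral_zero)

lemma increment_mult_exp: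
  assumes "0 \<le> s" "s \<le> t" "t \<le> T" "Z \<in> borel_measurable (F s)" "integrable M Z"
  shows "has_bochner_integral M (\<lambda>\<omega>. Z \<omega> * exp (c * (W t \<omega> - W s \<omega>))) (expectation Z * exp (c\<^sup>2 * (t - s) / 2))"
proof (cases "s = t")
  case True
  then show ?thesis using assms by (simp add: has_bochner_integral_iff)
next
  case False
  then have st: "s < t" using assms by simp
  have "has_bochner_integral lborel (\<lambda>x. normal_density 0 (sqrt (t - s)) x * exp (c * x)) (exp (c\<^sup>2 * (t - s) / 2))"
    using normal_exp_moment[of "sqrt (t - s)" c] st by simp
  from increment_mult[OF assms(1) st assms(3-5) _ this] show ?thesis by simp
qed

section \<open>Covariances of increments with bounded adapted coefficients\<close>

definition bounded_adapted :: "real \<Rightarrow> ('a \<Rightarrow> real) \<Rightarrow> bool" where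
  "bounded_adapted s \<xi> \<longleftrightarrow> \<xi> \<in> borel_measurable (F s) \<and> (\<exists>C. \<forall>\<omega>\<in>space M. \<bar>\<xi> \<omega>\<bar> \<le> C)"

lemma bounded_adapted_mono: "bounded_adapted s \<xi> \<Longrightarrow> 0 \<le> s \<Longrightarrow> s \<le> t \<Longrightarrow> t \<le> T \<Longrightarrow> bounded_adapted t \<xi>"
  by (auto simp: bounded_adapted_def intro: measurable_filtration_mono)

lemma bounded_adapted_mult:
  assumes "bounded_adapted s \<xi>" "bounded_adapted s \<eta>"
  shows "bounded_adapted s (\<lambda>\<omega>. \<xi> \<omega> * \<eta> \<omega>)"
proof -
  obtain C C' where "\<forall>\<omega>\<in>space M. \<bar>\<xi> \<omega>\<bar> \<le> C" "\<forall>\<omega>\<in>space M. \<bar>\<eta> \<omega>\<bar> \<le> C'"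
    using assms by (auto simp: bounded_adapted_def)
  then have "\<forall>\<omega>\<in>space M. \<bar>\<xi> \<omega> * \<eta> \<omega>\<bar> \<le> C * C'"
    unfolding abs_mult by (meson abs_ge_zero mult_mono order_trans)
  then show ?thesis using assms by (auto simp: bounded_adapted_def)
qed

lemma bounded_adapted_measurable: "bounded_adapted s \<xi> \<Longrightarrow> 0 \<le> s \<Longrightarrow> s \<le> T \<Longrightarrow> \<xi> \<in> borel_measurable M"
  by (auto simp: bounded_adapted_def intro: measurable_filtration_M)

lemma bounded_adapted_mult_integrable:
  assumes "bounded_adapted s \<xi>" "0 \<le> s" "s \<le> T" "integrable M X"
  shows "integrable M (\<lambda>\<omega>. \<xi> \<omega> * X \<omega>)"
proof -
  obtain C where C: "\<forall>\<omega>\<in>space M. \<bar>\<xi> \<omega>\<bar> \<le> C"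
    using assms by (auto simp: bounded_adapted_def)
  show ?thesis
  proof (rule Bochner_Integration.integrable_bound)
    show "integrable M (\<lambda>\<omega>. C * \<bar>X \<omega>\<bar>)" using assms by auto
    show "(\<lambda>\<omega>. \<xi> \<omega> * X \<omega>) \<in> borel_measurable M"
      using assms bounded_adapted_measurable[OF assms(1-3)] by auto
    show "AE x in M. norm (\<xi> x * X x) \<le> norm (C * \<bar>X x\<bar>)"
      using C by (intro AE_I2) (auto simp: abs_mult intro!: mult_right_mono)
  qed
qed

lemma bounded_adapted_integrable:
  assumes "bounded_adapted s \<xi>" "0 \<le> s" "s \<le> T"
  shows "integrable M \<xi>"
  using bounded_adapted_mult_integrable[OF assms, of "\<lambda>_. 1"] by simp

text \<open>Conditioning in disguise: both coefficients and the earlier increment are known at time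
  \<open>c\<close>, so together they form the adapted factor of \<open>increment_mult_mean\<close>,
  and the later increment averages to zero.\<close>

lemma increment_product_disjoint:
  assumes "0 \<le> a" "a \<le> b" "b \<le> c" "c \<le> d" "d \<le> T" "bounded_adapted a \<xi>" "bounded_adapted c \<eta>"
  shows "has_bochner_integral M (\<lambda>\<omega>. (\<xi> \<omega> * (W b \<omega> - W a \<omega>)) * (\<eta> \<omega> * (W d \<omega> - W c \<omega>))) 0"
proof -
  have \<xi>\<eta>: "bounded_adapted c (\<lambda>\<omega>. \<xi> \<omega> * \<eta> \<omega>)"
    using assms bounded_adapted_mono[of a \<xi> c] by (intro bounded_adapted_mult) auto
  have "(\<lambda>\<omega>. W b \<omega> - W a \<omega>) \<in> borel_measurable (F c)"
    using assms increment_measurable[of a b] by (auto intro: measurable_filtration_mono[of b c])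
  then have meas: "(\<lambda>\<omega>. (\<xi> \<omega> * \<eta> \<omega>) * (W b \<omega> - W a \<omega>)) \<in> borel_measurable (F c)"
    using \<xi>\<eta> by (auto simp: bounded_adapted_def)
  have "integrable M (\<lambda>\<omega>. W b \<omega> - W a \<omega>)"
  proof -
    have "has_bochner_integral M (\<lambda>\<omega>. 1 * (W b \<omega> - W a \<omega>)) 0"
      by (intro increment_mult_mean) (use assms in auto)
    then show ?thesis by (simp add: has_bochner_integral_iff)
  qed
  then have int: "integrable M (\<lambda>\<omega>. (\<xi> \<omega> * \<eta> \<omega>) * (W b \<omega> - W a \<omega>))"
    using assms \<xi>\<eta> by (intro bounded_adapted_mult_integrable[of c]) auto
  have "has_bochner_integral M (\<lambda>\<omega>. ((\<xi> \<omega> * \<eta> \<omega>) * (W b \<omega> - W a \<omega>)) * (W d \<omega> - W c \<omega>)) 0"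
    using assms by (intro increment_mult_mean meas int) auto
  then show ?thesis by (simp add: mult_ac)
qed

lemma increment_product_same:
  assumes "0 \<le> a" "a \<le> b" "b \<le> T" "bounded_adapted a \<xi>" "bounded_adapted a \<eta>"
  shows "has_bochner_integral M (\<lambda>\<omega>. (\<xi> \<omega> * (W b \<omega> - W a \<omega>)) * (\<eta> \<omega> * (W b \<omega> - W a \<omega>)))
     (expectation (\<lambda>\<omega>. \<xi> \<omega> * \<eta> \<omega>) * (b - a))"
proof -
  have \<xi>\<eta>: "bounded_adapted a (\<lambda>\<omega>. \<xi> \<omega> * \<eta> \<omega>)" using assms by (intro bounded_adapted_mult)
  have "has_bochner_integral M (\<lambda>\<omega>. (\<xi> \<omega> * \<eta> \<omega>) * (W b \<omega> - W a \<omega>)\<^sup>2)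
     (expectation (\<lambda>\<omega>. \<xi> \<omega> * \<eta> \<omega>) * (b - a))"
    using assms \<xi>\<eta> bounded_adapted_integrable[OF \<xi>\<eta>]
    by (intro increment_mult_square) (auto simp: bounded_adapted_def)
  then show ?thesis by (simp add: mult_ac power2_eq_square)
qed

lemma measure_Ioc_Int:
  fixes a b c d :: real
  shows "measure lborel ({a<..b} \<inter> {c<..d}) = max 0 (min b d - max a c)"
  by (auto simp: Int_greaterThanAtMost max_def min_def)

text \<open>If the intervals overlap, both are cut at \<open>c\<close> and at the smaller right end
  \<open>m\<close>. Only the common piece \<open>(c, m]\<close> paired with itself contributes, and
  it contributes its length; every other pair of pieces is disjoint and ordered in time.\<close>

lemma increment_product_ordered:
  assumes "0 \<le> a" "a \<le> b" "b \<le> T" "a \<le> c" "c \<le> d" "d \<le> T" "bounded_adapted a \<xi>" "bounded_adapted c \<eta>"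
  shows "has_bochner_integral M (\<lambda>\<omega>. (\<xi> \<omega> * (W b \<omega> - W a \<omega>)) * (\<eta> \<omega> * (W d \<omega> - W c \<omega>)))
     (expectation (\<lambda>\<omega>. \<xi> \<omega> * \<eta> \<omega>) * measure lborel ({a<..b} \<inter> {c<..d}))"
proof (cases "b \<le> c")
  case True
  then have "measure lborel ({a<..b} \<inter> {c<..d}) = 0"
    using assms by (simp add: measure_Ioc_Int)
  then show ?thesis using increment_product_disjoint[of a b c d \<xi> \<eta>] True assms by simp
next
  case False
  define m where "m = min b d"
  have m: "c \<le> m" "m \<le> b" "m \<le> d" "m = b \<or> m = d" "0 \<le> c" using False assms by (auto simp: m_def)
  have len: "measure lborel ({a<..b} \<inter> {c<..d}) = m - c"
    using assms m by (simp add: measure_Ioc_Int m_def)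
  have \<xi>: "bounded_adapted c \<xi>" "bounded_adapted m \<xi>" and \<eta>: "bounded_adapted m \<eta>"
    using assms m bounded_adapted_mono[of a \<xi> c] bounded_adapted_mono[of a \<xi> m] bounded_adapted_mono[of c \<eta> m] by auto
  let ?D = "\<lambda>s t \<omega>. W t \<omega> - W s \<omega>"
  have 1: "has_bochner_integral M (\<lambda>\<omega>. (\<xi> \<omega> * ?D a c \<omega>) * (\<eta> \<omega> * ?D c d \<omega>)) 0"
    using assms m by (intro increment_product_disjoint) auto
  have 2: "has_bochner_integral M (\<lambda>\<omega>. (\<xi> \<omega> * ?D c m \<omega>) * (\<eta> \<omega> * ?D c m \<omega>)) (expectation (\<lambda>\<omega>. \<xi> \<omega> * \<eta> \<omega>) * (m - c))"
    using assms m \<xi> by (intro increment_product_same) auto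
  have 3: "has_bochner_integral M (\<lambda>\<omega>. (\<xi> \<omega> * ?D c m \<omega>) * (\<eta> \<omega> * ?D m d \<omega>)) 0"
    using assms m \<xi> \<eta> by (intro increment_product_disjoint) auto
  have 4: "has_bochner_integral M (\<lambda>\<omega>. (\<eta> \<omega> * ?D c m \<omega>) * (\<xi> \<omega> * ?D m b \<omega>)) 0"
    using assms m \<xi> \<eta> by (intro increment_product_disjoint) auto
  \<comment> \<open>The product of the two remainders over \<open>(m, b]\<close> and
    \<open>(m, d]\<close> is missing from the expansion because one of them is empty:
    \<open>m\<close> equals \<open>b\<close> or \<open>d\<close>.\<close>
  have "(\<xi> \<omega> * ?D a b \<omega>) * (\<eta> \<omega> * ?D c d \<omega>) = (\<xi> \<omega> * ?D a c \<omega>) * (\<eta> \<omega> * ?D c d \<omega>)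
      + (\<xi> \<omega> * ?D c m \<omega>) * (\<eta> \<omega> * ?D c m \<omega>) + (\<xi> \<omega> * ?D c m \<omega>) * (\<eta> \<omega> * ?D m d \<omega>)
      + (\<eta> \<omega> * ?D c m \<omega>) * (\<xi> \<omega> * ?D m b \<omega>)" for \<omega>
    using m(4) by (auto simp: algebra_simps)
  moreover note has_bochner_integral_add[OF has_bochner_integral_add[OF has_bochner_integral_add[OF 1 2] 3] 4]
  ultimately show ?thesis by (simp only: len add_0_left add_0_right)
qed

lemma increment_product:
  assumes "0 \<le> a" "a \<le> b" "b \<le> T" "0 \<le> c" "c \<le> d" "d \<le> T" "bounded_adapted a \<xi>" "bounded_adapted c \<eta>"
  shows "has_bochner_integral M (\<lambda>\<omega>. (\<xi> \<omega> * (W b \<omega> - W a \<omega>)) * (\<eta> \<omega> * (W d \<omega> - W c \<omega>)))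
     (expectation (\<lambda>\<omega>. \<xi> \<omega> * \<eta> \<omega>) * measure lborel ({a<..b} \<inter> {c<..d}))"
proof (cases "a \<le> c")
  case True
  then show ?thesis using assms by (intro increment_product_ordered) auto
next
  case False
  then have "has_bochner_integral M (\<lambda>\<omega>. (\<eta> \<omega> * (W d \<omega> - W c \<omega>)) * (\<xi> \<omega> * (W b \<omega> - W a \<omega>)))
     (expectation (\<lambda>\<omega>. \<eta> \<omega> * \<xi> \<omega>) * measure lborel ({c<..d} \<inter> {a<..b}))"
    using assms by (intro increment_product_ordered) auto
  then show ?thesis by (simp add: mult.commute Int_commute)
qed

text \<open>The intervals form an arbitrary finite family and may overlap. Differences of simple
  processes over unrelated partitions are therefore covered without a common refinement. Expanding
  the squares reduces both sides to one double sum over pairs of intervals, in which a pair carries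
  the length of its intersection.\<close>

lemma elementary_isometry:
  assumes "finite I"
    and I: "\<And>i. i \<in> I \<Longrightarrow> 0 \<le> \<alpha> i" "\<And>i. i \<in> I \<Longrightarrow> \<alpha> i \<le> \<beta> i" "\<And>i. i \<in> I \<Longrightarrow> \<beta> i \<le> T"
      "\<And>i. i \<in> I \<Longrightarrow> bounded_adapted (\<alpha> i) (\<xi> i)"
  shows "(\<integral>\<^sup>+\<omega>. ennreal ((\<Sum>i\<in>I. \<xi> i \<omega> * (W (\<beta> i) \<omega> - W (\<alpha> i) \<omega>))\<^sup>2) \<partial>M)
     = (\<integral>\<^sup>+(r, \<omega>). ennreal ((\<Sum>i\<in>I. \<xi> i \<omega> * indicator {\<alpha> i <.. \<beta> i} r)\<^sup>2) \<partial>(lborel \<Otimes>\<^sub>M M))"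
proof -
  interpret pair_sigma_finite lborel M ..
  let ?len = "\<lambda>i j. measure lborel ({\<alpha> i<..\<beta> i} \<inter> {\<alpha> j<..\<beta> j})"
  let ?v = "\<Sum>i\<in>I. \<Sum>j\<in>I. expectation (\<lambda>\<omega>. \<xi> i \<omega> * \<xi> j \<omega>) * ?len i j"
  have I': "\<alpha> i \<le> T" if "i \<in> I" for i using I[OF that] by linarith
  have meas: "\<xi> i \<in> borel_measurable M" if "i \<in> I" for i
    using I[OF that] I'[OF that] bounded_adapted_measurable by auto
  have "has_bochner_integral M (\<lambda>\<omega>. \<Sum>i\<in>I. \<Sum>j\<in>I. (\<xi> i \<omega> * (W (\<beta> i) \<omega> - W (\<alpha> i) \<omega>)) * (\<xi> j \<omega> * (W (\<beta> j) \<omega> - W (\<alpha> j) \<omega>))) ?v"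
    using I by (intro has_bochner_integral_sum increment_product) auto
  then have "has_bochner_integral M (\<lambda>\<omega>. (\<Sum>i\<in>I. \<xi> i \<omega> * (W (\<beta> i) \<omega> - W (\<alpha> i) \<omega>))\<^sup>2) ?v"
    by (simp only: power2_eq_square sum_product)
  then have lhs: "(\<integral>\<^sup>+\<omega>. ennreal ((\<Sum>i\<in>I. \<xi> i \<omega> * (W (\<beta> i) \<omega> - W (\<alpha> i) \<omega>))\<^sup>2) \<partial>M) = ennreal ?v"
    by (rule nn_integral_eq_has_bochner) simp
  have hb: "has_bochner_integral lborel (\<lambda>r. (\<Sum>i\<in>I. \<xi> i \<omega> * indicator {\<alpha> i <.. \<beta> i} r)\<^sup>2)
      (\<Sum>i\<in>I. \<Sum>j\<in>I. (\<xi> i \<omega> * \<xi> j \<omega>) * ?len i j)" for \<omega>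
  proof -
    have "has_bochner_integral lborel (\<lambda>r. \<Sum>i\<in>I. \<Sum>j\<in>I. (\<xi> i \<omega> * \<xi> j \<omega>) * indicator ({\<alpha> i <.. \<beta> i} \<inter> {\<alpha> j <.. \<beta> j}) r)
       (\<Sum>i\<in>I. \<Sum>j\<in>I. (\<xi> i \<omega> * \<xi> j \<omega>) * ?len i j)"
    proof (intro has_bochner_integral_sum has_bochner_integral_mult_right has_bochner_integral_real_indicator)
      show "emeasure lborel ({\<alpha> i <.. \<beta> i} \<inter> {\<alpha> j <.. \<beta> j}) < \<infinity>" for i j
        by (rule emeasure_bounded_finite) (rule bounded_Int, simp)
    qed auto
    moreover have "(\<Sum>i\<in>I. \<Sum>j\<in>I. (\<xi> i \<omega> * \<xi> j \<omega>) * indicator ({\<alpha> i <.. \<beta> i} \<inter> {\<alpha> j <.. \<beta> j}) r)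
       = (\<Sum>i\<in>I. \<xi> i \<omega> * indicator {\<alpha> i <.. \<beta> i} r)\<^sup>2" for r
      unfolding power2_eq_square sum_product
      unfolding indicator_inter_arith by (simp add: mult_ac)
    ultimately show ?thesis by simp
  qed
  have inner: "(\<integral>\<^sup>+r. ennreal ((\<Sum>i\<in>I. \<xi> i \<omega> * indicator {\<alpha> i <.. \<beta> i} r)\<^sup>2) \<partial>lborel)
      = ennreal (\<Sum>i\<in>I. \<Sum>j\<in>I. (\<xi> i \<omega> * \<xi> j \<omega>) * ?len i j)" for \<omega>
    by (rule nn_integral_eq_has_bochner[OF hb]) simp
  have nonneg: "0 \<le> (\<Sum>i\<in>I. \<Sum>j\<in>I. (\<xi> i \<omega> * \<xi> j \<omega>) * ?len i j)" for \<omega>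
    unfolding has_bochner_integral_integral_eq[OF hb, symmetric] by simp
  have "integrable M (\<lambda>\<omega>. \<xi> i \<omega> * \<xi> j \<omega>)" if "i \<in> I" "j \<in> I" for i j
    using I I' that by (intro bounded_adapted_mult_integrable[of "\<alpha> i"] bounded_adapted_integrable[of "\<alpha> j"]) auto
  then have "has_bochner_integral M (\<lambda>\<omega>. \<Sum>i\<in>I. \<Sum>j\<in>I. (\<xi> i \<omega> * \<xi> j \<omega>) * ?len i j) ?v"
    by (intro has_bochner_integral_sum has_bochner_integral_mult_left) (auto simp: has_bochner_integral_iff)
  then have "(\<integral>\<^sup>+\<omega>. ennreal (\<Sum>i\<in>I. \<Sum>j\<in>I. (\<xi> i \<omega> * \<xi> j \<omega>) * ?len i j) \<partial>M) = ennreal ?v"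
    by (rule nn_integral_eq_has_bochner) (rule nonneg)
  moreover have "(\<lambda>(r, \<omega>). ennreal ((\<Sum>i\<in>I. \<xi> i \<omega> * indicator {\<alpha> i <.. \<beta> i} r)\<^sup>2)) \<in> borel_measurable (lborel \<Otimes>\<^sub>M M)"
    unfolding split_beta' using meas by (auto intro!: borel_measurable_sum borel_measurable_times borel_measurable_power measurable_compose[OF measurable_snd] measurable_compose[OF measurable_fst])
  ultimately show ?thesis
    unfolding lhs by (subst nn_integral_snd[symmetric]) (simp_all add: inner)
qed

end


section \<open>Moments of elementary Wiener integrals\<close>

text \<open>A real exponent is first raised to the integer \<open>n\<close>, at the cost of adding 1
  for small \<open>\<bar>y\<bar>\<close>. The factor \<open>n ^ n\<close> is the n-th power of
  \<open>\<bar>y\<bar> / n \<le> exp (\<bar>y\<bar> / n)\<close>. Both signs appear on the right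
  because exponential moments are computed without absolute values.\<close>

lemma abs_powr_le_exp:
  fixes p y :: real
  assumes "1 \<le> p" "p \<le> real n"
  shows "\<bar>y\<bar> powr p \<le> (1 + real n ^ n) * (exp y + exp (- y))"
proof -
  have n: "0 < n" using assms by (cases n) auto
  have exp_abs: "exp \<bar>y\<bar> \<le> exp y + exp (- y)"
    by (cases "0 \<le> y") (auto simp: add_increasing add_increasing2)
  have "\<bar>y\<bar> powr p \<le> 1 + \<bar>y\<bar> ^ n"
  proof (cases "\<bar>y\<bar> \<le> 1")
    case True
    have "\<bar>y\<bar> powr p \<le> 1 powr p" using True assms by (intro powr_mono2) auto
    then show ?thesis by (simp add: add_increasing2)
  next
    case False
    then have "\<bar>y\<bar> powr p \<le> \<bar>y\<bar> powr real n" using assms by (intro powr_mono) auto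
    then show ?thesis using False by (simp add: powr_realpow)
  qed
  also have "\<bar>y\<bar> ^ n \<le> real n ^ n * exp \<bar>y\<bar>"
  proof -
    have "\<bar>y\<bar> / n \<le> exp (\<bar>y\<bar> / n)" using exp_ge_add_one_self[of "\<bar>y\<bar> / n"] by linarith
    then have "(\<bar>y\<bar> / n) ^ n \<le> exp (\<bar>y\<bar> / n) ^ n" by (intro power_mono) auto
    also have "exp (\<bar>y\<bar> / n) ^ n = exp \<bar>y\<bar>" using n by (simp flip: exp_of_nat_mult)
    finally show ?thesis using n by (simp add: power_divide field_simps)
  qed
  also have "1 + real n ^ n * exp \<bar>y\<bar> \<le> (1 + real n ^ n) * exp \<bar>y\<bar>"
    by (simp add: distrib_right)
  also have "\<dots> \<le> (1 + real n ^ n) * (exp y + exp (- y))"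
    by (intro mult_left_mono exp_abs) auto
  finally show ?thesis by simp
qed

lemma (in prob_space) L2_fast_Cauchy_limit:
  fixes S :: "nat \<Rightarrow> 'a \<Rightarrow> real"
  assumes S[measurable]: "\<And>k. S k \<in> borel_measurable M" and C: "0 \<le> C"
    and cauchy: "\<And>j k. (\<integral>\<^sup>+\<omega>. ennreal ((S j \<omega> - S k \<omega>)\<^sup>2) \<partial>M) \<le> ennreal (C * (1 / 4 ^ j + 1 / 4 ^ k))"
  obtains I where "I \<in> borel_measurable M" "AE \<omega> in M. (\<lambda>k. S k \<omega>) \<longlonglongrightarrow> I \<omega>"
    "(\<lambda>k. \<integral>\<^sup>+\<omega>. ennreal ((S k \<omega> - I \<omega>)\<^sup>2) \<partial>M) \<longlonglongrightarrow> 0"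
proof -
  let ?d = "\<lambda>k \<omega>. S (Suc k) \<omega> - S k \<omega>"
  have step: "(\<integral>\<^sup>+\<omega>. ennreal \<bar>?d k \<omega>\<bar> \<partial>M) \<le> ennreal ((2 * C + 1) * (1 / 2) ^ k)" for k
  proof -
    \<comment> \<open>A weighted Young inequality in place of Cauchy-Schwarz; the weight
      \<open>2 ^ k\<close> balances a squared difference of order \<open>1 / 4 ^ k\<close>, so both
      terms are of order \<open>1 / 2 ^ k\<close>.\<close>
    have "\<bar>x\<bar> \<le> 2 ^ k * x\<^sup>2 + (1 / 2) ^ k" for x :: real
    proof -
      have "0 \<le> (2 ^ k * \<bar>x\<bar> - 1)\<^sup>2 + 2 ^ k * \<bar>x\<bar>" by simp
      then have "2 ^ k * \<bar>x\<bar> \<le> 2 ^ k * (2 ^ k * x\<^sup>2) + 1"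
        by (simp add: power2_eq_square algebra_simps)
      then have "2 ^ k * \<bar>x\<bar> \<le> 2 ^ k * (2 ^ k * x\<^sup>2 + (1 / 2) ^ k)"
        by (simp add: distrib_left power_divide)
      then show ?thesis by simp
    qed
    then have "(\<integral>\<^sup>+\<omega>. ennreal \<bar>?d k \<omega>\<bar> \<partial>M) \<le> (\<integral>\<^sup>+\<omega>. ennreal (2 ^ k * (?d k \<omega>)\<^sup>2 + (1 / 2) ^ k) \<partial>M)"
      by (intro nn_integral_mono ennreal_leI) auto
    also have "\<dots> = (\<integral>\<^sup>+\<omega>. ennreal (2 ^ k) * ennreal ((?d k \<omega>)\<^sup>2) + ennreal ((1 / 2) ^ k) \<partial>M)"
      by (intro nn_integral_cong) (simp add: ennreal_plus flip: ennreal_mult)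
    also have "\<dots> = ennreal (2 ^ k) * (\<integral>\<^sup>+\<omega>. ennreal ((?d k \<omega>)\<^sup>2) \<partial>M) + ennreal ((1 / 2) ^ k)"
      by (simp add: nn_integral_add nn_integral_cmult emeasure_space_1)
    also have "\<dots> \<le> ennreal (2 ^ k) * ennreal (C * (1 / 4 ^ Suc k + 1 / 4 ^ k)) + ennreal ((1 / 2) ^ k)"
      by (intro add_mono mult_left_mono cauchy) auto
    also have "\<dots> = ennreal (2 ^ k * (C * (1 / 4 ^ Suc k + 1 / 4 ^ k)) + (1 / 2) ^ k)"
    proof -
      have *: "0 \<le> C * (1 / 4 ^ Suc k + 1 / 4 ^ k)" "0 \<le> (2 :: real) ^ k" "0 \<le> (1 / 2 :: real) ^ k" using C by auto
      show ?thesis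
        unfolding ennreal_plus[OF mult_nonneg_nonneg[OF *(2,1)] *(3)] ennreal_mult[OF *(2,1)] ..
    qed
    also have "\<dots> \<le> ennreal ((2 * C + 1) * (1 / 2) ^ k)"
    proof (rule ennreal_leI)
      have e: "(4::real) ^ k = 2 ^ k * 2 ^ k" by (simp flip: power_mult_distrib)
      have "1 / 4 ^ Suc k + 1 / 4 ^ k \<le> 2 / (4::real) ^ k" by (simp add: field_simps)
      then have "2 ^ k * (C * (1 / 4 ^ Suc k + 1 / 4 ^ k)) \<le> 2 ^ k * (C * (2 / (4::real) ^ k))"
        using C by (intro mult_left_mono) auto
      also have "\<dots> = 2 * C * (1 / 2) ^ k"
        by (simp add: e power_divide field_simps)
      finally show "2 ^ k * (C * (1 / 4 ^ Suc k + 1 / 4 ^ k)) + (1 / 2) ^ k \<le> (2 * C + 1) * (1 / 2) ^ k"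
        by (simp add: distrib_right)
    qed
    finally show ?thesis .
  qed
  have "(\<integral>\<^sup>+\<omega>. (\<Sum>k. ennreal \<bar>?d k \<omega>\<bar>) \<partial>M) = (\<Sum>k. \<integral>\<^sup>+\<omega>. ennreal \<bar>?d k \<omega>\<bar> \<partial>M)"
    by (intro nn_integral_suminf) auto
  also have "\<dots> \<le> (\<Sum>k. ennreal ((2 * C + 1) * (1 / 2) ^ k))"
    by (intro suminf_le step) auto
  also have "\<dots> < \<infinity>"
  proof -
    have "summable (\<lambda>k. (2 * C + 1) * (1 / 2) ^ k :: real)"
      by (intro summable_mult summable_geometric) auto
    then show ?thesis using C by (subst suminf_ennreal2) auto
  qed
  finally have "AE \<omega> in M. (\<Sum>k. ennreal \<bar>?d k \<omega>\<bar>) \<noteq> \<infinity>"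
    by (intro nn_integral_PInf_AE) auto
  then have conv: "AE \<omega> in M. convergent (\<lambda>k. S k \<omega>)"
  proof eventually_elim
    case (elim \<omega>)
    have "summable (\<lambda>k. \<bar>?d k \<omega>\<bar>)"
      using elim by (intro summable_suminf_not_top) auto
    then have "summable (\<lambda>k. ?d k \<omega>)" by (rule summable_rabs_cancel)
    then have "convergent (\<lambda>n. \<Sum>k<n. ?d k \<omega>)" by (simp add: summable_iff_convergent)
    then have "convergent (\<lambda>n. S n \<omega> - S 0 \<omega>)" by (simp add: sum_lessThan_telescope[of "\<lambda>n. S n \<omega>"])
    then have "convergent (\<lambda>n. (S n \<omega> - S 0 \<omega>) + S 0 \<omega>)" by (intro convergent_add convergent_const)
    then show ?case by simp
  qed
  define I where "I = (\<lambda>\<omega>. lim (\<lambda>k. S k \<omega>))"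
  have I[measurable]: "I \<in> borel_measurable M" unfolding I_def by measurable
  have lim: "AE \<omega> in M. (\<lambda>k. S k \<omega>) \<longlonglongrightarrow> I \<omega>"
    using conv by eventually_elim (simp add: I_def convergent_LIMSEQ_iff)
  have bound: "(\<integral>\<^sup>+\<omega>. ennreal ((S k \<omega> - I \<omega>)\<^sup>2) \<partial>M) \<le> ennreal (2 * C * (1 / 4) ^ k)" for k
  proof -
    \<comment> \<open>Fatou's lemma along indices shifted by \<open>k\<close>: each
      \<open>j + k\<close> is at least \<open>k\<close>, so the Cauchy bound is at most
      \<open>2 * C * (1 / 4) ^ k\<close> for every \<open>j\<close> and not merely
      eventually.\<close>
    have "(\<integral>\<^sup>+\<omega>. ennreal ((S k \<omega> - I \<omega>)\<^sup>2) \<partial>M) = (\<integral>\<^sup>+\<omega>. liminf (\<lambda>j. ennreal ((S k \<omega> - S (j + k) \<omega>)\<^sup>2)) \<partial>M)"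
    proof (rule nn_integral_cong_AE)
      show "AE \<omega> in M. ennreal ((S k \<omega> - I \<omega>)\<^sup>2) = liminf (\<lambda>j. ennreal ((S k \<omega> - S (j + k) \<omega>)\<^sup>2))"
        using lim
      proof eventually_elim
        case (elim \<omega>)
        then have "(\<lambda>j. S (j + k) \<omega>) \<longlonglongrightarrow> I \<omega>" by (rule LIMSEQ_ignore_initial_segment)
        then have "(\<lambda>j. ennreal ((S k \<omega> - S (j + k) \<omega>)\<^sup>2)) \<longlonglongrightarrow> ennreal ((S k \<omega> - I \<omega>)\<^sup>2)"
          by (intro tendsto_intros)
        then show ?case by (rule lim_imp_Liminf[OF sequentially_bot, symmetric])
      qed
    qed
    also have "\<dots> \<le> liminf (\<lambda>j. \<integral>\<^sup>+\<omega>. ennreal ((S k \<omega> - S (j + k) \<omega>)\<^sup>2) \<partial>M)"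
      by (intro nn_integral_liminf) auto
    also have "\<dots> \<le> liminf (\<lambda>j. ennreal (2 * C * (1 / 4) ^ k))"
    proof (intro Liminf_mono always_eventually allI)
      fix j
      have "(\<integral>\<^sup>+\<omega>. ennreal ((S k \<omega> - S (j + k) \<omega>)\<^sup>2) \<partial>M) \<le> ennreal (C * (1 / 4 ^ k + 1 / 4 ^ (j + k)))"
        by (rule cauchy)
      also have "\<dots> \<le> ennreal (C * (2 * (1 / 4) ^ k))"
      proof (intro ennreal_leI mult_left_mono C)
        have "1 / 4 ^ (j + k) \<le> (1 / 4 ^ k :: real)"
          by (intro divide_left_mono power_increasing) auto
        then show "1 / 4 ^ k + 1 / 4 ^ (j + k) \<le> 2 * (1 / 4 :: real) ^ k"
          by (simp add: power_divide)
      qed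
      finally show "(\<integral>\<^sup>+\<omega>. ennreal ((S k \<omega> - S (j + k) \<omega>)\<^sup>2) \<partial>M) \<le> ennreal (2 * C * (1 / 4) ^ k)"
        by (simp add: mult_ac)
    qed
    also have "\<dots> = ennreal (2 * C * (1 / 4) ^ k)" by (simp add: Liminf_const)
    finally show ?thesis .
  qed
  have "(\<lambda>k. ennreal (2 * C * (1 / 4) ^ k)) \<longlonglongrightarrow> ennreal (2 * C * 0)"
    by (intro tendsto_intros LIMSEQ_power_zero) auto
  then have "(\<lambda>k. ennreal (2 * C * (1 / 4) ^ k)) \<longlonglongrightarrow> 0" by simp
  from tendsto_sandwich[OF _ _ tendsto_const this]
  have "(\<lambda>k. \<integral>\<^sup>+\<omega>. ennreal ((S k \<omega> - I \<omega>)\<^sup>2) \<partial>M) \<longlonglongrightarrow> 0"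
    using bound by auto
  with that I lim show thesis by blast
qed

text \<open>The constant comes from \<open>abs_powr_le_exp\<close>, applied to a centred Gaussian variable of variance at most 1.\<close>

definition moment_const :: "real \<Rightarrow> real" where
  "moment_const p = 2 * (1 + real (nat \<lceil>p\<rceil>) ^ nat \<lceil>p\<rceil>) * exp (1 / 2)"

lemma moment_const_pos: "0 < moment_const p"
proof -
  have "0 < 1 + real (nat \<lceil>p\<rceil>) ^ nat \<lceil>p\<rceil>" by (intro add_pos_nonneg) auto
  then show ?thesis by (simp add: moment_const_def)
qed

text \<open>Cross terms vanish since the cells are disjoint. The second claim is carried along for
  the induction: on the newly added cell the earlier sum is zero.\<close>

lemma step_function_square:
  fixes \<tau> c :: "nat \<Rightarrow> real"
  assumes "\<And>i. i < n \<Longrightarrow> \<tau> i \<le> \<tau> (Suc i)"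
  shows "(\<Sum>i<n. c i * indicator {\<tau> i <.. \<tau> (Suc i)} r)\<^sup>2 = (\<Sum>i<n. (c i)\<^sup>2 * indicator {\<tau> i <.. \<tau> (Suc i)} r)"
    and "\<tau> n < r \<Longrightarrow> (\<Sum>i<n. c i * indicator {\<tau> i <.. \<tau> (Suc i)} r) = 0"
  using assms
proof (induction n)
  case (Suc n)
  { case 1
    have IH: "(\<Sum>i<n. c i * indicator {\<tau> i <.. \<tau> (Suc i)} r)\<^sup>2 = (\<Sum>i<n. (c i)\<^sup>2 * indicator {\<tau> i <.. \<tau> (Suc i)} r)"
      "\<tau> n < r \<Longrightarrow> (\<Sum>i<n. c i * indicator {\<tau> i <.. \<tau> (Suc i)} r) = 0"
      using Suc 1 by auto
    show ?case
      using IH by (cases "\<tau> n < r") (auto simp: power2_sum power_mult_distrib power2_eq_square[of "indicator _ _"] indicator_def)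
  next
    case 2
    have "\<tau> n \<le> \<tau> (Suc n)" using 2 by auto
    then have "\<tau> n < r" using 2(1) by linarith
    then have "(\<Sum>i<n. c i * indicator {\<tau> i <.. \<tau> (Suc i)} r) = 0"
      using Suc 2 by auto
    then show ?case using 2(1) by simp
  }
qed auto

lemma nn_integral_step_function_square:
  fixes \<tau> c :: "nat \<Rightarrow> real"
  assumes "\<And>i. i < n \<Longrightarrow> \<tau> i \<le> \<tau> (Suc i)"
  shows "(\<integral>\<^sup>+r. ennreal ((\<Sum>i<n. c i * indicator {\<tau> i <.. \<tau> (Suc i)} r)\<^sup>2) \<partial>lborel)
    = ennreal (\<Sum>i<n. (c i)\<^sup>2 * (\<tau> (Suc i) - \<tau> i))"
proof -
  have "has_bochner_integral lborel (\<lambda>r. \<Sum>i<n. (c i)\<^sup>2 * indicator {\<tau> i <.. \<tau> (Suc i)} r)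
      (\<Sum>i<n. (c i)\<^sup>2 * measure lborel {\<tau> i <.. \<tau> (Suc i)})"
    using assms by (intro has_bochner_integral_sum has_bochner_integral_mult_right has_bochner_integral_real_indicator) auto
  moreover have "(\<Sum>i<n. (c i)\<^sup>2 * measure lborel {\<tau> i <.. \<tau> (Suc i)}) = (\<Sum>i<n. (c i)\<^sup>2 * (\<tau> (Suc i) - \<tau> i))"
    using assms by (intro sum.cong) auto
  ultimately have hb: "has_bochner_integral lborel (\<lambda>r. \<Sum>i<n. (c i)\<^sup>2 * indicator {\<tau> i <.. \<tau> (Suc i)} r)
      (\<Sum>i<n. (c i)\<^sup>2 * (\<tau> (Suc i) - \<tau> i))" by simp
  have "(\<Sum>i<n. c i * indicator {\<tau> i <.. \<tau> (Suc i)} r)\<^sup>2 = (\<Sum>i<n. (c i)\<^sup>2 * indicator {\<tau> i <.. \<tau> (Suc i)} r)" for r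
    by (rule step_function_square(1)) (rule assms)
  then show ?thesis
    by (simp only:) (rule nn_integral_eq_has_bochner[OF hb], auto intro!: sum_nonneg)
qed

context wiener_setting
begin

text \<open>The moment generating function of a centred Gaussian variable, computed by splitting off
  the last increment. Adaptedness is part of the induction because the exponential of the earlier
  sum serves as the past factor in \<open>increment_mult_exp\<close>.\<close>

lemma deterministic_exp_moment:
  assumes "0 \<le> \<tau> 0" "\<And>i. i < n \<Longrightarrow> \<tau> i \<le> \<tau> (Suc i)" "\<tau> n \<le> T"
  shows "0 \<le> \<tau> n \<and> simple_integral W n \<tau> (\<lambda>i \<omega>. c i) \<in> borel_measurable (F (\<tau> n)) \<and>
    has_bochner_integral M (\<lambda>\<omega>. exp (l * simple_integral W n \<tau> (\<lambda>i \<omega>. c i) \<omega>))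
     (exp (l\<^sup>2 * (\<Sum>i<n. (c i)\<^sup>2 * (\<tau> (Suc i) - \<tau> i)) / 2))"
  using assms
proof (induction n)
  case 0
  then show ?case by (simp add: simple_integral_def has_bochner_integral_iff prob_space)
next
  case (Suc n)
  let ?S = "simple_integral W n \<tau> (\<lambda>i \<omega>. c i)"
  have le: "\<tau> n \<le> \<tau> (Suc n)" "\<tau> (Suc n) \<le> T" using Suc.prems by auto
  have IH: "0 \<le> \<tau> n" "?S \<in> borel_measurable (F (\<tau> n))"
    "has_bochner_integral M (\<lambda>\<omega>. exp (l * ?S \<omega>)) (exp (l\<^sup>2 * (\<Sum>i<n. (c i)\<^sup>2 * (\<tau> (Suc i) - \<tau> i)) / 2))"
    using Suc le by auto
  have S: "simple_integral W (Suc n) \<tau> (\<lambda>i \<omega>. c i) = (\<lambda>\<omega>. ?S \<omega> + c n * (W (\<tau> (Suc n)) \<omega> - W (\<tau> n) \<omega>))"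
    by (auto simp: simple_integral_def)
  have "?S \<in> borel_measurable (F (\<tau> (Suc n)))"
    by (rule measurable_filtration_mono[OF IH(1) le IH(2)])
  moreover have "(\<lambda>\<omega>. W (\<tau> (Suc n)) \<omega> - W (\<tau> n) \<omega>) \<in> borel_measurable (F (\<tau> (Suc n)))"
    by (rule increment_measurable[OF IH(1) le])
  ultimately have meas: "simple_integral W (Suc n) \<tau> (\<lambda>i \<omega>. c i) \<in> borel_measurable (F (\<tau> (Suc n)))"
    unfolding S by measurable
  have "(\<lambda>\<omega>. exp (l * ?S \<omega>)) \<in> borel_measurable (F (\<tau> n))"
    using IH(2) by measurable
  moreover have "integrable M (\<lambda>\<omega>. exp (l * ?S \<omega>))"
    "expectation (\<lambda>\<omega>. exp (l * ?S \<omega>)) = exp (l\<^sup>2 * (\<Sum>i<n. (c i)\<^sup>2 * (\<tau> (Suc i) - \<tau> i)) / 2)"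
    using IH(3) by (auto simp: has_bochner_integral_iff)
  ultimately have "has_bochner_integral M (\<lambda>\<omega>. exp (l * ?S \<omega>) * exp ((l * c n) * (W (\<tau> (Suc n)) \<omega> - W (\<tau> n) \<omega>)))
     (exp (l\<^sup>2 * (\<Sum>i<n. (c i)\<^sup>2 * (\<tau> (Suc i) - \<tau> i)) / 2) * exp ((l * c n)\<^sup>2 * (\<tau> (Suc n) - \<tau> n) / 2))"
    using increment_mult_exp[OF IH(1) le, of "\<lambda>\<omega>. exp (l * ?S \<omega>)" "l * c n"] by simp
  then have "has_bochner_integral M (\<lambda>\<omega>. exp (l * simple_integral W (Suc n) \<tau> (\<lambda>i \<omega>. c i) \<omega>))
     (exp (l\<^sup>2 * (\<Sum>i<Suc n. (c i)\<^sup>2 * (\<tau> (Suc i) - \<tau> i)) / 2))"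
  proof -
    assume hb: "has_bochner_integral M (\<lambda>\<omega>. exp (l * ?S \<omega>) * exp ((l * c n) * (W (\<tau> (Suc n)) \<omega> - W (\<tau> n) \<omega>)))
     (exp (l\<^sup>2 * (\<Sum>i<n. (c i)\<^sup>2 * (\<tau> (Suc i) - \<tau> i)) / 2) * exp ((l * c n)\<^sup>2 * (\<tau> (Suc n) - \<tau> n) / 2))"
    have 1: "exp (l * ?S \<omega>) * exp ((l * c n) * (W (\<tau> (Suc n)) \<omega> - W (\<tau> n) \<omega>))
        = exp (l * simple_integral W (Suc n) \<tau> (\<lambda>i \<omega>. c i) \<omega>)" for \<omega>
      unfolding S by (simp add: distrib_left mult.assoc flip: exp_add)
    have 2: "exp (l\<^sup>2 * (\<Sum>i<n. (c i)\<^sup>2 * (\<tau> (Suc i) - \<tau> i)) / 2) * exp ((l * c n)\<^sup>2 * (\<tau> (Suc n) - \<tau> n) / 2)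
        = exp (l\<^sup>2 * (\<Sum>i<Suc n. (c i)\<^sup>2 * (\<tau> (Suc i) - \<tau> i)) / 2)"
      by (simp add: power_mult_distrib distrib_left add_divide_distrib mult.assoc flip: exp_add)
    show ?thesis using hb unfolding 1 2 .
  qed
  with meas IH(1) le(1) show ?case by auto
qed

text \<open>After division by \<open>sqrt v\<close> the variance is at most 1, so the exponential
  moments with parameters \<open>1 / sqrt v\<close> and \<open>- (1 / sqrt v)\<close> are at most
  \<open>exp (1 / 2)\<close>. A positive upper bound \<open>v\<close>, rather than the variance
  itself, keeps this meaningful when the variance is zero.\<close>

lemma deterministic_moment:
  assumes \<tau>: "0 \<le> \<tau> 0" "\<And>i. i < n \<Longrightarrow> \<tau> i \<le> \<tau> (Suc i)" "\<tau> n \<le> T"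
    and v: "(\<Sum>i<n. (c i)\<^sup>2 * (\<tau> (Suc i) - \<tau> i)) \<le> v" "0 < v" and p: "1 \<le> p"
  shows "(\<integral>\<^sup>+\<omega>. ennreal (\<bar>simple_integral W n \<tau> (\<lambda>i \<omega>. c i) \<omega>\<bar> powr p) \<partial>M) \<le> ennreal (moment_const p * v powr (p / 2))"
proof -
  let ?S = "simple_integral W n \<tau> (\<lambda>i \<omega>. c i)"
  let ?\<sigma> = "\<Sum>i<n. (c i)\<^sup>2 * (\<tau> (Suc i) - \<tau> i)"
  let ?N = "nat \<lceil>p\<rceil>"
  let ?l = "1 / sqrt v"
  define B where "B = (1 + real ?N ^ ?N) * v powr (p / 2)"
  have B: "0 \<le> B" by (simp add: B_def)
  have hb: "has_bochner_integral M (\<lambda>\<omega>. exp (l * ?S \<omega>)) (exp (l\<^sup>2 * ?\<sigma> / 2))" for l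
    using deterministic_exp_moment[of \<tau> n c l] \<tau> by blast
  have pt: "\<bar>?S \<omega>\<bar> powr p \<le> B * (exp (?l * ?S \<omega>) + exp ((- ?l) * ?S \<omega>))" for \<omega>
  proof -
    have "\<bar>?S \<omega>\<bar> = sqrt v * \<bar>?l * ?S \<omega>\<bar>" using v by (simp add: abs_mult)
    then have "\<bar>?S \<omega>\<bar> powr p = (sqrt v * \<bar>?l * ?S \<omega>\<bar>) powr p" by simp
    also have "\<dots> = sqrt v powr p * \<bar>?l * ?S \<omega>\<bar> powr p" by (rule powr_mult)
    also have "sqrt v powr p = v powr (p / 2)" using v by (simp add: powr_half_sqrt[symmetric] powr_powr)
    also have "v powr (p / 2) * \<bar>?l * ?S \<omega>\<bar> powr p \<le> v powr (p / 2) * ((1 + real ?N ^ ?N) * (exp (?l * ?S \<omega>) + exp (- (?l * ?S \<omega>))))"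
      using p by (intro mult_left_mono abs_powr_le_exp) (assumption, linarith, simp)
    finally show ?thesis by (simp add: B_def mult_ac)
  qed
  have "has_bochner_integral M (\<lambda>\<omega>. B * (exp (?l * ?S \<omega>) + exp ((- ?l) * ?S \<omega>)))
     (B * (exp (?l\<^sup>2 * ?\<sigma> / 2) + exp ((- ?l)\<^sup>2 * ?\<sigma> / 2)))"
    by (intro has_bochner_integral_mult_right has_bochner_integral_add hb)
  then have "(\<integral>\<^sup>+\<omega>. ennreal (B * (exp (?l * ?S \<omega>) + exp ((- ?l) * ?S \<omega>))) \<partial>M)
     = ennreal (B * (exp (?l\<^sup>2 * ?\<sigma> / 2) + exp ((- ?l)\<^sup>2 * ?\<sigma> / 2)))"
    by (rule nn_integral_eq_has_bochner) (use B in auto)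
  moreover have "(\<integral>\<^sup>+\<omega>. ennreal (\<bar>?S \<omega>\<bar> powr p) \<partial>M) \<le> (\<integral>\<^sup>+\<omega>. ennreal (B * (exp (?l * ?S \<omega>) + exp ((- ?l) * ?S \<omega>))) \<partial>M)"
    by (intro nn_integral_mono ennreal_leI pt)
  moreover have "B * (exp (?l\<^sup>2 * ?\<sigma> / 2) + exp ((- ?l)\<^sup>2 * ?\<sigma> / 2)) \<le> B * (exp (1 / 2) + exp (1 / 2))"
  proof -
    have "?l\<^sup>2 * ?\<sigma> / 2 \<le> 1 / 2" using v by (simp add: power_divide)
    then show ?thesis by (intro mult_left_mono add_mono B) auto
  qed
  moreover have "B * (exp (1 / 2) + exp (1 / 2)) = moment_const p * v powr (p / 2)"
    by (simp add: B_def moment_const_def)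
  ultimately show ?thesis
    by (simp only:) (erule order_trans, intro ennreal_leI, simp only:)
qed

end


section \<open>Existence of Wiener integrals\<close>

lemma AE_pair_fstI:
  assumes "sigma_finite_measure N" "AE x in L. P x"
  shows "AE z in L \<Otimes>\<^sub>M N. P (fst z)"
proof -
  interpret N: sigma_finite_measure N by fact
  obtain A where A: "A \<in> null_sets L" "{x \<in> space L. \<not> P x} \<subseteq> A"
    using assms(2) by (auto simp: eventually_ae_filter)
  have "A \<times> space N \<in> null_sets (L \<Otimes>\<^sub>M N)"
    using A by (auto simp: N.emeasure_pair_measure_Times null_sets_def)
  moreover have "{z \<in> space (L \<Otimes>\<^sub>M N). \<not> P (fst z)} \<subseteq> A \<times> space N"
    using A by (auto simp: space_pair_measure)
  ultimately show ?thesis by (auto simp: eventually_ae_filter)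
qed

text \<open>Preimages under \<open>f\<close> and \<open>g\<close> differ by null sets, which the
  completion contains. This supplies the measurability in \<open>has_ito_integral\<close> for an
  integrand that is only almost everywhere equal to a Borel function.\<close>

lemma borel_measurable_completion_cong_AE:
  fixes f g :: "'b \<Rightarrow> real"
  assumes g: "g \<in> borel_measurable N" and eq: "AE x in N. f x = g x"
  shows "f \<in> borel_measurable (completion N)"
proof (rule measurableI)
  fix B :: "real set" assume B: "B \<in> sets borel"
  show "f -` B \<inter> space (completion N) \<in> sets (completion N)"
  proof (rule completion.in_sets_AE)
    show "g -` B \<inter> space N \<in> sets (completion N)"
      by (intro sets_completionI_sets measurable_sets[OF g B])
    show "AE x in completion N. x \<in> g -` B \<inter> space N \<longleftrightarrow> x \<in> f -` B \<inter> space (completion N)"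
      using AE_completion[OF eq] by eventually_elim simp
  qed simp
qed simp

context wiener_setting
begin

lemma simple_process_dataD:
  assumes "simple_process_data M F t n \<tau> \<xi>" "t \<le> T" "i < n"
  shows "0 \<le> \<tau> i" "\<tau> i \<le> \<tau> (Suc i)" "\<tau> (Suc i) \<le> t" "bounded_adapted (\<tau> i) (\<xi> i)"
proof -
  have mono: "\<tau> j \<le> \<tau> k" if "j \<le> k" "k \<le> n" for j k
    using that
  proof (induction rule: dec_induct)
    case (step m)
    then show ?case using assms by (auto simp: simple_process_data_def intro: order_trans)
  qed simp
  show "0 \<le> \<tau> i" using mono[of 0 i] assms by (auto simp: simple_process_data_def)
  show "\<tau> i \<le> \<tau> (Suc i)" using assms by (auto simp: simple_process_data_def)
  show "\<tau> (Suc i) \<le> t" using mono[of "Suc i" n] assms by (auto simp: simple_process_data_def)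
  show "bounded_adapted (\<tau> i) (\<xi> i)" using assms by (auto simp: simple_process_data_def bounded_adapted_def)
qed

lemma simple_process_outside:
  assumes "simple_process_data M F t n \<tau> \<xi>" "t \<le> T" "r \<notin> {0..t}"
  shows "simple_process n \<tau> \<xi> r \<omega> = 0"
  unfolding simple_process_def
proof (intro sum.neutral ballI)
  fix i assume "i \<in> {..<n}"
  then show "\<xi> i \<omega> * indicator {\<tau> i<..\<tau> (Suc i)} r = 0"
    using simple_process_dataD[OF assms(1,2), of i] assms(3) by (auto simp: indicator_def)
qed

lemma simple_process_measurable:
  assumes "simple_process_data M F t n \<tau> \<xi>" "t \<le> T"
  shows "(\<lambda>(r, \<omega>). simple_process n \<tau> \<xi> r \<omega>) \<in> borel_measurable (lborel \<Otimes>\<^sub>M M)"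
proof -
  have [measurable]: "\<xi> i \<in> borel_measurable M" if "i < n" for i
    using simple_process_dataD[OF assms that] assms(2) by (intro bounded_adapted_measurable[of "\<tau> i"]) auto
  show ?thesis
    unfolding simple_process_def split_beta' by (intro borel_measurable_sum) auto
qed

lemma simple_integral_measurable:
  assumes "simple_process_data M F t n \<tau> \<xi>" "t \<le> T"
  shows "simple_integral W n \<tau> \<xi> \<in> borel_measurable M"
proof -
  have "\<xi> i \<in> borel_measurable M" "W (\<tau> i) \<in> borel_measurable M" "W (\<tau> (Suc i)) \<in> borel_measurable M" if "i < n" for i
    using simple_process_dataD[OF assms that] assms(2)
    by (auto intro!: bounded_adapted_measurable[of "\<tau> i"] wiener_measurable)
  then show ?thesis unfolding simple_integral_def by auto
qed

lemma bounded_adapted_uminus: "bounded_adapted s \<xi> \<Longrightarrow> bounded_adapted s (\<lambda>\<omega>. - \<xi> \<omega>)"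
  by (auto simp: bounded_adapted_def)

text \<open>The three processes become one family over a disjoint sum of index sets, with the signs
  moved into the coefficients; here the generality of \<open>elementary_isometry\<close> pays off.
  Three terms are what \<open>ito_diff_unique\<close> compares, and a difference of two is obtained
  with an empty third process.\<close>

lemma simple_isometry_diff:
  assumes 1: "simple_process_data M F t1 n1 \<tau>1 \<xi>1" "t1 \<le> T"
    and 2: "simple_process_data M F t2 n2 \<tau>2 \<xi>2" "t2 \<le> T"
    and 3: "simple_process_data M F t3 n3 \<tau>3 \<xi>3" "t3 \<le> T"
  shows "(\<integral>\<^sup>+\<omega>. ennreal ((simple_integral W n1 \<tau>1 \<xi>1 \<omega> - simple_integral W n2 \<tau>2 \<xi>2 \<omega> - simple_integral W n3 \<tau>3 \<xi>3 \<omega>)\<^sup>2) \<partial>M)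
     = (\<integral>\<^sup>+(r, \<omega>). ennreal ((simple_process n1 \<tau>1 \<xi>1 r \<omega> - simple_process n2 \<tau>2 \<xi>2 r \<omega> - simple_process n3 \<tau>3 \<xi>3 r \<omega>)\<^sup>2) \<partial>(lborel \<Otimes>\<^sub>M M))"
proof -
  define I where "I = {..<n1} <+> ({..<n2} <+> {..<n3})"
  define \<alpha> where "\<alpha> = case_sum \<tau>1 (case_sum \<tau>2 \<tau>3)"
  define \<beta> where "\<beta> = case_sum (\<lambda>i. \<tau>1 (Suc i)) (case_sum (\<lambda>i. \<tau>2 (Suc i)) (\<lambda>i. \<tau>3 (Suc i)))"
  define \<xi> where "\<xi> = case_sum \<xi>1 (case_sum (\<lambda>i \<omega>. - \<xi>2 i \<omega>) (\<lambda>i \<omega>. - \<xi>3 i \<omega>))"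
  have "finite I" by (simp add: I_def)
  moreover have "0 \<le> \<alpha> i \<and> \<alpha> i \<le> \<beta> i \<and> \<beta> i \<le> T \<and> bounded_adapted (\<alpha> i) (\<xi> i)" if "i \<in> I" for i
    using that simple_process_dataD[OF 1] simple_process_dataD[OF 2] simple_process_dataD[OF 3] 1(2) 2(2) 3(2)
    by (fastforce simp: I_def \<alpha>_def \<beta>_def \<xi>_def intro: bounded_adapted_uminus)
  ultimately have iso: "(\<integral>\<^sup>+\<omega>. ennreal ((\<Sum>i\<in>I. \<xi> i \<omega> * (W (\<beta> i) \<omega> - W (\<alpha> i) \<omega>))\<^sup>2) \<partial>M)
     = (\<integral>\<^sup>+(r, \<omega>). ennreal ((\<Sum>i\<in>I. \<xi> i \<omega> * indicator {\<alpha> i <.. \<beta> i} r)\<^sup>2) \<partial>(lborel \<Otimes>\<^sub>M M))"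
    by (intro elementary_isometry) auto
  have sumI: "sum f I = (\<Sum>i<n1. f (Inl i)) + ((\<Sum>i<n2. f (Inr (Inl i))) + (\<Sum>i<n3. f (Inr (Inr i))))" for f :: "_ \<Rightarrow> real"
    by (simp add: I_def sum.Plus)
  have S: "(\<Sum>i\<in>I. \<xi> i \<omega> * (W (\<beta> i) \<omega> - W (\<alpha> i) \<omega>))
      = simple_integral W n1 \<tau>1 \<xi>1 \<omega> - simple_integral W n2 \<tau>2 \<xi>2 \<omega> - simple_integral W n3 \<tau>3 \<xi>3 \<omega>" for \<omega>
    unfolding sumI by (simp only: \<alpha>_def \<beta>_def \<xi>_def sum.case add_uminus_conv_diff simple_integral_def mult_minus_left sum_negf)
  have P: "(\<Sum>i\<in>I. \<xi> i \<omega> * indicator {\<alpha> i <.. \<beta> i} r)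
      = simple_process n1 \<tau>1 \<xi>1 r \<omega> - simple_process n2 \<tau>2 \<xi>2 r \<omega> - simple_process n3 \<tau>3 \<xi>3 r \<omega>" for r \<omega>
    unfolding sumI by (simp only: \<alpha>_def \<beta>_def \<xi>_def sum.case add_uminus_conv_diff simple_process_def mult_minus_left sum_negf)
  show ?thesis using iso unfolding S P .
qed

lemma nn_integral_pair_fst:
  assumes [measurable]: "f \<in> borel_measurable lborel"
  shows "(\<integral>\<^sup>+z. f (fst z) \<partial>(lborel \<Otimes>\<^sub>M M)) = (\<integral>\<^sup>+r. f r \<partial>(lborel :: real measure))"
  by (subst nn_integral_fst[symmetric]) (simp_all add: emeasure_space_1)

text \<open>Step functions with squared errors below \<open>1 / 4 ^ k\<close> have, by the isometry,
  integrals that are Cauchy at the rate asked for by \<open>L2_fast_Cauchy_limit\<close>. Fatou's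
  lemma passes the Gaussian moment bounds to the limit. The 3 in \<open>3 * V\<close> is the price
  of estimating the variances of the approximations by
  \<open>nn_integral_square_sum3\<close>.\<close>

lemma wiener_integral_exists:
  assumes h[measurable]: "h \<in> borel_measurable borel" and t: "0 < t" "t \<le> T"
    and V: "(\<integral>\<^sup>+r. ennreal (indicator {0..t} r * (h r)\<^sup>2) \<partial>lborel) \<le> ennreal V" "0 \<le> V"
  obtains n \<tau> c J where "J \<in> borel_measurable M"
    "\<And>k. simple_process_data M F t (n k) (\<tau> k) (\<lambda>i \<omega>. c k i)"
    "(\<lambda>k. \<integral>\<^sup>+(r, \<omega>). ennreal (indicator {0..t} r * (simple_process (n k) (\<tau> k) (\<lambda>i \<omega>. c k i) r \<omega> - h r)\<^sup>2)
        \<partial>completion (lborel \<Otimes>\<^sub>M M)) \<longlonglongrightarrow> 0"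
    "(\<lambda>k. \<integral>\<^sup>+\<omega>. ennreal ((simple_integral W (n k) (\<tau> k) (\<lambda>i \<omega>. c k i) \<omega> - J \<omega>)\<^sup>2) \<partial>M) \<longlonglongrightarrow> 0"
    "\<And>p. 1 \<le> p \<Longrightarrow> (\<integral>\<^sup>+\<omega>. ennreal (\<bar>J \<omega>\<bar> powr p) \<partial>M) \<le> ennreal (moment_const p * (3 * V) powr (p / 2))"
proof -
  define close where "close k n c \<longleftrightarrow> (\<integral>\<^sup>+r. ennreal (indicator {0..t} r *
     ((\<Sum>i<n. c i * indicator {t * real i / real n <.. t * real (Suc i) / real n} r) - h r)\<^sup>2) \<partial>lborel) < ennreal (1 / 4 ^ k)"
    for k n and c :: "nat \<Rightarrow> real"
  have "\<exists>n c. 0 < n \<and> close k n c" for k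
    unfolding close_def by (rule step_functions_dense_L2[OF h t(1)]) (use V in \<open>auto intro: le_less_trans\<close>)
  then obtain n c where n: "\<And>k. 0 < n k" and close: "\<And>k. close k (n k) (c k)"
    by metis
  define \<tau> where "\<tau> k i = t * real i / real (n k)" for k i
  define \<phi> where "\<phi> k r = (\<Sum>i<n k. c k i * indicator {\<tau> k i <.. \<tau> k (Suc i)} r)" for k r
  define S where "S k = simple_integral W (n k) (\<tau> k) (\<lambda>i \<omega>. c k i)" for k
  have \<phi>[measurable]: "\<phi> k \<in> borel_measurable borel" for k unfolding \<phi>_def by measurable
  have \<tau>: "0 \<le> \<tau> k 0" "\<tau> k i \<le> \<tau> k (Suc i)" "\<tau> k (n k) = t" for k i
    using t n[of k] by (auto simp: \<tau>_def divide_right_mono)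
  have data: "simple_process_data M F t (n k) (\<tau> k) (\<lambda>i \<omega>. c k i)" for k
    using \<tau> by (auto simp: simple_process_data_def)
  \<comment> \<open>The empty process, used as the third term of
    \<open>simple_isometry_diff\<close>.\<close>
  have data0: "simple_process_data M F t 0 (\<lambda>_. 0) (\<lambda>_ _. 0)"
    using t by (auto simp: simple_process_data_def)
  have proc: "simple_process (n k) (\<tau> k) (\<lambda>i \<omega>. c k i) r \<omega> = \<phi> k r" for k r \<omega>
    by (simp add: simple_process_def \<phi>_def)
  have outside: "\<phi> k r = 0" if "r \<notin> {0..t}" for k r
    using simple_process_outside[OF data t(2) that] unfolding proc .
  have approx: "(\<integral>\<^sup>+r. ennreal (indicator {0..t} r * (\<phi> k r - h r)\<^sup>2) \<partial>lborel) \<le> ennreal (1 / 4 ^ k)" for k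
    using close[of k] unfolding close_def \<phi>_def \<tau>_def by (rule less_imp_le)
  have meas_S: "S k \<in> borel_measurable M" for k
    unfolding S_def by (rule simple_integral_measurable[OF data t(2)])
  have cauchy: "(\<integral>\<^sup>+\<omega>. ennreal ((S j \<omega> - S k \<omega>)\<^sup>2) \<partial>M) \<le> ennreal (3 * (1 / 4 ^ j + 1 / 4 ^ k))" for j k
  proof -
    have "(\<integral>\<^sup>+\<omega>. ennreal ((S j \<omega> - S k \<omega>)\<^sup>2) \<partial>M) = (\<integral>\<^sup>+z. ennreal ((\<phi> j (fst z) - \<phi> k (fst z))\<^sup>2) \<partial>(lborel \<Otimes>\<^sub>M M))"
      using simple_isometry_diff[OF data[of j] t(2) data[of k] t(2) data0 t(2)]
      by (simp add: S_def proc split_beta') (simp add: simple_integral_def simple_process_def)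
    also have "\<dots> = (\<integral>\<^sup>+r. ennreal ((\<phi> j r - \<phi> k r)\<^sup>2) \<partial>lborel)"
      by (rule nn_integral_pair_fst) measurable
    also have "\<dots> = (\<integral>\<^sup>+r. ennreal (indicator {0..t} r * ((\<phi> j r - h r) + (h r - \<phi> k r) + 0)\<^sup>2) \<partial>lborel)"
    proof (rule nn_integral_cong)
      show "ennreal ((\<phi> j r - \<phi> k r)\<^sup>2) = ennreal (indicator {0..t} r * ((\<phi> j r - h r) + (h r - \<phi> k r) + 0)\<^sup>2)" for r
        using outside[of r] by (cases "r \<in> {0..t}") simp_all
    qed
    also have "\<dots> \<le> 3 * (\<integral>\<^sup>+r. ennreal (indicator {0..t} r * (\<phi> j r - h r)\<^sup>2) \<partial>lborel)
        + 3 * (\<integral>\<^sup>+r. ennreal (indicator {0..t} r * (h r - \<phi> k r)\<^sup>2) \<partial>lborel)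
        + 3 * (\<integral>\<^sup>+r. ennreal (indicator {0..t} r * 0\<^sup>2) \<partial>lborel)"
      by (rule nn_integral_square_sum3) auto
    also have "\<dots> = 3 * (\<integral>\<^sup>+r. ennreal (indicator {0..t} r * (\<phi> j r - h r)\<^sup>2) \<partial>lborel)
        + 3 * (\<integral>\<^sup>+r. ennreal (indicator {0..t} r * (\<phi> k r - h r)\<^sup>2) \<partial>lborel)"
      by (simp add: power2_commute[of "h _"])
    also have "\<dots> \<le> 3 * ennreal (1 / 4 ^ j) + 3 * ennreal (1 / 4 ^ k)"
      by (intro add_mono mult_left_mono approx) auto
    also have "\<dots> = ennreal (3 * (1 / 4 ^ j + 1 / 4 ^ k))"
      using ennreal_mult[of 3 "1 / 4 ^ j"] ennreal_mult[of 3 "1 / 4 ^ k"]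
        ennreal_plus[of "3 * (1 / 4 ^ j)" "3 * (1 / 4 ^ k)"] by (simp add: distrib_left)
    finally show ?thesis .
  qed
  obtain J where J: "J \<in> borel_measurable M" "AE \<omega> in M. (\<lambda>k. S k \<omega>) \<longlonglongrightarrow> J \<omega>"
    "(\<lambda>k. \<integral>\<^sup>+\<omega>. ennreal ((S k \<omega> - J \<omega>)\<^sup>2) \<partial>M) \<longlonglongrightarrow> 0"
    by (rule L2_fast_Cauchy_limit[OF meas_S _ cauchy]) auto
  show thesis
  proof (rule that[OF J(1) data _ J(3)[unfolded S_def]])
    have to0: "(\<lambda>k. ennreal (1 / 4 ^ k)) \<longlonglongrightarrow> 0"
    proof -
      have "(\<lambda>k. (1 / 4 :: real) ^ k) \<longlonglongrightarrow> 0" by (intro LIMSEQ_realpow_zero) auto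
      then have "(\<lambda>k. ennreal ((1 / 4) ^ k)) \<longlonglongrightarrow> ennreal 0" by (rule tendsto_ennrealI)
      then show ?thesis by (simp add: power_divide)
    qed
    have "(\<integral>\<^sup>+(r, \<omega>). ennreal (indicator {0..t} r * (simple_process (n k) (\<tau> k) (\<lambda>i \<omega>. c k i) r \<omega> - h r)\<^sup>2) \<partial>completion (lborel \<Otimes>\<^sub>M M))
        = (\<integral>\<^sup>+r. ennreal (indicator {0..t} r * (\<phi> k r - h r)\<^sup>2) \<partial>lborel)" for k
      unfolding proc nn_integral_completion split_beta' by (rule nn_integral_pair_fst) measurable
    then show "(\<lambda>k. \<integral>\<^sup>+(r, \<omega>). ennreal (indicator {0..t} r * (simple_process (n k) (\<tau> k) (\<lambda>i \<omega>. c k i) r \<omega> - h r)\<^sup>2)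
        \<partial>completion (lborel \<Otimes>\<^sub>M M)) \<longlonglongrightarrow> 0"
      using approx by (intro tendsto_sandwich[OF _ _ tendsto_const to0]) auto
    fix p :: real assume p: "1 \<le> p"
    \<comment> \<open>Bound for the variance of \<open>S k\<close>, from writing
      \<open>\<phi> k\<close> as error plus \<open>h\<close>. The second summand keeps it positive
      when \<open>V\<close> is 0, as \<open>deterministic_moment\<close> requires, and vanishes in
      the limit.\<close>
    define v where "v k = 3 * V + 3 / 4 ^ k" for k :: nat
    have v: "0 < v k" for k using V(2) by (simp add: v_def add_nonneg_pos)
    have \<sigma>: "(\<Sum>i<n k. (c k i)\<^sup>2 * (\<tau> k (Suc i) - \<tau> k i)) \<le> v k" for k
    proof -
      have "ennreal (\<Sum>i<n k. (c k i)\<^sup>2 * (\<tau> k (Suc i) - \<tau> k i)) = (\<integral>\<^sup>+r. ennreal ((\<phi> k r)\<^sup>2) \<partial>lborel)"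
        unfolding \<phi>_def using \<tau> by (intro nn_integral_step_function_square[symmetric]) auto
      also have "\<dots> = (\<integral>\<^sup>+r. ennreal (indicator {0..t} r * ((\<phi> k r - h r) + h r + 0)\<^sup>2) \<partial>lborel)"
      proof (rule nn_integral_cong)
        show "ennreal ((\<phi> k r)\<^sup>2) = ennreal (indicator {0..t} r * ((\<phi> k r - h r) + h r + 0)\<^sup>2)" for r
          using outside[of r] by (cases "r \<in> {0..t}") simp_all
      qed
      also have "\<dots> \<le> 3 * (\<integral>\<^sup>+r. ennreal (indicator {0..t} r * (\<phi> k r - h r)\<^sup>2) \<partial>lborel)
          + 3 * (\<integral>\<^sup>+r. ennreal (indicator {0..t} r * (h r)\<^sup>2) \<partial>lborel)
          + 3 * (\<integral>\<^sup>+r. ennreal (indicator {0..t} r * 0\<^sup>2) \<partial>lborel)"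
        by (rule nn_integral_square_sum3) auto
      also have "\<dots> \<le> 3 * ennreal (1 / 4 ^ k) + 3 * ennreal V"
        using V(1) by (simp, intro add_mono mult_left_mono approx[simplified]) auto
      also have "\<dots> = ennreal (v k)"
        using ennreal_mult[of 3 "1 / 4 ^ k"] ennreal_mult[of 3 V] V(2)
          ennreal_plus[of "3 * (1 / 4 ^ k)" "3 * V"] by (simp add: v_def add.commute)
      finally show ?thesis using v[of k] by (simp add: ennreal_le_iff)
    qed
    have "(\<integral>\<^sup>+\<omega>. ennreal (\<bar>J \<omega>\<bar> powr p) \<partial>M) = (\<integral>\<^sup>+\<omega>. liminf (\<lambda>k. ennreal (\<bar>S k \<omega>\<bar> powr p)) \<partial>M)"
    proof (rule nn_integral_cong_AE)
      show "AE \<omega> in M. ennreal (\<bar>J \<omega>\<bar> powr p) = liminf (\<lambda>k. ennreal (\<bar>S k \<omega>\<bar> powr p))"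
        using J(2)
      proof eventually_elim
        case (elim \<omega>)
        then have "(\<lambda>k. ennreal (\<bar>S k \<omega>\<bar> powr p)) \<longlonglongrightarrow> ennreal (\<bar>J \<omega>\<bar> powr p)"
          using p by (intro tendsto_ennrealI tendsto_powr' tendsto_rabs tendsto_const) auto
        then show ?case by (rule lim_imp_Liminf[OF sequentially_bot, symmetric])
      qed
    qed
    also have "\<dots> \<le> liminf (\<lambda>k. \<integral>\<^sup>+\<omega>. ennreal (\<bar>S k \<omega>\<bar> powr p) \<partial>M)"
      using meas_S by (intro nn_integral_liminf) auto
    also have "\<dots> \<le> liminf (\<lambda>k. ennreal (moment_const p * v k powr (p / 2)))"
    proof (intro Liminf_mono always_eventually allI)
      fix k
      show "(\<integral>\<^sup>+\<omega>. ennreal (\<bar>S k \<omega>\<bar> powr p) \<partial>M) \<le> ennreal (moment_const p * v k powr (p / 2))"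
        unfolding S_def using \<tau> t(2) p by (intro deterministic_moment \<sigma> v) auto
    qed
    also have "\<dots> = ennreal (moment_const p * (3 * V) powr (p / 2))"
    proof (rule lim_imp_Liminf[OF sequentially_bot])
      have "(\<lambda>k. 3 * V + 3 * (1 / 4) ^ k) \<longlonglongrightarrow> 3 * V + 3 * 0"
        by (intro tendsto_intros LIMSEQ_realpow_zero) auto
      then have "v \<longlonglongrightarrow> 3 * V" by (simp add: v_def[abs_def] power_divide)
      then show "(\<lambda>k. ennreal (moment_const p * v k powr (p / 2))) \<longlonglongrightarrow> ennreal (moment_const p * (3 * V) powr (p / 2))"
        using p v by (intro tendsto_ennrealI tendsto_mult tendsto_powr' tendsto_const) (auto intro!: always_eventually less_imp_le)
    qed
    finally show "(\<integral>\<^sup>+\<omega>. ennreal (\<bar>J \<omega>\<bar> powr p) \<partial>M) \<le> ennreal (moment_const p * (3 * V) powr (p / 2))" .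
  qed
qed

end


section \<open>Versions of the Ito integral\<close>

lemma ennreal_tendsto_3_mult_0:
  fixes x :: "nat \<Rightarrow> ennreal"
  assumes "x \<longlonglongrightarrow> 0"
  shows "(\<lambda>k. 3 * x k) \<longlonglongrightarrow> 0"
  using ennreal_tendsto_cmult[OF _ assms, of "3"] by simp

context wiener_setting
begin

text \<open>A simple process vanishes outside its horizon, so the cutoff can be moved onto the
  integrand. Integrals over different time intervals can then be compared on one product
  space.\<close>

lemma simple_process_cutoff:
  assumes "simple_process_data M F t n \<tau> \<xi>" "t \<le> T"
  shows "indicator {0..t} r * (simple_process n \<tau> \<xi> r \<omega> - f r \<omega>)\<^sup>2
     = (simple_process n \<tau> \<xi> r \<omega> - indicator {0..t} r * f r \<omega>)\<^sup>2"
  using simple_process_outside[OF assms, of r \<omega>] by (cases "r \<in> {0..t}") auto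

text \<open>By the isometry, the elementary integrals of any approximations of the three integrands differ by
  as little as the approximations themselves. In particular the Ito integral is unique up to null sets,
  whatever approximating simple processes, random or not, the chosen version came from.\<close>

lemma ito_diff_unique:
  assumes ito1: "has_ito_integral M F W t1 f1 I1" and t1: "t1 \<le> T"
    and ito2: "has_ito_integral M F W t2 f2 I2" and t2: "t2 \<le> T"
    and ito3: "has_ito_integral M F W t3 f3 I3" and t3: "t3 \<le> T"
    and diff: "AE z in completion (lborel \<Otimes>\<^sub>M M). indicator {0..t1} (fst z) * f1 (fst z) (snd z)
       - indicator {0..t2} (fst z) * f2 (fst z) (snd z) - indicator {0..t3} (fst z) * f3 (fst z) (snd z) = 0"
  shows "AE \<omega> in M. I1 \<omega> - I2 \<omega> = I3 \<omega>"
proof -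
  let ?P = "lborel \<Otimes>\<^sub>M M" and ?C = "completion (lborel \<Otimes>\<^sub>M M)"
  obtain n1 \<tau>1 \<xi>1 where d1: "\<And>k. simple_process_data M F t1 (n1 k) (\<tau>1 k) (\<xi>1 k)"
    and p1: "(\<lambda>k. \<integral>\<^sup>+ (r, \<omega>). ennreal (indicator {0..t1} r * (simple_process (n1 k) (\<tau>1 k) (\<xi>1 k) r \<omega> - f1 r \<omega>)\<^sup>2) \<partial>?C) \<longlonglongrightarrow> 0"
    and l1: "(\<lambda>k. \<integral>\<^sup>+ \<omega>. ennreal ((simple_integral W (n1 k) (\<tau>1 k) (\<xi>1 k) \<omega> - I1 \<omega>)\<^sup>2) \<partial>M) \<longlonglongrightarrow> 0"
    using ito1 unfolding has_ito_integral_def by blast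
  obtain n2 \<tau>2 \<xi>2 where d2: "\<And>k. simple_process_data M F t2 (n2 k) (\<tau>2 k) (\<xi>2 k)"
    and p2: "(\<lambda>k. \<integral>\<^sup>+ (r, \<omega>). ennreal (indicator {0..t2} r * (simple_process (n2 k) (\<tau>2 k) (\<xi>2 k) r \<omega> - f2 r \<omega>)\<^sup>2) \<partial>?C) \<longlonglongrightarrow> 0"
    and l2: "(\<lambda>k. \<integral>\<^sup>+ \<omega>. ennreal ((simple_integral W (n2 k) (\<tau>2 k) (\<xi>2 k) \<omega> - I2 \<omega>)\<^sup>2) \<partial>M) \<longlonglongrightarrow> 0"
    using ito2 unfolding has_ito_integral_def by blast
  obtain n3 \<tau>3 \<xi>3 where d3: "\<And>k. simple_process_data M F t3 (n3 k) (\<tau>3 k) (\<xi>3 k)"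
    and p3: "(\<lambda>k. \<integral>\<^sup>+ (r, \<omega>). ennreal (indicator {0..t3} r * (simple_process (n3 k) (\<tau>3 k) (\<xi>3 k) r \<omega> - f3 r \<omega>)\<^sup>2) \<partial>?C) \<longlonglongrightarrow> 0"
    and l3: "(\<lambda>k. \<integral>\<^sup>+ \<omega>. ennreal ((simple_integral W (n3 k) (\<tau>3 k) (\<xi>3 k) \<omega> - I3 \<omega>)\<^sup>2) \<partial>M) \<longlonglongrightarrow> 0"
    using ito3 unfolding has_ito_integral_def by blast
  have [measurable]: "I1 \<in> borel_measurable M" "I2 \<in> borel_measurable M" "I3 \<in> borel_measurable M"
    using ito1 ito2 ito3 by (auto simp: has_ito_integral_def)
  define S1 where "S1 k = simple_integral W (n1 k) (\<tau>1 k) (\<xi>1 k)" for k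
  define S2 where "S2 k = simple_integral W (n2 k) (\<tau>2 k) (\<xi>2 k)" for k
  define S3 where "S3 k = simple_integral W (n3 k) (\<tau>3 k) (\<xi>3 k)" for k
  have [measurable]: "S1 k \<in> borel_measurable M" "S2 k \<in> borel_measurable M" "S3 k \<in> borel_measurable M" for k
    unfolding S1_def S2_def S3_def
    using simple_integral_measurable[OF d1 t1] simple_integral_measurable[OF d2 t2] simple_integral_measurable[OF d3 t3] by auto
  define \<phi>1 where "\<phi>1 k z = simple_process (n1 k) (\<tau>1 k) (\<xi>1 k) (fst z) (snd z)" for k z
  define \<phi>2 where "\<phi>2 k z = simple_process (n2 k) (\<tau>2 k) (\<xi>2 k) (fst z) (snd z)" for k z
  define \<phi>3 where "\<phi>3 k z = simple_process (n3 k) (\<tau>3 k) (\<xi>3 k) (fst z) (snd z)" for k z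
  have \<phi>: "\<phi>1 k \<in> borel_measurable ?C" "\<phi>2 k \<in> borel_measurable ?C" "\<phi>3 k \<in> borel_measurable ?C" for k
    unfolding \<phi>1_def[abs_def] \<phi>2_def[abs_def] \<phi>3_def[abs_def]
    using simple_process_measurable[OF d1 t1, of k] simple_process_measurable[OF d2 t2, of k] simple_process_measurable[OF d3 t3, of k]
    by (auto intro!: measurable_completion simp: split_beta')
  define g1 where "g1 z = indicator {0..t1} (fst z) * f1 (fst z) (snd z)" for z
  define g2 where "g2 z = indicator {0..t2} (fst z) * f2 (fst z) (snd z)" for z
  define g3 where "g3 z = indicator {0..t3} (fst z) * f3 (fst z) (snd z)" for z
  have g: "g1 \<in> borel_measurable ?C" "g2 \<in> borel_measurable ?C" "g3 \<in> borel_measurable ?C"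
    unfolding g1_def[abs_def] g2_def[abs_def] g3_def[abs_def]
    using ito1 ito2 ito3 by (simp_all add: has_ito_integral_def split_beta')
  have q1: "(\<lambda>k. \<integral>\<^sup>+z. ennreal (1 * (\<phi>1 k z - g1 z)\<^sup>2) \<partial>?C) \<longlonglongrightarrow> 0"
    using p1 unfolding simple_process_cutoff[OF d1 t1] by (simp add: \<phi>1_def g1_def split_beta')
  have q2: "(\<lambda>k. \<integral>\<^sup>+z. ennreal (1 * (g2 z - \<phi>2 k z)\<^sup>2) \<partial>?C) \<longlonglongrightarrow> 0"
    using p2 unfolding simple_process_cutoff[OF d2 t2] by (simp add: \<phi>2_def g2_def split_beta' power2_commute)
  have q3: "(\<lambda>k. \<integral>\<^sup>+z. ennreal (1 * (g3 z - \<phi>3 k z)\<^sup>2) \<partial>?C) \<longlonglongrightarrow> 0"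
    using p3 unfolding simple_process_cutoff[OF d3 t3] by (simp add: \<phi>3_def g3_def split_beta' power2_commute)
  have A: "(\<lambda>k. \<integral>\<^sup>+\<omega>. ennreal (1 * (S1 k \<omega> - S2 k \<omega> - S3 k \<omega>)\<^sup>2) \<partial>M) \<longlonglongrightarrow> 0"
  proof (rule tendsto_sandwich[OF _ _ tendsto_const])
    show "(\<lambda>k. 3 * (\<integral>\<^sup>+z. ennreal (1 * (\<phi>1 k z - g1 z)\<^sup>2) \<partial>?C) + 3 * (\<integral>\<^sup>+z. ennreal (1 * (g2 z - \<phi>2 k z)\<^sup>2) \<partial>?C)
       + 3 * (\<integral>\<^sup>+z. ennreal (1 * (g3 z - \<phi>3 k z)\<^sup>2) \<partial>?C)) \<longlonglongrightarrow> 0"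
      using tendsto_add[OF tendsto_add[OF ennreal_tendsto_3_mult_0[OF q1] ennreal_tendsto_3_mult_0[OF q2]] ennreal_tendsto_3_mult_0[OF q3]]
      by simp
    have "(\<integral>\<^sup>+\<omega>. ennreal (1 * (S1 k \<omega> - S2 k \<omega> - S3 k \<omega>)\<^sup>2) \<partial>M)
        \<le> 3 * (\<integral>\<^sup>+z. ennreal (1 * (\<phi>1 k z - g1 z)\<^sup>2) \<partial>?C) + 3 * (\<integral>\<^sup>+z. ennreal (1 * (g2 z - \<phi>2 k z)\<^sup>2) \<partial>?C)
          + 3 * (\<integral>\<^sup>+z. ennreal (1 * (g3 z - \<phi>3 k z)\<^sup>2) \<partial>?C)" for k
    proof -
      have "(\<integral>\<^sup>+\<omega>. ennreal (1 * (S1 k \<omega> - S2 k \<omega> - S3 k \<omega>)\<^sup>2) \<partial>M) = (\<integral>\<^sup>+z. ennreal ((\<phi>1 k z - \<phi>2 k z - \<phi>3 k z)\<^sup>2) \<partial>?P)"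
        using simple_isometry_diff[OF d1 t1 d2 t2 d3 t3, of k k k]
        by (simp add: S1_def S2_def S3_def \<phi>1_def \<phi>2_def \<phi>3_def split_beta')
      also have "\<dots> = (\<integral>\<^sup>+z. ennreal ((\<phi>1 k z - \<phi>2 k z - \<phi>3 k z)\<^sup>2) \<partial>?C)" by (simp only: nn_integral_completion)
      \<comment> \<open>The inserted integrands cancel because \<open>g1 = g2 + g3\<close> almost
        everywhere.\<close>
      also have "\<dots> = (\<integral>\<^sup>+z. ennreal (1 * ((\<phi>1 k z - g1 z) + (g2 z - \<phi>2 k z) + (g3 z - \<phi>3 k z))\<^sup>2) \<partial>?C)"
      proof (rule nn_integral_cong_AE)
        show "AE z in ?C. ennreal ((\<phi>1 k z - \<phi>2 k z - \<phi>3 k z)\<^sup>2) = ennreal (1 * ((\<phi>1 k z - g1 z) + (g2 z - \<phi>2 k z) + (g3 z - \<phi>3 k z))\<^sup>2)"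
          using diff
        proof eventually_elim
          case (elim z)
          then have "g1 z = g2 z + g3 z" unfolding g1_def g2_def g3_def by linarith
          then show ?case by (simp add: algebra_simps)
        qed
      qed
      also have "\<dots> \<le> 3 * (\<integral>\<^sup>+z. ennreal (1 * (\<phi>1 k z - g1 z)\<^sup>2) \<partial>?C) + 3 * (\<integral>\<^sup>+z. ennreal (1 * (g2 z - \<phi>2 k z)\<^sup>2) \<partial>?C)
          + 3 * (\<integral>\<^sup>+z. ennreal (1 * (g3 z - \<phi>3 k z)\<^sup>2) \<partial>?C)"
        by (rule nn_integral_square_sum3) (intro borel_measurable_times borel_measurable_power borel_measurable_diff borel_measurable_const \<phi> g zero_le_one)+
      finally show ?thesis .
    qed
    then show "\<forall>\<^sub>F k in sequentially. (\<integral>\<^sup>+\<omega>. ennreal (1 * (S1 k \<omega> - S2 k \<omega> - S3 k \<omega>)\<^sup>2) \<partial>M)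
        \<le> 3 * (\<integral>\<^sup>+z. ennreal (1 * (\<phi>1 k z - g1 z)\<^sup>2) \<partial>?C) + 3 * (\<integral>\<^sup>+z. ennreal (1 * (g2 z - \<phi>2 k z)\<^sup>2) \<partial>?C)
          + 3 * (\<integral>\<^sup>+z. ennreal (1 * (g3 z - \<phi>3 k z)\<^sup>2) \<partial>?C)" by (intro always_eventually allI)
  qed simp
  \<comment> \<open>The errors of the second and third integrals are grouped, so the three-term
    inequality is applied twice; this is the origin of the nested factor 3.\<close>
  let ?R = "\<lambda>k. 3 * (\<integral>\<^sup>+\<omega>. ennreal (1 * (S1 k \<omega> - S2 k \<omega> - S3 k \<omega>)\<^sup>2) \<partial>M)
     + 3 * (\<integral>\<^sup>+\<omega>. ennreal (1 * (S1 k \<omega> - I1 \<omega>)\<^sup>2) \<partial>M)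
     + 3 * (3 * (\<integral>\<^sup>+\<omega>. ennreal (1 * (S2 k \<omega> - I2 \<omega>)\<^sup>2) \<partial>M) + 3 * (\<integral>\<^sup>+\<omega>. ennreal (1 * (S3 k \<omega> - I3 \<omega>)\<^sup>2) \<partial>M))"
  have R: "?R \<longlonglongrightarrow> 0"
  proof -
    have 23: "(\<lambda>k. 3 * (\<integral>\<^sup>+\<omega>. ennreal (1 * (S2 k \<omega> - I2 \<omega>)\<^sup>2) \<partial>M) + 3 * (\<integral>\<^sup>+\<omega>. ennreal (1 * (S3 k \<omega> - I3 \<omega>)\<^sup>2) \<partial>M)) \<longlonglongrightarrow> 0"
      using tendsto_add[OF ennreal_tendsto_3_mult_0[OF l2] ennreal_tendsto_3_mult_0[OF l3]]
      by (simp add: S2_def S3_def)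
    have 1: "(\<lambda>k. \<integral>\<^sup>+\<omega>. ennreal (1 * (S1 k \<omega> - I1 \<omega>)\<^sup>2) \<partial>M) \<longlonglongrightarrow> 0"
      using l1 by (simp add: S1_def)
    show ?thesis
      using tendsto_add[OF tendsto_add[OF ennreal_tendsto_3_mult_0[OF A] ennreal_tendsto_3_mult_0[OF 1]] ennreal_tendsto_3_mult_0[OF 23]]
      unfolding add_0_right .
  qed
  have le: "(\<integral>\<^sup>+\<omega>. ennreal ((I1 \<omega> - I2 \<omega> - I3 \<omega>)\<^sup>2) \<partial>M) \<le> ?R k" for k
  proof -
    have "(\<integral>\<^sup>+\<omega>. ennreal ((I1 \<omega> - I2 \<omega> - I3 \<omega>)\<^sup>2) \<partial>M)
      = (\<integral>\<^sup>+\<omega>. ennreal (1 * ((S1 k \<omega> - S2 k \<omega> - S3 k \<omega>) + (I1 \<omega> - S1 k \<omega>) + ((S2 k \<omega> - I2 \<omega>) + (S3 k \<omega> - I3 \<omega>) + 0))\<^sup>2) \<partial>M)"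
      by (simp add: algebra_simps)
    also have "\<dots> \<le> 3 * (\<integral>\<^sup>+\<omega>. ennreal (1 * (S1 k \<omega> - S2 k \<omega> - S3 k \<omega>)\<^sup>2) \<partial>M)
       + 3 * (\<integral>\<^sup>+\<omega>. ennreal (1 * (I1 \<omega> - S1 k \<omega>)\<^sup>2) \<partial>M)
       + 3 * (\<integral>\<^sup>+\<omega>. ennreal (1 * ((S2 k \<omega> - I2 \<omega>) + (S3 k \<omega> - I3 \<omega>) + 0)\<^sup>2) \<partial>M)"
      by (rule nn_integral_square_sum3) auto
    also have "\<dots> \<le> 3 * (\<integral>\<^sup>+\<omega>. ennreal (1 * (S1 k \<omega> - S2 k \<omega> - S3 k \<omega>)\<^sup>2) \<partial>M)
       + 3 * (\<integral>\<^sup>+\<omega>. ennreal (1 * (I1 \<omega> - S1 k \<omega>)\<^sup>2) \<partial>M)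
       + 3 * (3 * (\<integral>\<^sup>+\<omega>. ennreal (1 * (S2 k \<omega> - I2 \<omega>)\<^sup>2) \<partial>M) + 3 * (\<integral>\<^sup>+\<omega>. ennreal (1 * (S3 k \<omega> - I3 \<omega>)\<^sup>2) \<partial>M)
         + 3 * (\<integral>\<^sup>+\<omega>. ennreal (1 * 0\<^sup>2) \<partial>M))"
      by (intro add_mono mult_left_mono order_refl nn_integral_square_sum3) auto
    finally show ?thesis by (simp add: power2_commute[of "I1 _"])
  qed
  have "(\<integral>\<^sup>+\<omega>. ennreal ((I1 \<omega> - I2 \<omega> - I3 \<omega>)\<^sup>2) \<partial>M) \<le> 0"
    by (rule LIMSEQ_le_const[OF R]) (use le in blast)
  then have "AE \<omega> in M. ennreal ((I1 \<omega> - I2 \<omega> - I3 \<omega>)\<^sup>2) = 0"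
    by (subst (asm) le_zero_eq, subst (asm) nn_integral_0_iff_AE) auto
  then show ?thesis by eventually_elim (auto simp: ennreal_eq_0_iff)
qed

text \<open>Approximation takes place for the Borel function \<open>h\<close>, while the integral is
  claimed for \<open>f\<close>, which will be the convolution with the original kernel; integrals
  over the completion do not see the difference.\<close>

lemma deterministic_ito_exists:
  assumes h[measurable]: "h \<in> borel_measurable borel" and t: "0 < t" "t \<le> T"
    and V: "(\<integral>\<^sup>+r. ennreal (indicator {0..t} r * (h r)\<^sup>2) \<partial>lborel) \<le> ennreal V" "0 \<le> V"
    and f: "AE r in lborel. r \<in> {0..t} \<longrightarrow> f r = h r"
  obtains J where "has_ito_integral M F W t (\<lambda>r \<omega>. f r) J"
    "\<And>p. 1 \<le> p \<Longrightarrow> (\<integral>\<^sup>+\<omega>. ennreal (\<bar>J \<omega>\<bar> powr p) \<partial>M) \<le> ennreal (moment_const p * (3 * V) powr (p / 2))"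
proof -
  let ?C = "completion (lborel \<Otimes>\<^sub>M M)"
  obtain n \<tau> c J where J: "J \<in> borel_measurable M"
    "\<And>k. simple_process_data M F t (n k) (\<tau> k) (\<lambda>i \<omega>. c k i)"
    "(\<lambda>k. \<integral>\<^sup>+(r, \<omega>). ennreal (indicator {0..t} r * (simple_process (n k) (\<tau> k) (\<lambda>i \<omega>. c k i) r \<omega> - h r)\<^sup>2)
        \<partial>?C) \<longlonglongrightarrow> 0"
    "(\<lambda>k. \<integral>\<^sup>+\<omega>. ennreal ((simple_integral W (n k) (\<tau> k) (\<lambda>i \<omega>. c k i) \<omega> - J \<omega>)\<^sup>2) \<partial>M) \<longlonglongrightarrow> 0"
    "\<And>p. 1 \<le> p \<Longrightarrow> (\<integral>\<^sup>+\<omega>. ennreal (\<bar>J \<omega>\<bar> powr p) \<partial>M) \<le> ennreal (moment_const p * (3 * V) powr (p / 2))"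
    by (rule wiener_integral_exists[OF h t V]) (rule that, assumption+)
  have AE: "AE z in lborel \<Otimes>\<^sub>M M. fst z \<in> {0..t} \<longrightarrow> f (fst z) = h (fst z)"
    by (rule AE_pair_fstI[OF _ f]) unfold_locales
  have meas: "(\<lambda>z. indicator {0..t} (fst z) * f (fst z)) \<in> borel_measurable ?C"
  proof (rule borel_measurable_completion_cong_AE)
    show "(\<lambda>z. indicator {0..t} (fst z) * h (fst z)) \<in> borel_measurable (lborel \<Otimes>\<^sub>M M)" by measurable
    show "AE z in lborel \<Otimes>\<^sub>M M. indicator {0..t} (fst z) * f (fst z) = indicator {0..t} (fst z) * h (fst z)"
      using AE by eventually_elim (auto simp: indicator_def)
  qed
  have eq: "(\<integral>\<^sup>+(r, \<omega>). ennreal (indicator {0..t} r * (simple_process (n k) (\<tau> k) (\<lambda>i \<omega>. c k i) r \<omega> - f r)\<^sup>2) \<partial>?C)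
     = (\<integral>\<^sup>+(r, \<omega>). ennreal (indicator {0..t} r * (simple_process (n k) (\<tau> k) (\<lambda>i \<omega>. c k i) r \<omega> - h r)\<^sup>2) \<partial>?C)" for k
    using AE_completion[OF AE] unfolding split_beta'
    by (intro nn_integral_cong_AE, eventually_elim) (auto simp: indicator_def)
  have "has_ito_integral M F W t (\<lambda>r \<omega>. f r) J"
    unfolding has_ito_integral_def
  proof (intro conjI exI[of _ n] exI[of _ \<tau>] exI[of _ "\<lambda>k i \<omega>. c k i"] allI J(1) J(2) J(4))
    show "(\<lambda>(r, \<omega>). indicator {0..t} r * f r) \<in> borel_measurable ?C"
      using meas by (simp add: split_beta')
  qed (unfold eq, rule J(3))
  then show thesis using J(5) by (rule that)
qed

text \<open>A version \<open>J\<close> of the integral of \<open>h\<close> over all of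
  \<open>[0, T]\<close> is constructed together with its moments, and uniqueness identifies it with
  \<open>I1 - I2\<close>, however these two versions were chosen. The different horizons are
  absorbed by the indicators in \<open>h\<close>.\<close>

lemma ito_diff_moment:
  assumes T: "0 < T"
    and ito1: "has_ito_integral M F W t1 (\<lambda>r \<omega>. f1 r) I1" and t1: "t1 \<le> T"
    and ito2: "has_ito_integral M F W t2 (\<lambda>r \<omega>. f2 r) I2" and t2: "t2 \<le> T"
    and h: "h \<in> borel_measurable borel"
    and diff: "AE r in lborel. r \<in> {0..T} \<longrightarrow> indicator {0..t1} r * f1 r - indicator {0..t2} r * f2 r = h r"
    and V: "(\<integral>\<^sup>+r. ennreal (indicator {0..T} r * (h r)\<^sup>2) \<partial>lborel) \<le> ennreal V" "0 \<le> V"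
    and p: "1 \<le> p"
  shows "(\<integral>\<^sup>+\<omega>. ennreal (\<bar>I1 \<omega> - I2 \<omega>\<bar> powr p) \<partial>M) \<le> ennreal (moment_const p * (3 * V) powr (p / 2))"
proof -
  obtain J where J: "has_ito_integral M F W T (\<lambda>r \<omega>. h r) J"
    "\<And>p. 1 \<le> p \<Longrightarrow> (\<integral>\<^sup>+\<omega>. ennreal (\<bar>J \<omega>\<bar> powr p) \<partial>M) \<le> ennreal (moment_const p * (3 * V) powr (p / 2))"
    by (rule deterministic_ito_exists[OF h T order_refl V, of h]) auto
  have "AE z in lborel \<Otimes>\<^sub>M M. fst z \<in> {0..T} \<longrightarrow>
      indicator {0..t1} (fst z) * f1 (fst z) - indicator {0..t2} (fst z) * f2 (fst z) = h (fst z)"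
    by (rule AE_pair_fstI[OF _ diff]) unfold_locales
  from AE_completion[OF this]
  have "AE z in completion (lborel \<Otimes>\<^sub>M M). indicator {0..t1} (fst z) * f1 (fst z)
       - indicator {0..t2} (fst z) * f2 (fst z) - indicator {0..T} (fst z) * h (fst z) = 0"
    by eventually_elim (use t1 t2 in \<open>auto simp: indicator_def\<close>)
  then have "AE \<omega> in M. I1 \<omega> - I2 \<omega> = J \<omega>"
    by (rule ito_diff_unique[OF ito1 t1 ito2 t2 J(1) order_refl])
  then have "AE \<omega> in M. ennreal (\<bar>I1 \<omega> - I2 \<omega>\<bar> powr p) = ennreal (\<bar>J \<omega>\<bar> powr p)"
    by eventually_elim simp
  then have "(\<integral>\<^sup>+\<omega>. ennreal (\<bar>I1 \<omega> - I2 \<omega>\<bar> powr p) \<partial>M) = (\<integral>\<^sup>+\<omega>. ennreal (\<bar>J \<omega>\<bar> powr p) \<partial>M)"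
    by (rule nn_integral_cong_AE)
  with J(2)[OF p] show ?thesis by simp
qed

text \<open>Serves as the subtrahend when moments of a single variable are obtained from the bound
  on differences.\<close>

lemma has_ito_integral_zero: "has_ito_integral M F W 0 (\<lambda>r \<omega>. 0) (\<lambda>\<omega>. 0)"
  unfolding has_ito_integral_def
  by (auto simp: split_beta' simple_process_data_def simple_process_def simple_integral_def
    intro!: exI[of _ "\<lambda>k. 0"] exI[of _ "\<lambda>k i. 0"])

end


section \<open>The deterministic convolution\<close>

lemma ennreal_square_add_le: "(a + b)\<^sup>2 \<le> 2 * a\<^sup>2 + 2 * (b::ennreal)\<^sup>2"
proof (cases "a = top \<or> b = top")
  case True
  then show ?thesis by (auto simp: power2_eq_square ennreal_mult_top)
next
  case False
  then obtain x y where xy: "a = ennreal x" "0 \<le> x" "b = ennreal y" "0 \<le> y"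
    by (metis ennreal_cases)
  have "(x + y)\<^sup>2 \<le> 2 * x\<^sup>2 + 2 * y\<^sup>2"
    using zero_le_power2[of "x - y"] by (simp add: power2_eq_square algebra_simps)
  then have "ennreal ((x + y)\<^sup>2) \<le> ennreal (2 * x\<^sup>2 + 2 * y\<^sup>2)" by (rule ennreal_leI)
  also have "ennreal (2 * x\<^sup>2 + 2 * y\<^sup>2) = 2 * ennreal x ^ 2 + 2 * ennreal y ^ 2"
    using xy ennreal_mult[of 2 "x\<^sup>2"] ennreal_mult[of 2 "y\<^sup>2"] by (simp add: ennreal_plus ennreal_power)
  also have "ennreal ((x + y)\<^sup>2) = (ennreal x + ennreal y)\<^sup>2"
    using xy by (simp add: ennreal_power flip: ennreal_plus)
  finally show ?thesis by (simp add: xy)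
qed

text \<open>True without integrability because the Bochner integral then has the default value
  0.\<close>

lemma ennreal_abs_integral_le: "ennreal \<bar>\<integral>y. f y \<partial>N\<bar> \<le> (\<integral>\<^sup>+y. ennreal \<bar>f y\<bar> \<partial>N)"
  for f :: "'b \<Rightarrow> real"
proof (cases "integrable N f")
  case True
  then show ?thesis using integral_norm_bound_ennreal[OF True] by simp
qed (simp add: not_integrable_integral_eq)

lemma powr_norm_diff_le:
  fixes x z :: "'b::real_normed_vector"
  assumes "0 < \<beta>" "\<beta> < 1"
  shows "norm (x - z) powr \<beta> \<le> 2 * (norm x powr \<beta> + norm z powr \<beta>)"
proof -
  define m where "m = max (norm x) (norm z)"
  have "norm (x - z) \<le> 2 * m"
    using norm_triangle_ineq4[of x z] by (simp add: m_def)
  then have "norm (x - z) powr \<beta> \<le> (2 * m) powr \<beta>" using assms by (intro powr_mono2) auto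
  also have "\<dots> = 2 powr \<beta> * m powr \<beta>" by (rule powr_mult)
  also have "\<dots> \<le> 2 * (norm x powr \<beta> + norm z powr \<beta>)"
  proof (rule mult_mono)
    show "2 powr \<beta> \<le> (2::real)" using assms powr_mono[of \<beta> 1 2] by simp
    show "m powr \<beta> \<le> norm x powr \<beta> + norm z powr \<beta>" by (simp add: m_def max_def)
  qed auto
  finally show ?thesis .
qed

text \<open>\<open>K\<close> and \<open>g\<close> are Borel here, so that the inner integral is a
  measurable function of time. The bounds include \<open>s = t\<close>, so purely spatial increments
  need no separate treatment. \<open>K_total\<close> stops short of \<open>T\<close> because the
  bound of the theorem at time \<open>s\<close> presupposes a later time up to
  \<open>T\<close>.\<close>

locale holder_kernel =
  fixes K g :: "real \<times> (real ^ 'd) \<Rightarrow> real" and T \<beta> C \<gamma>\<^sub>1 \<gamma>\<^sub>2 N\<^sub>0 N\<^sub>1 :: real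
  assumes K[measurable]: "K \<in> borel_measurable (borel \<Otimes>\<^sub>M borel)"
    and g[measurable]: "g \<in> borel_measurable (borel \<Otimes>\<^sub>M borel)"
    and \<beta>: "0 < \<beta>" "\<beta> < 1" and T: "0 < T" and C: "0 \<le> C" and N: "0 \<le> N\<^sub>0" "0 \<le> N\<^sub>1"
    and holder: "\<And>r x y. 0 \<le> r \<Longrightarrow> \<bar>g (r, x) - g (r, y)\<bar> \<le> C * norm (x - y) powr \<beta>"
    and growth: "\<And>r x. 0 \<le> r \<Longrightarrow> \<bar>g (r, x)\<bar> \<le> C * (norm x powr \<beta> + sqrt r powr \<beta>)"
    and K_diff: "\<And>s t. 0 \<le> s \<Longrightarrow> s \<le> t \<Longrightarrow> t \<le> T \<Longrightarrow>
      (\<integral>\<^sup>+ r\<in>{0..s}. (\<integral>\<^sup>+ z. ennreal (\<bar>K (t - r, z) - K (s - r, z)\<bar> * (1 + norm z powr \<beta>)) \<partial>lborel)\<^sup>2 \<partial>lborel)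
        \<le> ennreal (N\<^sub>1 * (t - s) powr \<gamma>\<^sub>1)"
    and K_total: "\<And>s. 0 \<le> s \<Longrightarrow> s < T \<Longrightarrow>
      (\<integral>\<^sup>+ r\<in>{0..s}. (\<integral>\<^sup>+ z. ennreal \<bar>K (s - r, z)\<bar> \<partial>lborel)\<^sup>2 \<partial>lborel) \<le> ennreal N\<^sub>0"
    and K_recent: "\<And>s t. 0 \<le> s \<Longrightarrow> s \<le> t \<Longrightarrow> t \<le> T \<Longrightarrow>
      (\<integral>\<^sup>+ r\<in>{s..t}. (\<integral>\<^sup>+ z. ennreal (\<bar>K (t - r, z)\<bar> * (1 + norm z powr \<beta>)) \<partial>lborel)\<^sup>2 \<partial>lborel)
        \<le> ennreal (N\<^sub>1 * (t - s) powr \<gamma>\<^sub>2)"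
begin

definition convolve :: "real \<times> (real ^ 'd) \<Rightarrow> real \<Rightarrow> real" where
  "convolve X r = (\<integral>y. K (fst X - r, y) * g (r, snd X - y) \<partial>lborel)"

lemma convolve_measurable[measurable]: "convolve X \<in> borel_measurable borel"
  unfolding convolve_def by measurable

text \<open>Collects the terms of \<open>2 * (R powr \<beta> + norm z powr \<beta>) + sqrt T powr
  \<beta>\<close> in front of the common weight \<open>1 + norm z powr \<beta>\<close>.\<close>

definition growth_const :: "real \<Rightarrow> real" where
  "growth_const R = C * (2 * R powr \<beta> + 2 + sqrt T powr \<beta>)"

lemma growth_const_nonneg: "0 \<le> growth_const R"
  using C by (simp add: growth_const_def)

lemma g_shift_le:
  assumes "0 \<le> r" "r \<le> T" "norm x \<le> R"
  shows "\<bar>g (r, x - z)\<bar> \<le> growth_const R * (1 + norm z powr \<beta>)"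
proof -
  have "norm (x - z) powr \<beta> + sqrt r powr \<beta> \<le> 2 * (R powr \<beta> + norm z powr \<beta>) + sqrt T powr \<beta>"
  proof (rule add_mono)
    have "norm x powr \<beta> \<le> R powr \<beta>" using assms \<beta> by (intro powr_mono2) auto
    then have "2 * (norm x powr \<beta> + norm z powr \<beta>) \<le> 2 * (R powr \<beta> + norm z powr \<beta>)" by simp
    then show "norm (x - z) powr \<beta> \<le> 2 * (R powr \<beta> + norm z powr \<beta>)"
      by (rule order_trans[OF powr_norm_diff_le[OF \<beta>]])
    show "sqrt r powr \<beta> \<le> sqrt T powr \<beta>" using assms \<beta> by (intro powr_mono2) auto
  qed
  also have "\<dots> \<le> (2 * R powr \<beta> + 2 + sqrt T powr \<beta>) * (1 + norm z powr \<beta>)"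
    by (simp add: algebra_simps)
  finally have "C * (norm (x - z) powr \<beta> + sqrt r powr \<beta>) \<le> C * ((2 * R powr \<beta> + 2 + sqrt T powr \<beta>) * (1 + norm z powr \<beta>))"
    using C by (rule mult_left_mono)
  with growth[OF assms(1), of "x - z"] show ?thesis by (simp add: growth_const_def mult_ac)
qed

abbreviation weight :: "real \<Rightarrow> ennreal" where
  "weight u \<equiv> (\<integral>\<^sup>+z. ennreal (\<bar>K (u, z)\<bar> * (1 + norm z powr \<beta>)) \<partial>lborel)"

abbreviation weight_diff :: "real \<Rightarrow> real \<Rightarrow> ennreal" where
  "weight_diff u v \<equiv> (\<integral>\<^sup>+z. ennreal (\<bar>K (u, z) - K (v, z)\<bar> * (1 + norm z powr \<beta>)) \<partial>lborel)"

abbreviation mass :: "real \<Rightarrow> ennreal" where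
  "mass u \<equiv> (\<integral>\<^sup>+z. ennreal \<bar>K (u, z)\<bar> \<partial>lborel)"

lemma integrand_le:
  assumes "0 \<le> r" "r \<le> T" "norm x \<le> R"
  shows "(\<integral>\<^sup>+z. ennreal \<bar>K (u, z) * g (r, x - z)\<bar> \<partial>lborel) \<le> ennreal (growth_const R) * weight u"
proof -
  have "(\<integral>\<^sup>+z. ennreal \<bar>K (u, z) * g (r, x - z)\<bar> \<partial>lborel)
      \<le> (\<integral>\<^sup>+z. ennreal (growth_const R) * ennreal (\<bar>K (u, z)\<bar> * (1 + norm z powr \<beta>)) \<partial>lborel)"
  proof (rule nn_integral_mono)
    fix z
    have "\<bar>K (u, z) * g (r, x - z)\<bar> \<le> \<bar>K (u, z)\<bar> * (growth_const R * (1 + norm z powr \<beta>))"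
      unfolding abs_mult by (intro mult_left_mono g_shift_le assms) auto
    then show "ennreal \<bar>K (u, z) * g (r, x - z)\<bar> \<le> ennreal (growth_const R) * ennreal (\<bar>K (u, z)\<bar> * (1 + norm z powr \<beta>))"
      using growth_const_nonneg[of R] by (subst ennreal_mult[symmetric]) (auto intro!: ennreal_leI simp: mult_ac)
  qed
  also have "\<dots> = ennreal (growth_const R) * weight u"
    by (intro nn_integral_cmult) measurable
  finally show ?thesis .
qed

lemma convolve_le:
  assumes "0 \<le> r" "r \<le> T" "norm (snd X) \<le> R"
  shows "ennreal \<bar>convolve X r\<bar> \<le> ennreal (growth_const R) * weight (fst X - r)"
  unfolding convolve_def by (rule order_trans[OF ennreal_abs_integral_le integrand_le[OF assms]])

lemma integrable_integrand:
  assumes "0 \<le> r" "r \<le> T" "weight u < \<infinity>"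
  shows "integrable lborel (\<lambda>z. K (u, z) * g (r, x - z))"
proof (rule integrableI_bounded)
  have "(\<integral>\<^sup>+z. ennreal (norm (K (u, z) * g (r, x - z))) \<partial>lborel) \<le> ennreal (growth_const (norm x)) * weight u"
    using integrand_le[OF assms(1,2) order_refl, where x = x and u = u] by simp
  also have "\<dots> < \<infinity>" using assms(3) by (simp add: ennreal_mult_less_top)
  finally show "(\<integral>\<^sup>+z. ennreal (norm (K (u, z) * g (r, x - z))) \<partial>lborel) < \<infinity>" .
qed measurable

text \<open>The growth weight falls only on the difference of kernels; the Hoelder bound on
  \<open>g\<close> is uniform in \<open>z\<close>, so the unweighted mass of the kernel suffices in
  the second term. Finiteness of both weights justifies merging two Bochner integrals into
  one.\<close>

lemma convolve_diff_le:
  assumes r: "0 \<le> r" "r \<le> T" and R: "norm (snd X) \<le> R"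
    and fin: "weight (fst X - r) < \<infinity>" "weight (fst Y - r) < \<infinity>"
  shows "ennreal \<bar>convolve X r - convolve Y r\<bar> \<le> ennreal (growth_const R) * weight_diff (fst X - r) (fst Y - r)
     + ennreal (C * norm (snd X - snd Y) powr \<beta>) * mass (fst Y - r)"
proof -
  let ?u = "fst X - r" and ?v = "fst Y - r" and ?x = "snd X" and ?y = "snd Y"
  have "convolve X r - convolve Y r = (\<integral>z. K (?u, z) * g (r, ?x - z) - K (?v, z) * g (r, ?y - z) \<partial>lborel)"
    unfolding convolve_def by (intro Bochner_Integration.integral_diff[symmetric] integrable_integrand r fin)
  then have "ennreal \<bar>convolve X r - convolve Y r\<bar> \<le> (\<integral>\<^sup>+z. ennreal \<bar>K (?u, z) * g (r, ?x - z) - K (?v, z) * g (r, ?y - z)\<bar> \<partial>lborel)"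
    by (simp only: ennreal_abs_integral_le)
  also have "\<dots> \<le> (\<integral>\<^sup>+z. ennreal (growth_const R) * ennreal (\<bar>K (?u, z) - K (?v, z)\<bar> * (1 + norm z powr \<beta>))
       + ennreal (C * norm (?x - ?y) powr \<beta>) * ennreal \<bar>K (?v, z)\<bar> \<partial>lborel)"
  proof (rule nn_integral_mono)
    fix z
    have "K (?u, z) * g (r, ?x - z) - K (?v, z) * g (r, ?y - z)
        = (K (?u, z) - K (?v, z)) * g (r, ?x - z) + K (?v, z) * (g (r, ?x - z) - g (r, ?y - z))"
      by (simp add: algebra_simps)
    also have "\<bar>\<dots>\<bar> \<le> \<bar>K (?u, z) - K (?v, z)\<bar> * \<bar>g (r, ?x - z)\<bar> + \<bar>K (?v, z)\<bar> * \<bar>g (r, ?x - z) - g (r, ?y - z)\<bar>"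
      by (intro order_trans[OF abs_triangle_ineq]) (simp add: abs_mult)
    also have "\<dots> \<le> \<bar>K (?u, z) - K (?v, z)\<bar> * (growth_const R * (1 + norm z powr \<beta>)) + \<bar>K (?v, z)\<bar> * (C * norm (?x - ?y) powr \<beta>)"
      using holder[OF r(1), of "?x - z" "?y - z"] by (intro add_mono mult_left_mono g_shift_le r R) auto
    also have "\<dots> = growth_const R * (\<bar>K (?u, z) - K (?v, z)\<bar> * (1 + norm z powr \<beta>)) + (C * norm (?x - ?y) powr \<beta>) * \<bar>K (?v, z)\<bar>"
      by (simp add: mult_ac)
    finally have "ennreal \<bar>K (?u, z) * g (r, ?x - z) - K (?v, z) * g (r, ?y - z)\<bar>
      \<le> ennreal (growth_const R * (\<bar>K (?u, z) - K (?v, z)\<bar> * (1 + norm z powr \<beta>)) + (C * norm (?x - ?y) powr \<beta>) * \<bar>K (?v, z)\<bar>)"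
      by (rule ennreal_leI)
    also have "\<dots> = ennreal (growth_const R) * ennreal (\<bar>K (?u, z) - K (?v, z)\<bar> * (1 + norm z powr \<beta>))
       + ennreal (C * norm (?x - ?y) powr \<beta>) * ennreal \<bar>K (?v, z)\<bar>"
    proof -
      have nn: "0 \<le> \<bar>K (?u, z) - K (?v, z)\<bar> * (1 + norm z powr \<beta>)" "0 \<le> C * norm (?x - ?y) powr \<beta>" "0 \<le> \<bar>K (?v, z)\<bar>"
        using C by auto
      show ?thesis
        unfolding ennreal_plus[OF mult_nonneg_nonneg[OF growth_const_nonneg nn(1)] mult_nonneg_nonneg[OF nn(2,3)]]
          ennreal_mult[OF growth_const_nonneg nn(1)] ennreal_mult[OF nn(2,3)] ..
    qed
    finally show "ennreal \<bar>K (?u, z) * g (r, ?x - z) - K (?v, z) * g (r, ?y - z)\<bar>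
       \<le> ennreal (growth_const R) * ennreal (\<bar>K (?u, z) - K (?v, z)\<bar> * (1 + norm z powr \<beta>))
       + ennreal (C * norm (?x - ?y) powr \<beta>) * ennreal \<bar>K (?v, z)\<bar>" .
  qed
  also have "\<dots> = ennreal (growth_const R) * weight_diff ?u ?v + ennreal (C * norm (?x - ?y) powr \<beta>) * mass ?v"
    by (simp add: nn_integral_add nn_integral_cmult)
  finally show ?thesis .
qed

text \<open>The bound \<open>K_recent\<close> with lower limit 0 makes the weight square integrable
  on \<open>[0, t]\<close>, hence finite almost everywhere.\<close>

lemma weight_finite_AE:
  assumes "0 \<le> t" "t \<le> T"
  shows "AE r in lborel. r \<in> {0..t} \<longrightarrow> weight (t - r) < \<infinity>"
proof -
  have "(\<integral>\<^sup>+ r\<in>{0..t}. (weight (t - r))\<^sup>2 \<partial>lborel) < \<infinity>"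
    using K_recent[of 0 t] assms by (auto intro: le_less_trans)
  then have "AE r in lborel. (weight (t - r))\<^sup>2 * indicator {0..t} r \<noteq> \<infinity>"
    by (intro nn_integral_PInf_AE) auto
  then show ?thesis
    by eventually_elim (auto simp: indicator_def less_top power2_eq_square ennreal_mult_eq_top_iff split: if_splits)
qed

lemma convolve_L2:
  assumes "0 \<le> fst X" "fst X \<le> T" "norm (snd X) \<le> R"
  shows "(\<integral>\<^sup>+r. ennreal (indicator {0..fst X} r * (convolve X r)\<^sup>2) \<partial>lborel)
     \<le> ennreal ((growth_const R)\<^sup>2 * (N\<^sub>1 * fst X powr \<gamma>\<^sub>2))"
proof -
  have "(\<integral>\<^sup>+r. ennreal (indicator {0..fst X} r * (convolve X r)\<^sup>2) \<partial>lborel)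
     \<le> (\<integral>\<^sup>+r. ennreal ((growth_const R)\<^sup>2) * ((weight (fst X - r))\<^sup>2 * indicator {0..fst X} r) \<partial>lborel)"
  proof (rule nn_integral_mono)
    fix r
    show "ennreal (indicator {0..fst X} r * (convolve X r)\<^sup>2) \<le> ennreal ((growth_const R)\<^sup>2) * ((weight (fst X - r))\<^sup>2 * indicator {0..fst X} r)"
    proof (cases "r \<in> {0..fst X}")
      case True
      have "ennreal ((convolve X r)\<^sup>2) = (ennreal \<bar>convolve X r\<bar>)\<^sup>2" by (simp add: ennreal_power)
      also have "\<dots> \<le> (ennreal (growth_const R) * weight (fst X - r))\<^sup>2"
        using True assms by (intro power_mono convolve_le) auto
      also have "\<dots> = ennreal ((growth_const R)\<^sup>2) * (weight (fst X - r))\<^sup>2"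
        by (simp add: power_mult_distrib ennreal_power growth_const_nonneg)
      finally show ?thesis using True by simp
    qed simp
  qed
  also have "\<dots> = ennreal ((growth_const R)\<^sup>2) * (\<integral>\<^sup>+ r\<in>{0..fst X}. (weight (fst X - r))\<^sup>2 \<partial>lborel)"
    by (intro nn_integral_cmult) measurable
  also have "\<dots> \<le> ennreal ((growth_const R)\<^sup>2) * ennreal (N\<^sub>1 * fst X powr \<gamma>\<^sub>2)"
    using K_recent[of 0 "fst X"] assms by (intro mult_left_mono) auto
  also have "\<dots> = ennreal ((growth_const R)\<^sup>2 * (N\<^sub>1 * fst X powr \<gamma>\<^sub>2))"
    using N by (simp add: ennreal_mult)
  finally show ?thesis .
qed

lemma convolve_diff_L2:
  assumes Y: "0 \<le> fst Y" and YX: "fst Y \<le> fst X" and X: "fst X < T" and R: "norm (snd X) \<le> R"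
  shows "(\<integral>\<^sup>+r. ennreal (indicator {0..T} r * (indicator {0..fst X} r * convolve X r - indicator {0..fst Y} r * convolve Y r)\<^sup>2) \<partial>lborel)
     \<le> ennreal (2 * (growth_const R)\<^sup>2 * (N\<^sub>1 * (fst X - fst Y) powr \<gamma>\<^sub>1)
        + 2 * (C * norm (snd X - snd Y) powr \<beta>)\<^sup>2 * N\<^sub>0
        + (growth_const R)\<^sup>2 * (N\<^sub>1 * (fst X - fst Y) powr \<gamma>\<^sub>2))"
proof -
  let ?t = "fst X" and ?s = "fst Y"
  \<comment> \<open>Squaring a sum of two terms on \<open>[0, s]\<close> produces the factor 2 in
    \<open>?c\<close> and \<open>?d\<close>; on \<open>(s, t]\<close> there is a single term, so
    \<open>?e\<close> has none.\<close>
  let ?c = "2 * (growth_const R)\<^sup>2" and ?d = "2 * (C * norm (snd X - snd Y) powr \<beta>)\<^sup>2" and ?e = "(growth_const R)\<^sup>2"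
  let ?h = "\<lambda>r. indicator {0..?t} r * convolve X r - indicator {0..?s} r * convolve Y r"
  have sq: "2 * (ennreal a * b)\<^sup>2 = ennreal (2 * a\<^sup>2) * b\<^sup>2" if "0 \<le> a" for a b
    using that by (simp add: power_mult_distrib ennreal_power ennreal_mult mult.assoc)
  have "(\<integral>\<^sup>+r. ennreal (indicator {0..T} r * (?h r)\<^sup>2) \<partial>lborel)
     \<le> (\<integral>\<^sup>+r. ennreal ?c * ((weight_diff (?t - r) (?s - r))\<^sup>2 * indicator {0..?s} r)
        + ennreal ?d * ((mass (?s - r))\<^sup>2 * indicator {0..?s} r)
        + ennreal ?e * ((weight (?t - r))\<^sup>2 * indicator {?s..?t} r) \<partial>lborel)"
  proof (rule nn_integral_mono_AE)
    have "AE r in lborel. r \<in> {0..?t} \<longrightarrow> weight (?t - r) < \<infinity>" "AE r in lborel. r \<in> {0..?s} \<longrightarrow> weight (?s - r) < \<infinity>"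
      by (rule weight_finite_AE; use Y YX X in linarith)+
    then show "AE r in lborel. ennreal (indicator {0..T} r * (?h r)\<^sup>2)
       \<le> ennreal ?c * ((weight_diff (?t - r) (?s - r))\<^sup>2 * indicator {0..?s} r)
        + ennreal ?d * ((mass (?s - r))\<^sup>2 * indicator {0..?s} r)
        + ennreal ?e * ((weight (?t - r))\<^sup>2 * indicator {?s..?t} r)"
    proof eventually_elim
      case (elim r)
      consider "r \<in> {0..?s}" | "r \<in> {?s<..?t}" | "r \<notin> {0..?t}" using YX by force
      then show ?case
      proof cases
        case 1
        have fin: "weight (?t - r) < \<infinity>" "weight (?s - r) < \<infinity>" using elim 1 YX by auto
        have "ennreal (indicator {0..T} r * (?h r)\<^sup>2) = (ennreal \<bar>convolve X r - convolve Y r\<bar>)\<^sup>2"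
          using 1 YX X by (simp add: ennreal_power)
        also have "\<dots> \<le> (ennreal (growth_const R) * weight_diff (?t - r) (?s - r)
           + ennreal (C * norm (snd X - snd Y) powr \<beta>) * mass (?s - r))\<^sup>2"
          using 1 YX X by (intro power_mono convolve_diff_le R fin) auto
        also have "\<dots> \<le> 2 * (ennreal (growth_const R) * weight_diff (?t - r) (?s - r))\<^sup>2
           + 2 * (ennreal (C * norm (snd X - snd Y) powr \<beta>) * mass (?s - r))\<^sup>2"
          by (rule ennreal_square_add_le)
        also have "\<dots> = ennreal ?c * (weight_diff (?t - r) (?s - r))\<^sup>2 + ennreal ?d * (mass (?s - r))\<^sup>2"
          using C by (subst sq sq, simp add: growth_const_nonneg, subst sq, simp_all)
        also have "\<dots> \<le> ennreal ?c * ((weight_diff (?t - r) (?s - r))\<^sup>2 * indicator {0..?s} r)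
            + ennreal ?d * ((mass (?s - r))\<^sup>2 * indicator {0..?s} r)
            + ennreal ?e * ((weight (?t - r))\<^sup>2 * indicator {?s..?t} r)"
          using 1 by (simp add: add_increasing2)
        finally show ?thesis .
      next
        case 2
        then have "ennreal (indicator {0..T} r * (?h r)\<^sup>2) = (ennreal \<bar>convolve X r\<bar>)\<^sup>2"
          using X Y by (simp add: ennreal_power)
        also have "\<dots> \<le> (ennreal (growth_const R) * weight (?t - r))\<^sup>2"
          using 2 X Y R by (intro power_mono convolve_le) auto
        also have "\<dots> = ennreal ?e * (weight (?t - r))\<^sup>2"
          by (simp add: power_mult_distrib ennreal_power growth_const_nonneg)
        finally show ?thesis using 2 by simp
      next
        case 3
        then have "?h r = 0" using YX by (auto simp: indicator_def)
        then show ?thesis by simp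
      qed
    qed
  qed
  also have "\<dots> = ennreal ?c * (\<integral>\<^sup>+r\<in>{0..?s}. (weight_diff (?t - r) (?s - r))\<^sup>2 \<partial>lborel)
      + ennreal ?d * (\<integral>\<^sup>+r\<in>{0..?s}. (mass (?s - r))\<^sup>2 \<partial>lborel)
      + ennreal ?e * (\<integral>\<^sup>+r\<in>{?s..?t}. (weight (?t - r))\<^sup>2 \<partial>lborel)"
    by (simp add: nn_integral_add nn_integral_cmult)
  also have "\<dots> \<le> ennreal ?c * ennreal (N\<^sub>1 * (?t - ?s) powr \<gamma>\<^sub>1) + ennreal ?d * ennreal N\<^sub>0
      + ennreal ?e * ennreal (N\<^sub>1 * (?t - ?s) powr \<gamma>\<^sub>2)"
    using Y YX X by (intro add_mono mult_left_mono K_diff K_total K_recent) auto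
  also have "\<dots> = ennreal (?c * (N\<^sub>1 * (?t - ?s) powr \<gamma>\<^sub>1) + ?d * N\<^sub>0 + ?e * (N\<^sub>1 * (?t - ?s) powr \<gamma>\<^sub>2))"
  proof -
    have nn: "0 \<le> ?c" "0 \<le> ?d" "0 \<le> ?e" "0 \<le> N\<^sub>1 * (?t - ?s) powr \<gamma>\<^sub>1" "0 \<le> N\<^sub>1 * (?t - ?s) powr \<gamma>\<^sub>2"
      using N by auto
    show ?thesis
      unfolding ennreal_mult[OF nn(1,4), symmetric] ennreal_mult[OF nn(2) N(1), symmetric] ennreal_mult[OF nn(3,5), symmetric]
      using nn N by (subst ennreal_plus[symmetric], simp, simp, subst ennreal_plus[symmetric]) auto
  qed
  finally show ?thesis .
qed

end


section \<open>The random field\<close>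

text \<open>\<open>AE_borel_affine\<close> wants a measurable predicate and \<open>P\<close> is
  arbitrary, so a measurable null set containing the exceptions is transformed instead.\<close>

lemma AE_lborel_affine:
  fixes P :: "real \<Rightarrow> bool"
  assumes "c \<noteq> 0" "AE x in lborel. P x"
  shows "AE x in lborel. P (t + c * x)"
proof -
  obtain A where A: "A \<in> null_sets lborel" "{x \<in> space lborel. \<not> P x} \<subseteq> A"
    using assms(2) by (auto simp: eventually_ae_filter)
  have "AE x in lborel. x \<notin> A" by (rule AE_not_in[OF A(1)])
  moreover have "Measurable.pred borel (\<lambda>x. x \<notin> A)"
    using null_setsD2[OF A(1)] by measurable
  ultimately have "AE x in lborel. t + c * x \<notin> A"
    using AE_borel_affine[OF assms(1), of "\<lambda>x. x \<notin> A" t] by blast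
  then show ?thesis by eventually_elim (use A(2) in auto)
qed

lemma Lp_norm_le:
  assumes f: "f \<in> borel_measurable M" and B: "(\<integral>\<^sup>+\<omega>. ennreal (\<bar>f \<omega>\<bar> powr p) \<partial>M) \<le> ennreal B" "0 \<le> B"
    and p: "1 \<le> p"
  shows "in_Lp M p f" and "Lp_norm M p f \<le> B powr (1 / p)"
proof -
  have int: "integrable M (\<lambda>\<omega>. \<bar>f \<omega>\<bar> powr p)"
    using f B(1) by (intro integrableI_bounded) (auto intro: le_less_trans)
  then show "in_Lp M p f" using f by (simp add: in_Lp_def)
  have "ennreal (\<integral>\<omega>. \<bar>f \<omega>\<bar> powr p \<partial>M) \<le> ennreal B"
    using B(1) nn_integral_eq_integral[OF int] by simp
  then have "(\<integral>\<omega>. \<bar>f \<omega>\<bar> powr p \<partial>M) \<le> B" using B(2) by (simp add: ennreal_le_iff)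
  then show "Lp_norm M p f \<le> B powr (1 / p)"
    unfolding Lp_norm_def using p by (intro powr_mono2) auto
qed

text \<open>The surplus exponent \<open>\<alpha> - \<gamma>\<close> falls on a bounded quantity and
  becomes a constant, which \<open>1 \<le> \<Delta>\<close> simplifies to
  \<open>\<Delta> powr \<alpha>\<close>. Powers with different exponents are thus reduced to a
  common one.\<close>

lemma powr_le_rescaled:
  fixes a \<delta> \<Delta> \<gamma> \<alpha> :: real
  assumes "0 \<le> a" "a \<le> \<delta>" "\<delta> \<le> \<Delta>" "1 \<le> \<Delta>" "0 < \<gamma>" "\<gamma> \<le> \<alpha>"
  shows "a powr \<alpha> \<le> \<Delta> powr \<alpha> * \<delta> powr \<gamma>"
proof -
  have "a powr \<alpha> \<le> \<delta> powr \<alpha>" using assms by (intro powr_mono2) auto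
  also have "\<dots> = \<delta> powr (\<alpha> - \<gamma>) * \<delta> powr \<gamma>" by (simp flip: powr_add)
  also have "\<dots> \<le> \<Delta> powr \<alpha> * \<delta> powr \<gamma>"
  proof (rule mult_right_mono)
    have "\<delta> powr (\<alpha> - \<gamma>) \<le> \<Delta> powr (\<alpha> - \<gamma>)" using assms by (intro powr_mono2) auto
    also have "\<dots> \<le> \<Delta> powr \<alpha>" using assms by (intro powr_mono) auto
    finally show "\<delta> powr (\<alpha> - \<gamma>) \<le> \<Delta> powr \<alpha>" .
  qed simp
  finally show ?thesis .
qed

lemma pdist_commute: "pdist X Y = pdist Y X"
  by (simp add: pdist_def norm_minus_commute abs_minus_commute)

text \<open>The parabolic distance tends to 0 under Euclidean convergence, and so does its power
  since \<open>\<beta>\<close> is positive. The Borel measurability of \<open>g\<close> rests on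
  this.\<close>

lemma pholder_on_continuous:
  fixes g :: "real \<times> (real ^ 'd) \<Rightarrow> real"
  assumes "pholder_on S \<beta> g" "0 < \<beta>"
  shows "continuous_on S g"
  unfolding continuous_on_def
proof
  fix X assume X: "X \<in> S"
  obtain C where C: "\<And>X Y. X \<in> S \<Longrightarrow> Y \<in> S \<Longrightarrow> \<bar>g X - g Y\<bar> \<le> C * pdist X Y powr \<beta>"
    using assms by (auto simp: pholder_on_def)
  have "((\<lambda>Y. C * (max (norm (snd Y - snd X)) (sqrt \<bar>fst Y - fst X\<bar>)) powr \<beta>)
      \<longlongrightarrow> C * (max (norm (snd X - snd X)) (sqrt \<bar>fst X - fst X\<bar>)) powr \<beta>) (at X within S)"
    using assms(2) by (intro tendsto_mult tendsto_const tendsto_powr' tendsto_max tendsto_norm tendsto_diff tendsto_snd tendsto_fst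
        tendsto_ident_at tendsto_real_sqrt tendsto_rabs) (auto simp: le_max_iff_disj)
  then have "((\<lambda>Y. C * pdist Y X powr \<beta>) \<longlongrightarrow> 0) (at X within S)" by (simp add: pdist_def)
  then have "((\<lambda>Y. g Y - g X) \<longlongrightarrow> 0) (at X within S)"
    by (rule Lim_null_comparison[rotated]) (use C X in \<open>auto simp: eventually_at_topological\<close>)
  then show "(g \<longlongrightarrow> g X) (at X within S)" by (rule LIM_zero_cancel)
qed

section \<open>The Hoelder estimate for the field\<close>

context wiener_setting
begin

text \<open>The pair \<open>K\<close>, \<open>g\<close> enters only through the inner integral, and
  that only up to a null set of times, so the estimates are those of the Borel pair
  \<open>K'\<close>, \<open>g'\<close>. Positive times admit the construction of the Wiener
  integral; times below \<open>T\<close> are the ones \<open>K_total\<close> covers.\<close>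

lemma holder_kernel_field:
  fixes K g K' g' :: "real \<times> (real ^ 'd) \<Rightarrow> real"
  assumes kernel: "holder_kernel K' g' T \<beta> C \<gamma>\<^sub>1 \<gamma>\<^sub>2 N\<^sub>0 N\<^sub>1"
    and conv: "\<And>X. AE r in lborel. 0 \<le> r \<longrightarrow>
       (\<integral>y. K (fst X - r, y) * g (r, snd X - y) \<partial>lebesgue) = holder_kernel.convolve K' g' X r"
    and S: "\<And>X. X \<in> S \<Longrightarrow> 0 < fst X \<and> fst X < T" "bounded S"
    and \<gamma>: "0 < \<gamma>" "\<gamma> \<le> \<gamma>\<^sub>1" "\<gamma> \<le> \<gamma>\<^sub>2" "\<gamma> \<le> \<beta>" and p: "1 \<le> p"
  shows "pholder_Lp M p \<gamma> S (stochastic_convolution M F W K g)"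
proof -
  interpret holder_kernel K' g' T \<beta> C \<gamma>\<^sub>1 \<gamma>\<^sub>2 N\<^sub>0 N\<^sub>1 by fact
  obtain R where R: "\<And>X. X \<in> S \<Longrightarrow> norm X \<le> R" and R0: "0 < R"
    using S(2) by (auto simp: bounded_pos)
  have R': "norm (snd X) \<le> R" if "X \<in> S" for X
    using R[OF that] norm_snd_le[of "snd X" "fst X"] by simp
  define u where "u = stochastic_convolution M F W K g"
  define f where "f X r = (\<integral>y. K (fst X - r, y) * g (r, snd X - y) \<partial>lebesgue)" for X r
  have V0: "(growth_const R)\<^sup>2 * (N\<^sub>1 * fst X powr \<gamma>\<^sub>2) \<le> (growth_const R)\<^sup>2 * (N\<^sub>1 * T powr \<gamma>\<^sub>2)" if "X \<in> S" for X
    using S(1)[OF that] N \<gamma> by (intro mult_left_mono powr_mono2) auto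
  define V where "V = (growth_const R)\<^sup>2 * (N\<^sub>1 * T powr \<gamma>\<^sub>2)"
  have V: "0 \<le> V" using N by (simp add: V_def)
  have L2: "(\<integral>\<^sup>+r. ennreal (indicator {0..fst X} r * (convolve X r)\<^sup>2) \<partial>lborel) \<le> ennreal V" if "X \<in> S" for X
    using convolve_L2[of X R] V0[OF that] S(1)[OF that] R'[OF that] unfolding V_def
    by (intro order_trans[OF convolve_L2[of X R] ennreal_leI]) auto
  have ito: "has_ito_integral M F W (fst X) (\<lambda>r \<omega>. f X r) (u X)" if X: "X \<in> S" for X
  proof -
    have t: "0 < fst X" "fst X \<le> T" using S(1)[OF X] by auto
    have "AE r in lborel. r \<in> {0..fst X} \<longrightarrow> f X r = convolve X r"
      using conv[of X] by eventually_elim (simp add: f_def)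
    from deterministic_ito_exists[OF convolve_measurable t L2[OF X] V this]
    obtain J where "has_ito_integral M F W (fst X) (\<lambda>r \<omega>. f X r) J" by blast
    \<comment> \<open>One version suffices for \<open>SOME\<close> to select a version; the moments
      of the selected one follow later by uniqueness.\<close>
    then have "has_ito_integral M F W (fst X) (\<lambda>r \<omega>. f X r) (ito_integral M F W (fst X) (\<lambda>r \<omega>. f X r))"
      unfolding ito_integral_def by (rule someI[of "has_ito_integral M F W (fst X) (\<lambda>r \<omega>. f X r)"])
    then show ?thesis by (simp add: u_def stochastic_convolution_def f_def[abs_def])
  qed
  have meas: "u X \<in> borel_measurable M" if "X \<in> S" for X
    using ito[OF that] by (simp add: has_ito_integral_def)
  have single: "(\<integral>\<^sup>+\<omega>. ennreal (\<bar>u X \<omega>\<bar> powr p) \<partial>M) \<le> ennreal (moment_const p * (3 * V) powr (p / 2))" if X: "X \<in> S" for X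
  proof -
    have t: "0 < fst X" "fst X \<le> T" using S(1)[OF X] by auto
    have "(\<integral>\<^sup>+r. ennreal (indicator {0..T} r * (indicator {0..fst X} r * convolve X r)\<^sup>2) \<partial>lborel)
        = (\<integral>\<^sup>+r. ennreal (indicator {0..fst X} r * (convolve X r)\<^sup>2) \<partial>lborel)"
      using t by (intro nn_integral_cong) (auto simp: indicator_def)
    then have bound: "(\<integral>\<^sup>+r. ennreal (indicator {0..T} r * (indicator {0..fst X} r * convolve X r)\<^sup>2) \<partial>lborel) \<le> ennreal V"
      using L2[OF X] by simp
    have eq: "AE r in lborel. r \<in> {0..T} \<longrightarrow> indicator {0..fst X} r * f X r - indicator {0..0} r * 0 = indicator {0..fst X} r * convolve X r"
      using conv[of X] by eventually_elim (auto simp: f_def indicator_def)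
    have "(\<integral>\<^sup>+\<omega>. ennreal (\<bar>u X \<omega> - 0\<bar> powr p) \<partial>M) \<le> ennreal (moment_const p * (3 * V) powr (p / 2))"
      by (rule ito_diff_moment[OF T ito[OF X] t(2) has_ito_integral_zero _ _ eq bound V p]) (use T in auto)
    then show ?thesis by simp
  qed
  \<comment> \<open>A bound on all distances in \<open>S\<close>: space contributes at most
    \<open>2 * R\<close> and time at most \<open>sqrt T\<close>. The 1 provides the lower bound that
    \<open>powr_le_rescaled\<close> asks for.\<close>
  define \<Delta> where "\<Delta> = 1 + 2 * R + sqrt T"
  have \<Delta>: "1 \<le> \<Delta>" using R0 T by (simp add: \<Delta>_def)
  have pd: "pdist X Y \<le> \<Delta>" if XY: "X \<in> S" "Y \<in> S" for X Y
  proof -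
    have "norm (snd X - snd Y) \<le> 2 * R"
      using R'[OF XY(1)] R'[OF XY(2)] norm_triangle_ineq4[of "snd X" "snd Y"] by linarith
    moreover have "sqrt \<bar>fst X - fst Y\<bar> \<le> sqrt T"
      using S(1)[OF XY(1)] S(1)[OF XY(2)] by (intro real_sqrt_le_mono) auto
    ultimately show ?thesis using R0 T by (auto simp: pdist_def \<Delta>_def add_increasing add_increasing2)
  qed
  define Q where "Q = 2 * (growth_const R)\<^sup>2 * (N\<^sub>1 * \<Delta> powr (2 * \<gamma>\<^sub>1)) + 2 * (C\<^sup>2 * \<Delta> powr (2 * \<beta>)) * N\<^sub>0
     + (growth_const R)\<^sup>2 * (N\<^sub>1 * \<Delta> powr (2 * \<gamma>\<^sub>2))"
  have Q: "0 \<le> Q" using N by (simp add: Q_def)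
  have diff: "(\<integral>\<^sup>+\<omega>. ennreal (\<bar>u X \<omega> - u Y \<omega>\<bar> powr p) \<partial>M)
      \<le> ennreal (moment_const p * (3 * (Q * pdist X Y powr (2 * \<gamma>))) powr (p / 2))"
    if X: "X \<in> S" and Y: "Y \<in> S" and YX: "fst Y \<le> fst X" for X Y
  proof -
    have t: "0 < fst X" "fst X \<le> T" "fst X < T" "0 < fst Y" "fst Y \<le> T" "0 \<le> fst Y" using S(1)[OF X] S(1)[OF Y] by auto
    let ?\<delta> = "pdist X Y"
    have time: "(fst X - fst Y) powr \<alpha> \<le> \<Delta> powr (2 * \<alpha>) * ?\<delta> powr (2 * \<gamma>)" if "\<gamma> \<le> \<alpha>" for \<alpha>
    proof -
      \<comment> \<open>Time exponents double: it is the square root of the time difference that the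
        parabolic distance dominates.\<close>
      have "(fst X - fst Y) powr \<alpha> = sqrt \<bar>fst X - fst Y\<bar> powr (2 * \<alpha>)"
        using YX by (simp add: powr_half_sqrt[symmetric] powr_powr)
      also have "\<dots> \<le> \<Delta> powr (2 * \<alpha>) * ?\<delta> powr (2 * \<gamma>)"
        using that \<gamma> \<Delta> pd[OF X Y] by (intro powr_le_rescaled) (auto simp: pdist_def)
      finally show ?thesis .
    qed
    have space: "(C * norm (snd X - snd Y) powr \<beta>)\<^sup>2 \<le> C\<^sup>2 * \<Delta> powr (2 * \<beta>) * ?\<delta> powr (2 * \<gamma>)"
    proof -
      have "(C * norm (snd X - snd Y) powr \<beta>)\<^sup>2 = C\<^sup>2 * norm (snd X - snd Y) powr (2 * \<beta>)"
      proof -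
        have "(x powr \<beta>)\<^sup>2 = x powr (2 * \<beta>)" for x :: real
          unfolding power2_eq_square powr_add[symmetric] mult_2 ..
        then show ?thesis by (simp only: power_mult_distrib)
      qed
      also have "\<dots> \<le> C\<^sup>2 * (\<Delta> powr (2 * \<beta>) * ?\<delta> powr (2 * \<gamma>))"
        using \<gamma> \<Delta> pd[OF X Y] by (intro mult_left_mono powr_le_rescaled) (auto simp: pdist_def)
      finally show ?thesis by (simp add: mult.assoc)
    qed
    have "2 * (growth_const R)\<^sup>2 * (N\<^sub>1 * (fst X - fst Y) powr \<gamma>\<^sub>1) + 2 * (C * norm (snd X - snd Y) powr \<beta>)\<^sup>2 * N\<^sub>0
        + (growth_const R)\<^sup>2 * (N\<^sub>1 * (fst X - fst Y) powr \<gamma>\<^sub>2)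
      \<le> 2 * (growth_const R)\<^sup>2 * (N\<^sub>1 * (\<Delta> powr (2 * \<gamma>\<^sub>1) * ?\<delta> powr (2 * \<gamma>)))
        + 2 * (C\<^sup>2 * \<Delta> powr (2 * \<beta>) * ?\<delta> powr (2 * \<gamma>)) * N\<^sub>0
        + (growth_const R)\<^sup>2 * (N\<^sub>1 * (\<Delta> powr (2 * \<gamma>\<^sub>2) * ?\<delta> powr (2 * \<gamma>)))"
      using N by (intro add_mono mult_left_mono mult_right_mono time space \<gamma>) auto
    also have "\<dots> = Q * ?\<delta> powr (2 * \<gamma>)" by (simp add: Q_def algebra_simps)
    finally have bound: "(\<integral>\<^sup>+r. ennreal (indicator {0..T} r * (indicator {0..fst X} r * convolve X r - indicator {0..fst Y} r * convolve Y r)\<^sup>2) \<partial>lborel)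
        \<le> ennreal (Q * ?\<delta> powr (2 * \<gamma>))"
      by (intro order_trans[OF convolve_diff_L2[OF t(6) YX t(3) R'[OF X]] ennreal_leI])
    have eq: "AE r in lborel. r \<in> {0..T} \<longrightarrow> indicator {0..fst X} r * f X r - indicator {0..fst Y} r * f Y r
       = indicator {0..fst X} r * convolve X r - indicator {0..fst Y} r * convolve Y r"
      using conv[of X] conv[of Y] by eventually_elim (auto simp: f_def indicator_def)
    show ?thesis
      by (rule ito_diff_moment[OF T ito[OF X] t(2) ito[OF Y] t(5) _ eq bound _ p]) (use Q in auto)
  qed
  \<comment> \<open>In the p-th root of the moment bound the exponents \<open>p / 2\<close> and
    \<open>1 / p\<close> combine to a square root, which takes \<open>2 * \<gamma>\<close> back to
    \<open>\<gamma>\<close>.\<close>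
  define L where "L = moment_const p powr (1 / p) * sqrt (3 * Q)"
  have diff_norm: "Lp_norm M p (\<lambda>\<omega>. u X \<omega> - u Y \<omega>) \<le> L * pdist X Y powr \<gamma>" if X: "X \<in> S" and Y: "Y \<in> S" for X Y
  proof -
    have bound: "(\<integral>\<^sup>+\<omega>. ennreal (\<bar>u X \<omega> - u Y \<omega>\<bar> powr p) \<partial>M)
      \<le> ennreal (moment_const p * (3 * (Q * pdist X Y powr (2 * \<gamma>))) powr (p / 2))"
    proof (cases "fst Y \<le> fst X")
      case True
      then show ?thesis by (rule diff[OF X Y])
    next
      case False
      then show ?thesis using diff[OF Y X] by (simp add: pdist_commute[of Y X] abs_minus_commute)
    qed
    have "Lp_norm M p (\<lambda>\<omega>. u X \<omega> - u Y \<omega>) \<le> (moment_const p * (3 * (Q * pdist X Y powr (2 * \<gamma>))) powr (p / 2)) powr (1 / p)"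
      using meas[OF X] meas[OF Y] moment_const_pos[of p] by (intro Lp_norm_le(2)[OF _ bound _ p]) auto
    also have "\<dots> = moment_const p powr (1 / p) * ((3 * (Q * pdist X Y powr (2 * \<gamma>))) powr (p / 2)) powr (1 / p)"
      by (rule powr_mult)
    also have "((3 * (Q * pdist X Y powr (2 * \<gamma>))) powr (p / 2)) powr (1 / p) = sqrt (3 * (Q * pdist X Y powr (2 * \<gamma>)))"
      using p Q by (simp add: powr_powr powr_half_sqrt)
    also have "\<dots> = sqrt (3 * Q) * pdist X Y powr \<gamma>"
    proof -
      have "sqrt (pdist X Y powr (2 * \<gamma>)) = pdist X Y powr \<gamma>"
        by (simp add: powr_half_sqrt[symmetric] powr_powr)
      then show ?thesis by (simp add: real_sqrt_mult)
    qed
    finally show ?thesis by (simp add: L_def mult.assoc)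
  qed
  have "bdd_above {Lp_norm M p (u X) | X. X \<in> S}"
  proof (rule bdd_aboveI)
    fix a assume "a \<in> {Lp_norm M p (u X) | X. X \<in> S}"
    then show "a \<le> (moment_const p * (3 * V) powr (p / 2)) powr (1 / p)"
      using meas single moment_const_pos[of p] by (auto intro!: Lp_norm_le(2)[OF _ _ _ p])
  qed
  moreover have "bdd_above {Lp_norm M p (\<lambda>\<omega>. u X \<omega> - u Y \<omega>) / pdist X Y powr \<gamma> | X Y. X \<in> S \<and> Y \<in> S \<and> X \<noteq> Y}"
  proof (rule bdd_aboveI)
    fix a assume "a \<in> {Lp_norm M p (\<lambda>\<omega>. u X \<omega> - u Y \<omega>) / pdist X Y powr \<gamma> | X Y. X \<in> S \<and> Y \<in> S \<and> X \<noteq> Y}"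
    then obtain X Y where XY: "X \<in> S" "Y \<in> S" "X \<noteq> Y" "a = Lp_norm M p (\<lambda>\<omega>. u X \<omega> - u Y \<omega>) / pdist X Y powr \<gamma>" by auto
    have "0 < pdist X Y"
      using XY(3) by (cases X; cases Y) (auto simp: pdist_def less_max_iff_disj)
    then show "a \<le> L" using diff_norm[OF XY(1,2)] by (simp add: XY(4) divide_le_eq)
  qed
  moreover have "in_Lp M p (u X)" if "X \<in> S" for X
    using moment_const_pos[of p] by (intro Lp_norm_le(1)[OF meas[OF that] single[OF that] _ p]) auto
  ultimately show ?thesis unfolding pholder_Lp_def u_def by blast
qed

end

text \<open>A null subset of the product has null sections at almost every time, and the reflection
  \<open>r\<close> to \<open>t - r\<close> preserves null sets. The exceptional times may depend on
  \<open>t\<close>, which is harmless since only one or two values of \<open>t\<close> occur at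
  once.\<close>

lemma lebesgue_kernel_borel_version:
  fixes K :: "real \<times> (real ^ 'd) \<Rightarrow> real"
  assumes "K \<in> borel_measurable lebesgue"
  obtains K' where "K' \<in> borel_measurable (borel \<Otimes>\<^sub>M borel)"
    "\<And>t. AE r in lborel. AE z in lborel. K (t - r, z) = K' (t - r, z)"
proof -
  obtain K' where K': "K' \<in> borel_measurable lborel" "AE x in lborel. K x = K' x"
    using completion_ex_borel_measurable_real[OF assms] by blast
  have "AE r in lborel. AE z in lborel. K (r, z) = K' (r, z)"
    by (rule lborel_pair.AE_pair) (unfold lborel_prod, rule K'(2))
  from AE_lborel_affine[OF _ this, of "- 1"]
  have "AE r in lborel. AE z in lborel. K (t - r, z) = K' (t - r, z)" for t by simp
  moreover have "K' \<in> borel_measurable (borel \<Otimes>\<^sub>M borel)"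
    using K'(1) by (simp add: borel_prod)
  ultimately show thesis using that by blast
qed

text \<open>Exchanges the kernel and the measure in one go. The nonnegative integral is the same for
  a measure and its completion whatever the function, so measurability of the sections of the
  original kernel is not at issue.\<close>

lemma nn_integral_kernel_cong:
  fixes \<Phi> \<Psi> :: "real \<Rightarrow> 'b::euclidean_space \<Rightarrow> ennreal"
  assumes "AE r in lborel. AE z in lborel. \<Phi> r z = \<Psi> r z"
  shows "(\<integral>\<^sup>+ r\<in>A. (\<integral>\<^sup>+ z. \<Psi> r z \<partial>lborel)\<^sup>2 \<partial>lborel) = (\<integral>\<^sup>+ r\<in>A. (\<integral>\<^sup>+ z. \<Phi> r z \<partial>lebesgue)\<^sup>2 \<partial>lebesgue)"
  unfolding nn_integral_completion
proof (rule nn_integral_cong_AE)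
  show "AE r in lborel. (\<integral>\<^sup>+ z. \<Psi> r z \<partial>lborel)\<^sup>2 * indicator A r = (\<integral>\<^sup>+ z. \<Phi> r z \<partial>lborel)\<^sup>2 * indicator A r"
    using assms
  proof eventually_elim
    case (elim r)
    then have "(\<integral>\<^sup>+ z. \<Phi> r z \<partial>lborel) = (\<integral>\<^sup>+ z. \<Psi> r z \<partial>lborel)" by (rule nn_integral_cong_AE)
    then show ?case by simp
  qed
qed

theorem corollary2p1:
  fixes M :: "'a measure" and F :: "real \<Rightarrow> 'a measure" and W :: "real \<Rightarrow> 'a \<Rightarrow> real"
    and T \<beta> \<gamma>\<^sub>1 \<gamma>\<^sub>2 N\<^sub>0 N\<^sub>1 :: real
    and D :: "(real \<times> (real ^ 'd)) set"
    and g K :: "real \<times> (real ^ 'd) \<Rightarrow> real"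
  assumes "prob_space M" and "complete_measure M"
    and "0 < T"
    and "complete_filtration M T F"
    and "wiener_process M T F W"
    and "open D" and "connected D" and "D \<noteq> {}" and "bounded D"
    and "A_type D"
    and "closure D \<subseteq> {0<..<T} \<times> UNIV"
    and "0 < \<beta>" and "\<beta> < 1"
    and "pholder_on ({0..} \<times> UNIV) \<beta> g" and "g (0, 0) = 0"
    and "K \<in> borel_measurable lebesgue"
    and "0 < \<gamma>\<^sub>1" and "0 < \<gamma>\<^sub>2" and "0 < N\<^sub>0" and "0 < N\<^sub>1"
    and "\<And>s t. 0 \<le> s \<Longrightarrow> s < t \<Longrightarrow> t \<le> T \<Longrightarrow>
      (\<integral>\<^sup>+ r\<in>{0..s}. (\<integral>\<^sup>+ z. ennreal (\<bar>K (t - r, z) - K (s - r, z)\<bar> * (1 + norm z powr \<beta>)) \<partial>lebesgue)\<^sup>2 \<partial>lebesgue)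
        \<le> ennreal (N\<^sub>1 * (t - s) powr \<gamma>\<^sub>1)"
    and "\<And>s t. 0 \<le> s \<Longrightarrow> s < t \<Longrightarrow> t \<le> T \<Longrightarrow>
      (\<integral>\<^sup>+ r\<in>{0..s}. (\<integral>\<^sup>+ z. ennreal \<bar>K (s - r, z)\<bar> \<partial>lebesgue)\<^sup>2 \<partial>lebesgue) \<le> ennreal N\<^sub>0"
    and "\<And>s t. 0 \<le> s \<Longrightarrow> s < t \<Longrightarrow> t \<le> T \<Longrightarrow>
      (\<integral>\<^sup>+ r\<in>{s..t}. (\<integral>\<^sup>+ z. ennreal (\<bar>K (t - r, z)\<bar> * (1 + norm z powr \<beta>)) \<partial>lebesgue)\<^sup>2 \<partial>lebesgue)
        \<le> ennreal (N\<^sub>1 * (t - s) powr \<gamma>\<^sub>2)"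
  shows "\<forall>p\<ge>1. pholder_Lp M p (min \<gamma>\<^sub>1 (min \<gamma>\<^sub>2 \<beta>)) (closure D) (stochastic_convolution M F W K g)"
proof (intro allI impI)
  fix p :: real assume p: "1 \<le> p"
  have Kleb: "K \<in> borel_measurable lebesgue" by (rule assms)
  have \<beta>: "0 < \<beta>" "\<beta> < 1" by (rule assms)+
  have T: "0 < T" by (rule assms)
  note K_diff = assms(21) and K_total = assms(22) and K_recent = assms(23)
  interpret wiener_setting M T F W
    by (intro wiener_setting.intro wiener_setting_axioms.intro) (rule assms(1,4,5))+
  obtain K' where K'[measurable]: "K' \<in> borel_measurable (borel \<Otimes>\<^sub>M borel)"
    and KK': "\<And>t. AE r in lborel. AE z in lborel. K (t - r, z) = K' (t - r, z)"
    by (rule lebesgue_kernel_borel_version[OF Kleb]) (rule that, assumption+)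
  obtain C0 where C0: "\<And>X Y. X \<in> {0..} \<times> UNIV \<Longrightarrow> Y \<in> {0..} \<times> UNIV \<Longrightarrow> \<bar>g X - g Y\<bar> \<le> C0 * pdist X Y powr \<beta>"
    using assms(14) unfolding pholder_on_def by blast
  \<comment> \<open>The constant in \<open>pholder_on\<close> carries no sign; a nonnegative one is
    wanted for monotonicity arguments.\<close>
  define C where "C = max 0 C0"
  have C: "0 \<le> C" by (simp add: C_def)
  have hold: "\<bar>g X - g Y\<bar> \<le> C * pdist X Y powr \<beta>" if "X \<in> {0..} \<times> UNIV" "Y \<in> {0..} \<times> UNIV" for X Y
  proof -
    have "C0 * pdist X Y powr \<beta> \<le> C * pdist X Y powr \<beta>" by (intro mult_right_mono) (auto simp: C_def)
    then show ?thesis using C0[OF that] by linarith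
  qed
  \<comment> \<open>Nothing is known about \<open>g\<close> at negative times, so it is cut off
    there. The result is Borel, by continuity on a closed set, and agrees with \<open>g\<close> at
    all times over which the stochastic integral extends.\<close>
  define g' where "g' = (\<lambda>z. indicator ({0..} \<times> UNIV) z *\<^sub>R g z)"
  have g'_eq: "g' (r, x) = g (r, x)" if "0 \<le> r" for r x using that by (simp add: g'_def)
  have "closed ({0::real..} \<times> (UNIV :: (real ^ 'd) set))" by (intro closed_Times) auto
  then have "g' \<in> borel_measurable borel"
    unfolding g'_def by (intro borel_measurable_continuous_on_indicator pholder_on_continuous[OF assms(14) \<beta>(1)]) auto
  then have g'[measurable]: "g' \<in> borel_measurable (borel \<Otimes>\<^sub>M borel)" by (simp add: borel_prod)
  have kernel: "holder_kernel K' g' T \<beta> C \<gamma>\<^sub>1 \<gamma>\<^sub>2 N\<^sub>0 N\<^sub>1"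
  proof
    show "\<bar>g' (r, x) - g' (r, y)\<bar> \<le> C * norm (x - y) powr \<beta>" if "0 \<le> r" for r x y
      using hold[of "(r, x)" "(r, y)"] that by (simp add: g'_eq pdist_def)
    show "\<bar>g' (r, x)\<bar> \<le> C * (norm x powr \<beta> + sqrt r powr \<beta>)" if r: "0 \<le> r" for r x
    proof -
      \<comment> \<open>Comparison with the origin, where \<open>g\<close> vanishes, turns the
        Hoelder bound into a growth bound.\<close>
      have "\<bar>g (r, x)\<bar> \<le> C * max (norm x) (sqrt r) powr \<beta>"
        using hold[of "(r, x)" "(0, 0)"] r assms(15) by (simp add: pdist_def)
      also have "\<dots> \<le> C * (norm x powr \<beta> + sqrt r powr \<beta>)"
        using C by (intro mult_left_mono) (auto simp: max_def)
      finally show ?thesis using r by (simp add: g'_eq)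
    qed
    show "(\<integral>\<^sup>+ r\<in>{0..s}. (\<integral>\<^sup>+ z. ennreal (\<bar>K' (t - r, z) - K' (s - r, z)\<bar> * (1 + norm z powr \<beta>)) \<partial>lborel)\<^sup>2 \<partial>lborel)
        \<le> ennreal (N\<^sub>1 * (t - s) powr \<gamma>\<^sub>1)" if "0 \<le> s" "s \<le> t" "t \<le> T" for s t
    proof (cases "s = t")
      case False
      have "AE r in lborel. AE z in lborel. ennreal (\<bar>K (t - r, z) - K (s - r, z)\<bar> * (1 + norm z powr \<beta>))
          = ennreal (\<bar>K' (t - r, z) - K' (s - r, z)\<bar> * (1 + norm z powr \<beta>))"
        using KK'[of t] KK'[of s]
      proof eventually_elim
        case (elim r)
        then show ?case by eventually_elim simp
      qed
      from nn_integral_kernel_cong[OF this, of "{0..s}"] K_diff[of s t] that False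
      show ?thesis by simp
    qed simp
    show "(\<integral>\<^sup>+ r\<in>{0..s}. (\<integral>\<^sup>+ z. ennreal \<bar>K' (s - r, z)\<bar> \<partial>lborel)\<^sup>2 \<partial>lborel) \<le> ennreal N\<^sub>0" if "0 \<le> s" "s < T" for s
    proof -
      have "AE r in lborel. AE z in lborel. ennreal \<bar>K (s - r, z)\<bar> = ennreal \<bar>K' (s - r, z)\<bar>"
        using KK'[of s]
      proof eventually_elim
        case (elim r)
        then show ?case by eventually_elim simp
      qed
      \<comment> \<open>The larger time does not occur in this bound, so \<open>T\<close> is put in
        its place.\<close>
      from nn_integral_kernel_cong[OF this, of "{0..s}"] K_total[of s T] that
      show ?thesis by simp
    qed
    show "(\<integral>\<^sup>+ r\<in>{s..t}. (\<integral>\<^sup>+ z. ennreal (\<bar>K' (t - r, z)\<bar> * (1 + norm z powr \<beta>)) \<partial>lborel)\<^sup>2 \<partial>lborel)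
        \<le> ennreal (N\<^sub>1 * (t - s) powr \<gamma>\<^sub>2)" if "0 \<le> s" "s \<le> t" "t \<le> T" for s t
    proof (cases "s = t")
      case True
      \<comment> \<open>For \<open>s = t\<close> the right-hand side is 0, and the interval is a
        single point, so the integral vanishes even if the weight is infinite there.\<close>
      have "AE r in lborel. (\<integral>\<^sup>+ z. ennreal (\<bar>K' (t - r, z)\<bar> * (1 + norm z powr \<beta>)) \<partial>lborel)\<^sup>2 * indicator {s..t} r = 0"
        using AE_lborel_singleton[of s] by eventually_elim (use True in \<open>auto simp: indicator_def\<close>)
      then have "(\<integral>\<^sup>+ r\<in>{s..t}. (\<integral>\<^sup>+ z. ennreal (\<bar>K' (t - r, z)\<bar> * (1 + norm z powr \<beta>)) \<partial>lborel)\<^sup>2 \<partial>lborel) = (\<integral>\<^sup>+ r. 0 \<partial>(lborel :: real measure))"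
        by (rule nn_integral_cong_AE)
      then show ?thesis by simp
    next
      case False
      have "AE r in lborel. AE z in lborel. ennreal (\<bar>K (t - r, z)\<bar> * (1 + norm z powr \<beta>)) = ennreal (\<bar>K' (t - r, z)\<bar> * (1 + norm z powr \<beta>))"
        using KK'[of t]
      proof eventually_elim
        case (elim r)
        then show ?case by eventually_elim simp
      qed
      from nn_integral_kernel_cong[OF this, of "{s..t}"] K_recent[of s t] that False
      show ?thesis by simp
    qed
  qed (use K' g' \<beta> T C assms(19,20) in auto)
  have conv: "AE r in lborel. 0 \<le> r \<longrightarrow>
       (\<integral>y. K (fst X - r, y) * g (r, snd X - y) \<partial>lebesgue) = holder_kernel.convolve K' g' X r" for X
    using KK'[of "fst X"]
  proof eventually_elim
    case (elim r)
    show ?case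
    proof
      assume r: "0 \<le> r"
      let ?f = "\<lambda>y. K (fst X - r, y) * g (r, snd X - y)" and ?f' = "\<lambda>y. K' (fst X - r, y) * g' (r, snd X - y)"
      have eq: "AE y in lborel. ?f y = ?f' y"
        using elim by eventually_elim (simp add: g'_eq[OF r])
      have meas: "?f' \<in> borel_measurable lborel" by measurable
      \<comment> \<open>For almost every time the integrand with \<open>K\<close> agrees almost
        everywhere with a Borel function of \<open>y\<close>, and this also makes it measurable for
        the completion.\<close>
      have "(\<integral>y. ?f y \<partial>lebesgue) = (\<integral>y. ?f' y \<partial>lebesgue)"
        by (intro integral_cong_AE borel_measurable_completion_cong_AE[OF meas eq] measurable_completion[OF meas] AE_completion[OF eq])
      also have "\<dots> = (\<integral>y. ?f' y \<partial>lborel)" by (rule integral_completion[OF meas])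
      finally show "(\<integral>y. ?f y \<partial>lebesgue) = holder_kernel.convolve K' g' X r"
        by (simp add: holder_kernel.convolve_def[OF kernel])
    qed
  qed
  show "pholder_Lp M p (min \<gamma>\<^sub>1 (min \<gamma>\<^sub>2 \<beta>)) (closure D) (stochastic_convolution M F W K g)"
  proof (rule holder_kernel_field[OF kernel conv])
    show "0 < fst X \<and> fst X < T" if "X \<in> closure D" for X
      using assms(11) that by auto
    show "bounded (closure D)" using \<open>bounded D\<close> by (rule bounded_closure)
  qed (use assms(12,17,18) p in auto)
qed

end
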